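(* Let $G$ be a finite innately transitive group on $\Omega$ with a non-abelian plinth $M=T_1\times\cdots\times T_k$, where $T_1,\ldots,T_k$ are the simple normal subgroups of $M$, and let $\omega\in\Omega$. Let $\mathrm x=\mathrm S$ if $M_\omega$ is a subdirect subgroup of $M$, and let $\mathrm x=1$ otherwise. Then there is a bijection between the set $\mathrm{CD}_{\mathrm x}(G)$ (defined in the context) and the set of $G$-invariant partitions $\mathcal P=\{P_1,\ldots,P_\ell\}$, $\ell\geq 2$, of $\{T_1,\ldots,T_k\}$ satisfying $$M_\omega=\sigma_{P_1}(M_\omega)\times\cdots\times\sigma_{P_\ell}(M_\omega),$$ and each $\mathcal E\in\mathrm{CD}_{\mathrm x}(G)$ arises from such a partition $\mathcal P$ by the following construction: for $i=1,\ldots,\ell$ put $K_i=\sigma_{P_i}(M_\omega)\times\prod_{T_j\notin P_i}T_j$ and let $\mathcal E=\{\Gamma_1,\ldots,\Gamma_\ell\}$, where $\Gamma_i$ is the $M$-invariant partition $\{(\omega K_i)m\mid m\in M\}$ of $\Omega$ (here $\omega K_i$ is the $K_i$-orbit of $\omega$).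
   Context: A permutation group is innately transitive if it has a transitive minimal normal subgroup; such a subgroup is called a plinth. $G$ acts on $\{T_1,\ldots,T_k\}$ by conjugation. Let $\sigma_i:M\to T_i$, and $\sigma_I:M\to\prod_{T_i\in I}T_i$ for $I\subseteq\{T_1,\ldots,T_k\}$, be the natural projections (subproducts are regarded as subgroups of $M$). A subgroup $K\leq M$ is subdirect if $\sigma_i(K)=T_i$ for all $i$. A Cartesian decomposition of $\Omega$ is a set $\{\Gamma_1,\ldots,\Gamma_\ell\}$ of $\ell\geq 2$ partitions of $\Omega$, each with at least two blocks, such that $|\gamma_1\cap\cdots\cap\gamma_\ell|=1$ for all $\gamma_1\in\Gamma_1,\ldots,\gamma_\ell\in\Gamma_\ell$. It is $G$-invariant if $G$ permutes the partitions. $\mathrm{CD}_{\mathrm{tr}}(G)$ is the set of $G$-invariant Cartesian decompositions $\mathcal E$ of $\Omega$ such that $G$ acts transitively on $\mathcal E$. For $G$-invariant $\mathcal E=\{\Gamma_1,\ldots,\Gamma_\ell\}$, each $\Gamma_j$ is $M$-invariant. For $\omega\in\Omega$ let $\gamma_j\in\Gamma_j$ be the block containing $\omega$, let $K_j=M_{\gamma_j}$ be the setwise stabiliser of $\gamma_j$ in $M$, and put $\mathcal K_\omega(\mathcal E)=\{K_1,\ldots,K_\ell\}$. A strip is a subgroup $X\leq M$ such that for each $i$ either $\sigma_i(X)=1$ or $\sigma_i(X)\cong X$; $\mathrm{Supp}\,X=\{T_i\mid\sigma_i(X)\neq1\}$; $X$ is full if $\sigma_i(X)=T_i$ for all $T_i\in\mathrm{Supp}\,X$,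 and non-trivial if $|\mathrm{Supp}\,X|\geq 2$. A non-trivial strip $X$ is involved in $K\leq M$ if $K=X\times\sigma_{\{T_1,\ldots,T_k\}\setminus\mathrm{Supp}\,X}(K)$, and is involved in $\mathcal K_\omega(\mathcal E)$ if it is involved in one of its members. Put $\mathcal F_i=\{\sigma_i(K_j)\mid j=1,\ldots,\ell,\ \sigma_i(K_j)\neq T_i\}$. For $\mathcal E\in\mathrm{CD}_{\mathrm{tr}}(G)$ (the following do not depend on the choice of $M$, $\omega$, $i$): - $\mathcal E\in\mathrm{CD}_{\mathrm S}(G)$ if the elements of $\mathcal K_\omega(\mathcal E)$ are subdirect subgroups of $M$; - $\mathcal E\in\mathrm{CD}_1(G)$ if $|\mathcal F_i|=1$ and $\mathcal K_\omega(\mathcal E)$ involves no non-trivial, full strip. *)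

theory Defs
  imports "HOL-Algebra.Group_Action" "HOL-Algebra.Generated_Groups" "HOL-Algebra.SimpleGroups"
    "HOL-Library.Disjoint_Sets"
begin

section \<open>Direct decompositions inside an ambient group\<close>

text \<open>All groups in this section are subsets of the carrier of one ambient group \<open>A\<close>.\<close>

definition minimal_normal :: "('g, 'm) monoid_scheme \<Rightarrow> 'g set \<Rightarrow> bool" where
  "minimal_normal A N \<longleftrightarrow>
     N \<lhd> A \<and> N \<noteq> {\<one>\<^bsub>A\<^esub>} \<and>
     (\<forall>L. L \<lhd> A \<and> L \<subseteq> N \<longrightarrow> L = {\<one>\<^bsub>A\<^esub>} \<or> L = N)"

definition simple_normal_subgroups :: "('g, 'm) monoid_scheme \<Rightarrow> 'g set \<Rightarrow> 'g set set" where
  "simple_normal_subgroups A M =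
     {T. T \<lhd> A\<lparr>carrier := M\<rparr> \<and> simple_group (A\<lparr>carrier := T\<rparr>)}"

text \<open>
  \<open>K\<close> is the internal direct product of the family \<open>H\<close> over \<open>I\<close>. The family is indexed
  because several of its members may be trivial, hence equal as sets.
\<close>

definition internal_direct_product ::
    "('g, 'm) monoid_scheme \<Rightarrow> 'g set \<Rightarrow> 'i set \<Rightarrow> ('i \<Rightarrow> 'g set) \<Rightarrow> bool" where
  "internal_direct_product A K I H \<longleftrightarrow>
     (\<forall>i\<in>I. H i \<lhd> A\<lparr>carrier := K\<rparr>) \<and>
     generate A (\<Union>i\<in>I. H i) = K \<and>
     (\<forall>i\<in>I. H i \<inter> generate A (\<Union>j\<in>I - {i}. H j) = {\<one>\<^bsub>A\<^esub>})"

text \<open>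
  Below, \<open>\<T>\<close> is the set of direct factors of \<open>M\<close> and \<open>I \<subseteq> \<T>\<close>. The subproduct of \<open>M\<close> over \<open>I\<close>
  is the subgroup generated by the factors in \<open>I\<close>; \<open>proj A \<T> I\<close> is the natural projection of
  \<open>M\<close> onto it, and the projection onto a single factor \<open>T\<close> is \<open>proj A \<T> {T}\<close>.
\<close>

definition subproduct :: "('g, 'm) monoid_scheme \<Rightarrow> 'g set set \<Rightarrow> 'g set" where
  "subproduct A I = generate A (\<Union>I)"

definition proj :: "('g, 'm) monoid_scheme \<Rightarrow> 'g set set \<Rightarrow> 'g set set \<Rightarrow> 'g \<Rightarrow> 'g" where
  "proj A \<T> I m =
     (THE x. x \<in> subproduct A I \<and> (\<exists>y \<in> subproduct A (\<T> - I). m = x \<otimes>\<^bsub>A\<^esub> y))"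

definition subdirect_subgroup ::
    "('g, 'm) monoid_scheme \<Rightarrow> 'g set \<Rightarrow> 'g set set \<Rightarrow> 'g set \<Rightarrow> bool" where
  "subdirect_subgroup A M \<T> K \<longleftrightarrow>
     subgroup K (A\<lparr>carrier := M\<rparr>) \<and> (\<forall>T\<in>\<T>. proj A \<T> {T} ` K = T)"

definition strip :: "('g, 'm) monoid_scheme \<Rightarrow> 'g set \<Rightarrow> 'g set set \<Rightarrow> 'g set \<Rightarrow> bool" where
  "strip A M \<T> X \<longleftrightarrow>
     subgroup X (A\<lparr>carrier := M\<rparr>) \<and>
     (\<forall>T\<in>\<T>. proj A \<T> {T} ` X = {\<one>\<^bsub>A\<^esub>} \<or>
             (A\<lparr>carrier := proj A \<T> {T} ` X\<rparr>) \<cong> (A\<lparr>carrier := X\<rparr>))"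

definition strip_support :: "('g, 'm) monoid_scheme \<Rightarrow> 'g set set \<Rightarrow> 'g set \<Rightarrow> 'g set set" where
  "strip_support A \<T> X = {T \<in> \<T>. proj A \<T> {T} ` X \<noteq> {\<one>\<^bsub>A\<^esub>}}"

definition full_strip :: "('g, 'm) monoid_scheme \<Rightarrow> 'g set \<Rightarrow> 'g set set \<Rightarrow> 'g set \<Rightarrow> bool" where
  "full_strip A M \<T> X \<longleftrightarrow>
     strip A M \<T> X \<and> (\<forall>T \<in> strip_support A \<T> X. proj A \<T> {T} ` X = T)"

definition nontrivial_strip ::
    "('g, 'm) monoid_scheme \<Rightarrow> 'g set \<Rightarrow> 'g set set \<Rightarrow> 'g set \<Rightarrow> bool" where
  "nontrivial_strip A M \<T> X \<longleftrightarrow> strip A M \<T> X \<and> 2 \<le> card (strip_support A \<T> X)"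

text \<open>
  The product in the next definition is automatically direct, since its two factors lie in the
  subproducts over two disjoint sets of direct factors of \<open>M\<close>.
\<close>

definition involved ::
    "('g, 'm) monoid_scheme \<Rightarrow> 'g set \<Rightarrow> 'g set set \<Rightarrow> 'g set \<Rightarrow> 'g set \<Rightarrow> bool" where
  "involved A M \<T> X K \<longleftrightarrow>
     nontrivial_strip A M \<T> X \<and> subgroup K (A\<lparr>carrier := M\<rparr>) \<and>
     K = X <#>\<^bsub>A\<^esub> (proj A \<T> (\<T> - strip_support A \<T> X) ` K)"


section \<open>Innately transitive permutation groups\<close>

text \<open>
  Permutations act on the left. For sets of permutations, \<open>perm_group \<Omega> H\<close> is \<open>H\<close> with the
  operations of the symmetric group on \<open>\<Omega>\<close>.
\<close>

abbreviation perm_group :: "'a set \<Rightarrow> ('a \<Rightarrow> 'a) set \<Rightarrow> ('a \<Rightarrow> 'a) monoid" where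
  "perm_group \<Omega> H \<equiv> BijGroup \<Omega>\<lparr>carrier := H\<rparr>"

definition plinth :: "'a set \<Rightarrow> ('a \<Rightarrow> 'a) set \<Rightarrow> ('a \<Rightarrow> 'a) set \<Rightarrow> bool" where
  "plinth \<Omega> G M \<longleftrightarrow>
     minimal_normal (perm_group \<Omega> G) M \<and> transitive_action (perm_group \<Omega> M) \<Omega> id"

definition innately_transitive :: "'a set \<Rightarrow> ('a \<Rightarrow> 'a) set \<Rightarrow> bool" where
  "innately_transitive \<Omega> G \<longleftrightarrow> subgroup G (BijGroup \<Omega>) \<and> (\<exists>M. plinth \<Omega> G M)"

abbreviation point_stabilizer :: "'a set \<Rightarrow> ('a \<Rightarrow> 'a) set \<Rightarrow> 'a \<Rightarrow> ('a \<Rightarrow> 'a) set" where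
  "point_stabilizer \<Omega> M \<omega> \<equiv> stabilizer (perm_group \<Omega> M) id \<omega>"


section \<open>Invariant Cartesian decompositions\<close>

definition cartesian_decomposition :: "'a set \<Rightarrow> 'a set set set \<Rightarrow> bool" where
  "cartesian_decomposition \<Omega> \<E> \<longleftrightarrow>
     2 \<le> card \<E> \<and>
     (\<forall>\<Gamma>\<in>\<E>. partition_on \<Omega> \<Gamma> \<and> (\<exists>\<gamma>\<in>\<Gamma>. \<exists>\<delta>\<in>\<Gamma>. \<gamma> \<noteq> \<delta>)) \<and>
     (\<forall>s. (\<forall>\<Gamma>\<in>\<E>. s \<Gamma> \<in> \<Gamma>) \<longrightarrow> card (\<Inter>\<Gamma>\<in>\<E>. s \<Gamma>) = 1)"

text \<open>A permutation \<open>g\<close> maps a partition \<open>\<Gamma>\<close> of \<open>\<Omega>\<close> to the partition \<open>((`) g) ` \<Gamma>\<close>.\<close>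

definition CD_tr :: "'a set \<Rightarrow> ('a \<Rightarrow> 'a) set \<Rightarrow> 'a set set set set" where
  "CD_tr \<Omega> G =
     {\<E>. cartesian_decomposition \<Omega> \<E> \<and>
         (\<forall>g\<in>G. (\<lambda>\<Gamma>. ((`) g) ` \<Gamma>) ` \<E> = \<E>) \<and>
         (\<forall>\<Gamma>\<in>\<E>. \<forall>\<Delta>\<in>\<E>. \<exists>g\<in>G. ((`) g) ` \<Gamma> = \<Delta>)}"

definition block_stabilizers ::
    "'a set \<Rightarrow> ('a \<Rightarrow> 'a) set \<Rightarrow> 'a \<Rightarrow> 'a set set set \<Rightarrow> ('a \<Rightarrow> 'a) set set" where
  "block_stabilizers \<Omega> M \<omega> \<E> =
     (\<lambda>\<Gamma>. stabilizer (perm_group \<Omega> M) (`) (THE \<gamma>. \<gamma> \<in> \<Gamma> \<and> \<omega> \<in> \<gamma>)) ` \<E>"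

definition proper_projections ::
    "('g, 'm) monoid_scheme \<Rightarrow> 'g set set \<Rightarrow> 'g set set \<Rightarrow> 'g set \<Rightarrow> 'g set set" where
  "proper_projections A \<T> \<K> T =
     {proj A \<T> {T} ` K | K. K \<in> \<K> \<and> proj A \<T> {T} ` K \<noteq> T}"

definition CD_S ::
    "'a set \<Rightarrow> ('a \<Rightarrow> 'a) set \<Rightarrow> ('a \<Rightarrow> 'a) set \<Rightarrow> ('a \<Rightarrow> 'a) set set \<Rightarrow> 'a \<Rightarrow> 'a set set set set"
  where
  "CD_S \<Omega> G M \<T> \<omega> =
     {\<E> \<in> CD_tr \<Omega> G.
        \<forall>K \<in> block_stabilizers \<Omega> M \<omega> \<E>. subdirect_subgroup (BijGroup \<Omega>) M \<T> K}"

text \<open>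
  For \<open>G\<close>-transitive decompositions the number of proper projections is the same for all direct
  factors, so quantifying over all \<open>T \<in> \<T>\<close> agrees with choosing one.
\<close>

definition CD_1 ::
    "'a set \<Rightarrow> ('a \<Rightarrow> 'a) set \<Rightarrow> ('a \<Rightarrow> 'a) set \<Rightarrow> ('a \<Rightarrow> 'a) set set \<Rightarrow> 'a \<Rightarrow> 'a set set set set"
  where
  "CD_1 \<Omega> G M \<T> \<omega> =
     {\<E> \<in> CD_tr \<Omega> G.
        (\<forall>T\<in>\<T>. card (proper_projections (BijGroup \<Omega>) \<T> (block_stabilizers \<Omega> M \<omega> \<E>) T) = 1) \<and>
        \<not> (\<exists>K \<in> block_stabilizers \<Omega> M \<omega> \<E>. \<exists>X.
             full_strip (BijGroup \<Omega>) M \<T> X \<and> nontrivial_strip (BijGroup \<Omega>) M \<T> X \<and>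
             involved (BijGroup \<Omega>) M \<T> X K)}"


section \<open>Partitions of the set of direct factors\<close>

definition conj_subgroup :: "('g, 'm) monoid_scheme \<Rightarrow> 'g \<Rightarrow> 'g set \<Rightarrow> 'g set" where
  "conj_subgroup A g T = g <#\<^bsub>A\<^esub> T #>\<^bsub>A\<^esub> inv\<^bsub>A\<^esub> g"

definition factorising_partitions ::
    "'a set \<Rightarrow> ('a \<Rightarrow> 'a) set \<Rightarrow> ('a \<Rightarrow> 'a) set \<Rightarrow> ('a \<Rightarrow> 'a) set set \<Rightarrow> 'a \<Rightarrow> ('a \<Rightarrow> 'a) set set set set"
  where
  "factorising_partitions \<Omega> G M \<T> \<omega> =
     {\<P>. partition_on \<T> \<P> \<and> 2 \<le> card \<P> \<and>
         (\<forall>g\<in>G. (\<lambda>P. conj_subgroup (BijGroup \<Omega>) g ` P) ` \<P> = \<P>) \<and>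
         internal_direct_product (BijGroup \<Omega>) (point_stabilizer \<Omega> M \<omega>) \<P>
           (\<lambda>P. proj (BijGroup \<Omega>) \<T> P ` point_stabilizer \<Omega> M \<omega>)}"

definition part_subgroup ::
    "'a set \<Rightarrow> ('a \<Rightarrow> 'a) set \<Rightarrow> ('a \<Rightarrow> 'a) set set \<Rightarrow> 'a \<Rightarrow> ('a \<Rightarrow> 'a) set set \<Rightarrow> ('a \<Rightarrow> 'a) set"
  where
  "part_subgroup \<Omega> M \<T> \<omega> P =
     (proj (BijGroup \<Omega>) \<T> P ` point_stabilizer \<Omega> M \<omega>) <#>\<^bsub>BijGroup \<Omega>\<^esub>
       subproduct (BijGroup \<Omega>) (\<T> - P)"

definition cartesian_of_partition ::
    "'a set \<Rightarrow> ('a \<Rightarrow> 'a) set \<Rightarrow> ('a \<Rightarrow> 'a) set set \<Rightarrow> 'a \<Rightarrow> ('a \<Rightarrow> 'a) set set set \<Rightarrow> 'a set set set"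
  where
  "cartesian_of_partition \<Omega> M \<T> \<omega> \<P> =
     (\<lambda>P. {m ` orbit (perm_group \<Omega> (part_subgroup \<Omega> M \<T> \<omega> P)) id \<omega> | m. m \<in> M}) ` \<P>"

end

theory Submission
  imports Defs "HOL-Combinatorics.Permutations"
begin

text \<open>
  Write \<open>S(I)\<close> for the subproduct of \<open>M\<close> over a set \<open>I\<close> of factors, \<open>H\<close> for the stabiliser of
  \<open>\<omega>\<close> in \<open>M\<close>, and \<open>K\<^sub>\<Gamma>\<close> for the stabiliser in \<open>M\<close> of the block of \<open>\<Gamma>\<close> that contains \<open>\<omega>\<close>.

  The construction can be described without reference to \<open>\<omega>\<close>. The subgroup attached to a part
  \<open>P\<close> is \<open>S(\<T> - P) H\<close>, so the partition attached to \<open>P\<close> consists of the orbits of \<open>S(\<T> - P)\<close>, a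
  normal subgroup of \<open>M\<close> (\<open>part_subgroup_eq\<close>, \<open>cartesian_of_partition_eq\<close>). Hence \<open>g \<in> G\<close> carries
  the partition attached to \<open>P\<close> to the one attached to the conjugate of \<open>P\<close>, which gives invariance;
  transitivity follows because \<open>G\<close> permutes the factors transitively (\<open>conj_transitive\<close>). A point
  with prescribed blocks is found coordinate by coordinate (\<open>cart_choice_exists\<close>), and it is unique
  because \<open>H\<close> contains its projections (\<open>cart_choice_unique\<close>). The subgroup \<open>S(\<T> - P) H\<close> contains
  the factors outside \<open>P\<close> and has the same projection as \<open>H\<close> to each factor in \<open>P\<close>. So the
  decomposition lies in \<open>CD_S\<close> if \<open>H\<close> is subdirect; otherwise \<open>H\<close> projects properly to every factor
  (\<open>projection_onto_factor_conj\<close>), and the decomposition lies in \<open>CD_1\<close> (\<open>cart_CD_1\<close>).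

  The inverse sends \<open>\<Gamma>\<close> to the set \<open>P\<^sub>\<Gamma>\<close> of the factors that are not contained in \<open>K\<^sub>\<Gamma>\<close>; these are
  the factors that move some block of \<open>\<Gamma>\<close>, again a condition without \<open>\<omega>\<close>. Suppose that every
  factor is moved by exactly one \<open>\<Gamma> \<in> \<E>\<close>. Then the sets \<open>P\<^sub>\<Gamma>\<close> partition \<open>\<T>\<close> and
  \<open>S(\<T> - P\<^sub>\<Gamma>) \<le> K\<^sub>\<Gamma>\<close>. The projection of an element of \<open>K\<^sub>\<Gamma>\<close> to \<open>P\<^sub>\<Gamma>\<close> therefore lies in \<open>K\<^sub>\<Gamma>\<close> and
  in every other \<open>K\<^sub>\<Delta>\<close>, hence in \<open>\<Inter>\<Gamma>. K\<^sub>\<Gamma> = H\<close>. So \<open>H\<close> is the product of its projections, and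
  the construction applied to \<open>{P\<^sub>\<Gamma>}\<close> returns \<open>\<E>\<close> (\<open>cartesian_of_moved_factors\<close>).

  It remains to see that each factor \<open>T\<close> is moved by exactly one \<open>\<Gamma> \<in> \<E>\<close>. It is moved by at
  least one, since otherwise \<open>T \<le> H\<close>, and \<open>T\<close>, being normal in the transitive group \<open>M\<close>, would fix
  all points. That there is only one has a different reason in each of the two cases.

  For \<open>\<E>\<close> in \<open>CD_1\<close>: distinct \<open>\<Gamma>\<close>, \<open>\<Delta>\<close> satisfy \<open>K\<^sub>\<Gamma> K\<^sub>\<Delta> = M\<close>, so they cannot both project to the
  single proper subgroup of \<open>T\<close> that occurs. If \<open>K\<^sub>\<Gamma>\<close> projects onto \<open>T\<close>, then a minimality argument
  in the style of Scott's lemma (\<open>strip_through_factor\<close>) yields a full strip involved in \<open>K\<^sub>\<Gamma>\<close> and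
  with \<open>T\<close> in its support; it must be trivial, that is, \<open>T \<le> K\<^sub>\<Gamma>\<close>. Coordinates at which \<open>K\<^sub>\<Gamma>\<close> is
  not onto do not interfere, because groups smaller than \<open>T\<close> have no section isomorphic to \<open>T\<close>.

  For \<open>\<E>\<close> in \<open>CD_S\<close>: this is a count. For subdirect \<open>K\<close>, the product of the orders of the
  factors outside \<open>K\<close> is at most \<open>|M:K|\<^sup>2\<close> (\<open>card_subdirect_le\<close>), because such factors are linked by
  strips at least in pairs. By transitivity all factors are moved by the same number \<open>e\<close> of
  partitions, so multiplying over \<open>\<E>\<close> gives \<open>|M|\<^sup>e \<le> |\<Omega>|\<^sup>2\<close>. If \<open>e \<ge> 2\<close>, then \<open>|M| \<le> |\<Omega>|\<close>
  and \<open>H = 1\<close>, which is not subdirect.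

  All of this presupposes that \<open>M\<close> fixes each partition in \<open>\<E>\<close> (\<open>CD_M_invariant\<close>). Otherwise, by
  minimality, \<open>M\<close> acts faithfully on the \<open>l\<close> partitions, each with \<open>m \<ge> 2\<close> blocks say, and
  \<open>|\<Omega>| = m\<^sup>l\<close> divides \<open>|M|\<close>, which divides \<open>l!\<close>; that is impossible (\<open>power_not_dvd_fact\<close>).
\<close>

section \<open>Internal direct products and their projections\<close>

lemma (in group) normal_in_subgroup_iff:
  assumes "subgroup M G"
  shows "N \<lhd> G\<lparr>carrier := M\<rparr> \<longleftrightarrow>
           subgroup N G \<and> N \<subseteq> M \<and> (\<forall>m\<in>M. \<forall>x\<in>N. m \<otimes> x \<otimes> inv m \<in> N)"
proof -
  interpret M: group "G\<lparr>carrier := M\<rparr>" using assms by (rule subgroup_imp_group)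
  have "subgroup N (G\<lparr>carrier := M\<rparr>) \<longleftrightarrow> subgroup N G \<and> N \<subseteq> M"
    using incl_subgroup[OF assms] subgroup_incl[OF _ assms] subgroup.subset by fastforce
  then show ?thesis
    unfolding M.normal_inv_iff using assms by (auto simp: m_inv_consistent)
qed

locale direct_factors = group A for A (structure) +
  fixes M :: "'a set" and \<T> :: "'a set set"
  assumes M_subgroup: "subgroup M A"
    and finite_factors: "finite \<T>"
    and factor_normal: "T \<in> \<T> \<Longrightarrow> T \<lhd> A\<lparr>carrier := M\<rparr>"
    and generate_factors: "generate A (\<Union>\<T>) = M"
    and factor_independent: "T \<in> \<T> \<Longrightarrow> T \<inter> generate A (\<Union>(\<T> - {T})) = {\<one>}"
begin

lemma M_carrier: "M \<subseteq> carrier A"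
  using M_subgroup by (rule subgroup.subset)

lemma in_carrier [simp, intro]: "m \<in> M \<Longrightarrow> m \<in> carrier A"
  using M_carrier by blast

lemma M_closed [simp]:
  "\<one> \<in> M" "\<lbrakk>m \<in> M; n \<in> M\<rbrakk> \<Longrightarrow> m \<otimes> n \<in> M" "m \<in> M \<Longrightarrow> inv m \<in> M"
  using M_subgroup by (simp_all add: subgroup.one_closed subgroup.m_closed subgroup.m_inv_closed)

lemma factor_subgroup: "T \<in> \<T> \<Longrightarrow> subgroup T A"
  and factor_subset: "T \<in> \<T> \<Longrightarrow> T \<subseteq> M"
  and factor_conj: "\<lbrakk>T \<in> \<T>; m \<in> M; x \<in> T\<rbrakk> \<Longrightarrow> m \<otimes> x \<otimes> inv m \<in> T"
proof -
  assume "T \<in> \<T>"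
  note * = factor_normal[OF this, unfolded normal_in_subgroup_iff[OF M_subgroup]]
  show "subgroup T A" "T \<subseteq> M" using * by auto
  show "\<lbrakk>m \<in> M; x \<in> T\<rbrakk> \<Longrightarrow> m \<otimes> x \<otimes> inv m \<in> T" using * by auto
qed

abbreviation pr where "pr I \<equiv> proj A \<T> I"
abbreviation sp where "sp I \<equiv> subproduct A I"

lemma subproduct_normal: "I \<subseteq> \<T> \<Longrightarrow> sp I \<lhd> A\<lparr>carrier := M\<rparr>"
proof -
  assume I: "I \<subseteq> \<T>"
  interpret M: group "A\<lparr>carrier := M\<rparr>" using M_subgroup by (rule subgroup_imp_group)
  have U: "\<Union>I \<subseteq> M" using I factor_subset by blast
  have "generate (A\<lparr>carrier := M\<rparr>) (\<Union>I) \<lhd> A\<lparr>carrier := M\<rparr>"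
  proof (rule M.normal_generateI)
    show "\<Union>I \<subseteq> carrier (A\<lparr>carrier := M\<rparr>)" using U by simp
    fix h g assume "h \<in> \<Union>I" "g \<in> carrier (A\<lparr>carrier := M\<rparr>)"
    then obtain T where "T \<in> I" "h \<in> T" "g \<in> M" by auto
    then have "g \<otimes> h \<otimes> inv g \<in> T" using I factor_conj by blast
    then show "g \<otimes>\<^bsub>A\<lparr>carrier := M\<rparr>\<^esub> h \<otimes>\<^bsub>A\<lparr>carrier := M\<rparr>\<^esub> inv\<^bsub>A\<lparr>carrier := M\<rparr>\<^esub> g \<in> \<Union>I"
      using \<open>T \<in> I\<close> \<open>g \<in> M\<close> M_subgroup by auto
  qed
  then show ?thesis
    unfolding subproduct_def using generate_consistent[OF U M_subgroup] by simp
qed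

lemma subproduct_subgroup: "I \<subseteq> \<T> \<Longrightarrow> subgroup (sp I) A"
  and subproduct_subset: "I \<subseteq> \<T> \<Longrightarrow> sp I \<subseteq> M"
  and subproduct_conj:
    "\<lbrakk>I \<subseteq> \<T>; m \<in> M; x \<in> sp I\<rbrakk> \<Longrightarrow> m \<otimes> x \<otimes> inv m \<in> sp I"
proof -
  assume "I \<subseteq> \<T>"
  note * = subproduct_normal[OF this, unfolded normal_in_subgroup_iff[OF M_subgroup]]
  show "subgroup (sp I) A" "sp I \<subseteq> M" using * by auto
  show "\<lbrakk>m \<in> M; x \<in> sp I\<rbrakk> \<Longrightarrow> m \<otimes> x \<otimes> inv m \<in> sp I" using * by auto
qed

lemma subproduct_in [intro]: "\<lbrakk>x \<in> sp I; I \<subseteq> \<T>\<rbrakk> \<Longrightarrow> x \<in> M"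
  using subproduct_subset by blast

lemma subproduct_closed:
  assumes "I \<subseteq> \<T>"
  shows "\<one> \<in> sp I"
    and "\<lbrakk>x \<in> sp I; y \<in> sp I\<rbrakk> \<Longrightarrow> x \<otimes> y \<in> sp I"
    and "x \<in> sp I \<Longrightarrow> inv x \<in> sp I"
  using subproduct_subgroup[OF assms]
  by (simp_all add: subgroup.one_closed subgroup.m_closed subgroup.m_inv_closed)

lemma subproduct_mono: "I \<subseteq> J \<Longrightarrow> sp I \<subseteq> sp J"
  unfolding subproduct_def by (rule mono_generate) auto

lemma factor_in_subproduct: "T \<in> I \<Longrightarrow> T \<subseteq> sp I"
  unfolding subproduct_def by (auto intro: generate.incl)

lemma subproduct_minimal: "\<lbrakk>subgroup H A; \<And>T. T \<in> I \<Longrightarrow> T \<subseteq> H\<rbrakk> \<Longrightarrow> sp I \<subseteq> H"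
  unfolding subproduct_def by (rule generate_subgroup_incl) auto

lemma subproduct_all: "sp \<T> = M"
  unfolding subproduct_def by (rule generate_factors)

lemma subproduct_empty: "sp {} = {\<one>}"
  unfolding subproduct_def by (simp add: generate_empty)

lemma subproduct_single: "T \<in> \<T> \<Longrightarrow> sp {T} = T"
  using subproduct_minimal[of T "{T}"] factor_subgroup factor_in_subproduct[of T "{T}"] by blast

lemma subproduct_UnE:
  assumes I: "I \<subseteq> \<T>" and J: "J \<subseteq> \<T>" and x: "x \<in> sp (I \<union> J)"
  obtains a b where "a \<in> sp I" "b \<in> sp J" "x = a \<otimes> b"
proof -
  let ?D = "{a \<otimes> b |a b. a \<in> sp I \<and> b \<in> sp J}"
  have "sp (I \<union> J) \<subseteq> ?D"
  proof (rule subproduct_minimal)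
    have "subgroup (sp I <#> sp J) A"
    proof (rule subgroupI)
      show "sp I <#> sp J \<subseteq> carrier A"
        using I J by (auto simp: set_mult_def)
      show "sp I <#> sp J \<noteq> {}"
        using subproduct_closed(1) I J by (auto simp: set_mult_def)
      fix u assume "u \<in> sp I <#> sp J"
      then obtain a b where ab: "a \<in> sp I" "b \<in> sp J" "u = a \<otimes> b"
        by (auto simp: set_mult_def)
      have c: "a \<in> M" "b \<in> M" using ab I J by auto
      have "inv u = (inv b \<otimes> inv a \<otimes> inv (inv b)) \<otimes> inv b"
        using ab c by (simp add: inv_mult_group m_assoc)
      moreover have "inv b \<otimes> inv a \<otimes> inv (inv b) \<in> sp I" "inv b \<in> sp J"
        using subproduct_conj[OF I, of "inv b" "inv a"] subproduct_closed(3)[OF I ab(1)]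
          subproduct_closed(3)[OF J ab(2)] c by simp_all
      ultimately show "inv u \<in> sp I <#> sp J"
        by (auto simp: set_mult_def)
      fix v assume "v \<in> sp I <#> sp J"
      then obtain a' b' where ab': "a' \<in> sp I" "b' \<in> sp J" "v = a' \<otimes> b'"
        by (auto simp: set_mult_def)
      have c': "a' \<in> M" "b' \<in> M" using ab' I J by auto
      have "u \<otimes> v = (a \<otimes> (b \<otimes> a' \<otimes> inv b)) \<otimes> (b \<otimes> b')"
        using ab ab' c c' by (simp add: m_assoc inv_solve_left)
      moreover have "a \<otimes> (b \<otimes> a' \<otimes> inv b) \<in> sp I" "b \<otimes> b' \<in> sp J"
        using subproduct_conj[OF I c(2) ab'(1)] subproduct_closed(2)[OF I ab(1)]
          subproduct_closed(2)[OF J ab(2) ab'(2)] by simp_all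
      ultimately show "u \<otimes> v \<in> sp I <#> sp J"
        by (auto simp: set_mult_def)
    qed
    then show "subgroup ?D A"
      by (rule back_subst[of "\<lambda>H. subgroup H A"]) (auto simp: set_mult_def)
    fix T assume "T \<in> I \<union> J"
    then show "T \<subseteq> ?D"
    proof
      assume T: "T \<in> I"
      show ?thesis
      proof
        fix t assume "t \<in> T"
        then have "t \<in> sp I" "t \<in> carrier A"
          using factor_in_subproduct[OF T] I by (auto intro!: in_carrier)
        then show "t \<in> ?D"
          using subproduct_closed(1)[OF J] by (intro CollectI exI[of _ t] exI[of _ \<one>]) auto
      qed
    next
      assume T: "T \<in> J"
      show ?thesis
      proof
        fix t assume "t \<in> T"
        then have "t \<in> sp J" "t \<in> carrier A"
          using factor_in_subproduct[OF T] J by (auto intro!: in_carrier)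
        then show "t \<in> ?D"
          using subproduct_closed(1)[OF I] by (intro CollectI exI[of _ \<one>] exI[of _ t]) auto
      qed
    qed
  qed
  then show thesis using x that by blast
qed

text \<open>
  Each factor is independent of all the others together. Peeling one factor at a time off an element
  of the first subproduct turns this into independence of disjoint sets of factors.
\<close>
lemma subproduct_disjoint:
  assumes "I \<subseteq> \<T>" "J \<subseteq> \<T>" "I \<inter> J = {}"
  shows "sp I \<inter> sp J = {\<one>}"
proof -
  have "finite I" using assms(1) finite_factors finite_subset by blast
  then have "x = \<one>" if "x \<in> sp I" "x \<in> sp J" for x
    using assms that
  proof (induction I arbitrary: x)
    case empty
    then show ?case by (simp add: subproduct_empty)
  next
    case (insert T I)
    have "x \<in> sp ({T} \<union> I)" using insert.prems by simp
    then obtain t a where ta: "t \<in> sp {T}" "a \<in> sp I" "x = t \<otimes> a"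
      using subproduct_UnE[of "{T}" I x] insert.prems by auto
    have t: "t \<in> T" and T: "T \<in> \<T>" using ta(1) subproduct_single insert.prems by auto
    have c: "t \<in> M" "a \<in> M" "x \<in> M"
      using ta t T insert.prems factor_subset[OF T] by auto
    have sub: "I \<union> J \<subseteq> \<T> - {T}" using insert by auto
    have "t = x \<otimes> inv a" using ta c by (simp add: m_assoc)
    moreover have "x \<in> sp (\<T> - {T})" "a \<in> sp (\<T> - {T})"
      using insert.prems ta sub subproduct_mono[of J "\<T> - {T}"] subproduct_mono[of I "\<T> - {T}"]
      by auto
    ultimately have "t \<in> sp (\<T> - {T})"
      by (auto intro!: subproduct_closed)
    then have "t = \<one>" using factor_independent[OF T] t by (auto simp: subproduct_def)
    then have "x = a" using ta c by simp
    then show ?case using insert ta by auto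
  qed
  then show ?thesis using subproduct_closed(1) assms by auto
qed

lemma subproduct_commute:
  assumes "I \<subseteq> \<T>" "J \<subseteq> \<T>" "I \<inter> J = {}" "x \<in> sp I" "y \<in> sp J"
  shows "x \<otimes> y = y \<otimes> x"
proof -
  have c: "x \<in> M" "y \<in> M" using assms by auto
  have "x \<otimes> y \<otimes> inv x \<otimes> inv y \<in> sp J"
    using assms c by (auto intro!: subproduct_closed subproduct_conj)
  moreover have "x \<otimes> (y \<otimes> inv x \<otimes> inv y) \<in> sp I"
    using assms c by (auto intro!: subproduct_closed subproduct_conj)
  ultimately have "x \<otimes> y \<otimes> inv x \<otimes> inv y = \<one>"
    using subproduct_disjoint[OF assms(1-3)] c by (auto simp: m_assoc)
  then have "x \<otimes> y \<otimes> inv (y \<otimes> x) = \<one>" using c by (simp add: m_assoc inv_mult_group)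
  then show ?thesis using c by (metis M_closed(2) in_carrier inv_equality inv_inv m_closed inv_closed)
qed

lemma proj_eqI:
  assumes I: "I \<subseteq> \<T>" and x: "x \<in> sp I" and y: "y \<in> sp (\<T> - I)"
  shows "pr I (x \<otimes> y) = x"
  unfolding proj_def
proof (rule the_equality)
  show "x \<in> sp I \<and> (\<exists>y'\<in>sp (\<T> - I). x \<otimes> y = x \<otimes> y')" using x y by auto
next
  fix x' assume "x' \<in> sp I \<and> (\<exists>y'\<in>sp (\<T> - I). x \<otimes> y = x' \<otimes> y')"
  then obtain y' where x': "x' \<in> sp I" and y': "y' \<in> sp (\<T> - I)"
    and eq: "x \<otimes> y = x' \<otimes> y'" by auto
  have c: "x \<in> M" "y \<in> M" "x' \<in> M" "y' \<in> M"
    using x y x' y' I subproduct_in[of _ "\<T> - I"] by auto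
  have "inv x' \<otimes> x = y' \<otimes> inv y"
    using eq c by (metis in_carrier inv_closed inv_solve_left inv_solve_right m_assoc m_closed)
  moreover have "inv x' \<otimes> x \<in> sp I" "y' \<otimes> inv y \<in> sp (\<T> - I)"
    using x y x' y' I by (auto intro!: subproduct_closed)
  ultimately have "inv x' \<otimes> x = \<one>"
    using subproduct_disjoint[of I "\<T> - I"] I by auto
  then show "x' = x" using c by (metis in_carrier inv_closed inv_equality inv_inv)
qed

lemma proj_decompose:
  assumes I: "I \<subseteq> \<T>" and m: "m \<in> M"
  shows "pr I m \<in> sp I"
    and "m = pr I m \<otimes> pr (\<T> - I) m"
proof -
  have "m \<in> sp (I \<union> (\<T> - I))" using I m subproduct_all by (simp add: Un_absorb1)
  then obtain a b where ab: "a \<in> sp I" "b \<in> sp (\<T> - I)" "m = a \<otimes> b"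
    using subproduct_UnE[OF I, of "\<T> - I"] by blast
  have "m = b \<otimes> a" using ab subproduct_commute[of I "\<T> - I"] I by auto
  moreover have "\<T> - (\<T> - I) = I" using I by auto
  ultimately have "pr I m = a" "pr (\<T> - I) m = b"
    using ab proj_eqI[OF I, of a b] proj_eqI[of "\<T> - I" b a] by auto
  then show "pr I m \<in> sp I" "m = pr I m \<otimes> pr (\<T> - I) m"
    using ab by auto
qed

lemma proj_in_M [simp]: "\<lbrakk>I \<subseteq> \<T>; m \<in> M\<rbrakk> \<Longrightarrow> pr I m \<in> M"
  using proj_decompose(1) by auto

lemma proj_factor: "\<lbrakk>T \<in> \<T>; m \<in> M\<rbrakk> \<Longrightarrow> pr {T} m \<in> T"
  using proj_decompose(1)[of "{T}" m] subproduct_single by auto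

lemma proj_id: "\<lbrakk>I \<subseteq> \<T>; x \<in> sp I\<rbrakk> \<Longrightarrow> pr I x = x"
  using proj_eqI[of I x \<one>] subproduct_closed(1)[of "\<T> - I"] subproduct_in[of x I] by auto

lemma proj_trivial:
  assumes "I \<subseteq> \<T>" "J \<subseteq> \<T>" "I \<inter> J = {}" "x \<in> sp J"
  shows "pr I x = \<one>"
proof -
  have "x \<in> sp (\<T> - I)" using assms subproduct_mono[of J "\<T> - I"] by auto
  then have "pr I (\<one> \<otimes> x) = \<one>" using assms by (intro proj_eqI subproduct_closed) auto
  then show ?thesis using assms subproduct_in[of x J] by simp
qed

lemma proj_mult:
  assumes I: "I \<subseteq> \<T>" and m: "m \<in> M" and n: "n \<in> M"
  shows "pr I (m \<otimes> n) = pr I m \<otimes> pr I n"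
proof -
  define a b where "a = pr I m" and "b = pr (\<T> - I) m"
  define c d where "c = pr I n" and "d = pr (\<T> - I) n"
  have s: "a \<in> sp I" "c \<in> sp I"
    "b \<in> sp (\<T> - I)" "d \<in> sp (\<T> - I)"
    using proj_decompose(1) assms by (auto simp: a_def b_def c_def d_def)
  have M: "a \<in> M" "b \<in> M" "c \<in> M" "d \<in> M" using s I subproduct_in[of _ "\<T> - I"] by auto
  have mn: "m = a \<otimes> b" "n = c \<otimes> d"
    using proj_decompose(2)[OF I] m n by (simp_all add: a_def b_def c_def d_def)
  have bc: "c \<otimes> b = b \<otimes> c" using subproduct_commute[of I "\<T> - I" c b] s I by auto
  have "m \<otimes> n = a \<otimes> (b \<otimes> c) \<otimes> d" using mn M by (simp add: m_assoc)
  also have "\<dots> = (a \<otimes> c) \<otimes> (b \<otimes> d)" using M by (simp add: m_assoc flip: bc)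
  finally have "pr I (m \<otimes> n) = a \<otimes> c"
    using s I proj_eqI[of I "a \<otimes> c" "b \<otimes> d"] by (auto intro!: subproduct_closed)
  then show ?thesis by (simp add: a_def c_def)
qed

lemma proj_one [simp]: "I \<subseteq> \<T> \<Longrightarrow> pr I \<one> = \<one>"
  using proj_id subproduct_closed(1) by auto

lemma proj_inv: "\<lbrakk>I \<subseteq> \<T>; m \<in> M\<rbrakk> \<Longrightarrow> pr I (inv m) = inv (pr I m)"
  using proj_mult[of I "inv m" m] by (metis M_closed(3) in_carrier inv_equality l_inv proj_in_M proj_one)

lemma proj_group_hom: "I \<subseteq> \<T> \<Longrightarrow> group_hom (A\<lparr>carrier := M\<rparr>) A (pr I)"
  using subgroup_imp_group[OF M_subgroup]
  by (intro group_hom.intro group_hom_axioms.intro homI) (auto simp: proj_mult group_axioms)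

lemma proj_subgroup:
  assumes "I \<subseteq> \<T>" "subgroup K A" "K \<subseteq> M"
  shows "subgroup (pr I ` K) A"
proof -
  interpret h: group_hom "A\<lparr>carrier := M\<rparr>" A "pr I" using assms(1) by (rule proj_group_hom)
  show ?thesis using h.subgroup_img_is_subgroup subgroup_incl[OF assms(2) M_subgroup assms(3)] by auto
qed

lemma proj_proj:
  assumes "J \<subseteq> I" "I \<subseteq> \<T>" "m \<in> M"
  shows "pr J (pr I m) = pr J m"
proof -
  have "pr J (pr I m \<otimes> pr (\<T> - I) m) =
      pr J (pr I m) \<otimes> pr J (pr (\<T> - I) m)"
    using assms by (intro proj_mult) auto
  moreover have "pr J (pr (\<T> - I) m) = \<one>"
    using assms by (intro proj_trivial[of J "\<T> - I"] proj_decompose(1)) auto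
  ultimately show ?thesis using proj_decompose(2)[of I m] assms by auto
qed

lemma proj_proj_disjoint:
  "\<lbrakk>J \<inter> I = {}; J \<subseteq> \<T>; I \<subseteq> \<T>; m \<in> M\<rbrakk> \<Longrightarrow> pr J (pr I m) = \<one>"
  by (intro proj_trivial[of J I] proj_decompose(1)) auto

lemma eq_one_if_coordinates:
  assumes "I \<subseteq> \<T>" "m \<in> sp I" "\<And>T. T \<in> I \<Longrightarrow> pr {T} m = \<one>"
  shows "m = \<one>"
proof -
  have "finite I" using assms(1) finite_factors finite_subset by blast
  then show ?thesis using assms
  proof (induction I arbitrary: m)
    case empty
    then show ?case by (simp add: subproduct_empty)
  next
    case (insert T I)
    have "m \<in> sp ({T} \<union> I)" using insert.prems by simp
    then obtain t a where ta: "t \<in> sp {T}" "a \<in> sp I" "m = t \<otimes> a"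
      using subproduct_UnE[of "{T}" I m] insert.prems by auto
    have "a \<in> sp (\<T> - {T})"
      using ta insert subproduct_mono[of I "\<T> - {T}"] by auto
    then have "pr {T} m = t" using ta insert.prems by (simp add: proj_eqI)
    then have "t = \<one>" using insert.prems by auto
    then have "m = a" using ta insert.prems subproduct_in[of a I] by simp
    then show ?case using insert ta by auto
  qed
qed

lemma subproduct_iff:
  assumes "I \<subseteq> \<T>" "m \<in> M"
  shows "m \<in> sp I \<longleftrightarrow> (\<forall>T\<in>\<T> - I. pr {T} m = \<one>)"
proof
  assume "m \<in> sp I"
  then show "\<forall>T\<in>\<T> - I. pr {T} m = \<one>"
    using assms proj_trivial[of "{T}" I m for T] by simp
next
  assume *: "\<forall>T\<in>\<T> - I. pr {T} m = \<one>"
  have "pr (\<T> - I) m = \<one>"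
  proof (rule eq_one_if_coordinates[of "\<T> - I"])
    show "pr (\<T> - I) m \<in> sp (\<T> - I)" using assms by (intro proj_decompose(1)) auto
    fix T assume "T \<in> \<T> - I"
    then show "pr {T} (pr (\<T> - I) m) = \<one>" using * assms(2) by (subst proj_proj) auto
  qed auto
  then have "m = pr I m" using proj_decompose(2)[OF assms] proj_in_M[OF assms] by simp
  then show "m \<in> sp I" using proj_decompose(1)[OF assms] by simp
qed

lemma proj_eq_one_iff:
  assumes "I \<subseteq> \<T>" "m \<in> M"
  shows "pr I m = \<one> \<longleftrightarrow> m \<in> sp (\<T> - I)"
proof
  assume "pr I m = \<one>"
  then show "m \<in> sp (\<T> - I)"
    using proj_decompose(2)[OF assms] proj_decompose(1)[of "\<T> - I" m] assms by auto
next
  assume "m \<in> sp (\<T> - I)"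
  then show "pr I m = \<one>" using assms by (intro proj_trivial[of I "\<T> - I"]) auto
qed

lemma proj_eq_iff:
  assumes "I \<subseteq> \<T>" "m \<in> M" "n \<in> M"
  shows "pr I m = pr I n \<longleftrightarrow> pr I (inv m \<otimes> n) = \<one>"
proof -
  have "pr I (inv m \<otimes> n) = inv (pr I m) \<otimes> pr I n"
    using assms by (simp add: proj_mult proj_inv)
  then show ?thesis using assms
    by (metis inv_closed inv_equality inv_inv in_carrier proj_in_M l_inv)
qed

lemma eq_if_coordinates:
  assumes "m \<in> M" "n \<in> M" "\<And>T. T \<in> \<T> \<Longrightarrow> pr {T} m = pr {T} n"
  shows "m = n"
proof -
  have "pr {T} (inv m \<otimes> n) = \<one>" if "T \<in> \<T>" for T
    using proj_eq_iff[of "{T}" m n] assms that by auto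
  then have "inv m \<otimes> n = \<one>" using assms subproduct_all eq_one_if_coordinates[of \<T> "inv m \<otimes> n"] by auto
  then show ?thesis using assms by (metis in_carrier inv_closed inv_equality inv_inv)
qed

lemma proj_image_containing_factor:
  assumes T: "T \<in> \<T>" and K: "T \<subseteq> K" "K \<subseteq> M"
  shows "pr {T} ` K = T"
proof
  show "pr {T} ` K \<subseteq> T" using proj_factor[OF T] K(2) by blast
  show "T \<subseteq> pr {T} ` K"
  proof
    fix t assume t: "t \<in> T"
    then have "t = pr {T} t" using proj_id[of "{T}" t] T subproduct_single[OF T] by simp
    then show "t \<in> pr {T} ` K" using t K(1) by blast
  qed
qed

lemma exists_with_coordinates:
  assumes "\<And>T. T \<in> \<T> \<Longrightarrow> f T \<in> T"
  shows "\<exists>m\<in>M. \<forall>T\<in>\<T>. pr {T} m = f T"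
proof -
  have "\<exists>m\<in>sp I. \<forall>T\<in>I. pr {T} m = f T" if "finite I" "I \<subseteq> \<T>" for I
    using that
  proof (induction I)
    case empty
    then show ?case using subproduct_closed(1) by auto
  next
    case (insert T I)
    then obtain m where m: "m \<in> sp I" "\<forall>U\<in>I. pr {U} m = f U" by auto
    have T: "T \<in> \<T>" "f T \<in> T" "f T \<in> M" using insert assms factor_subset by auto
    have mM: "m \<in> M" using m insert by auto
    have "pr {U} (m \<otimes> f T) = f U" if U: "U \<in> insert T I" for U
    proof -
      have eq: "pr {U} (m \<otimes> f T) = pr {U} m \<otimes> pr {U} (f T)"
        using U insert T mM by (intro proj_mult) auto
      show ?thesis
      proof (cases "U = T")
        case True
        have "pr {T} m = \<one>" using m insert by (intro proj_trivial[of _ I]) auto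
        moreover have "pr {T} (f T) = f T"
          using T by (intro proj_id) (auto simp: subproduct_single)
        ultimately show ?thesis using eq True T by simp
      next
        case False
        have "pr {U} (f T) = \<one>"
          using False U insert T by (intro proj_trivial[of _ "{T}"]) (auto simp: subproduct_single)
        moreover have "f U \<in> M" using U insert.prems assms factor_subset by blast
        ultimately show ?thesis using eq False U m by simp
      qed
    qed
    moreover have "m \<otimes> f T \<in> sp (insert T I)"
      using m T insert subproduct_mono[of I "insert T I"] factor_in_subproduct[of T "insert T I"]
      by (intro subproduct_closed) auto
    ultimately show ?case by auto
  qed
  from this[OF finite_factors] show ?thesis using subproduct_all by auto
qed

lemma card_le_prod_coordinates:
  assumes R: "R \<subseteq> \<T>" and fin: "\<And>T. T \<in> R \<Longrightarrow> finite T" and K: "K \<subseteq> M"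
    and inj: "\<And>k l. \<lbrakk>k \<in> K; l \<in> K; \<And>T. T \<in> R \<Longrightarrow> pr {T} k = pr {T} l\<rbrakk> \<Longrightarrow> k = l"
  shows "card K \<le> (\<Prod>T\<in>R. card T)"
proof -
  have fR: "finite R" using R finite_factors finite_subset by blast
  have "inj_on (\<lambda>k. \<lambda>T\<in>R. pr {T} k) K"
  proof (rule inj_onI)
    fix k l assume kl: "k \<in> K" "l \<in> K"
      and eq: "(\<lambda>T\<in>R. pr {T} k) = (\<lambda>T\<in>R. pr {T} l)"
    have "pr {T} k = pr {T} l" if "T \<in> R" for T
      using fun_cong[OF eq, of T] that by simp
    with kl show "k = l" by (rule inj)
  qed
  moreover have "(\<lambda>k. \<lambda>T\<in>R. pr {T} k) ` K \<subseteq> PiE R (\<lambda>T. T)"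
    using R K proj_factor by fastforce
  ultimately have "card K \<le> card (PiE R (\<lambda>T. T))"
    using fR fin by (intro card_inj_on_le) (auto intro: finite_PiE)
  then show ?thesis using fR by (simp add: card_PiE)
qed

lemma card_prod_factors_le:
  assumes fin: "finite M"
  shows "(\<Prod>T\<in>\<T>. card T) \<le> card M"
proof -
  have "PiE \<T> (\<lambda>T. T) \<subseteq> (\<lambda>k. \<lambda>T\<in>\<T>. pr {T} k) ` M"
  proof
    fix f assume f: "f \<in> PiE \<T> (\<lambda>T. T)"
    then obtain m where "m \<in> M" "\<forall>T\<in>\<T>. pr {T} m = f T"
      using exists_with_coordinates[of f] by auto
    then show "f \<in> (\<lambda>k. \<lambda>T\<in>\<T>. pr {T} k) ` M"
      using f by (intro image_eqI[of _ _ m]) (auto simp: PiE_def extensional_def)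
  qed
  then have "card (PiE \<T> (\<lambda>T. T)) \<le> card M" using fin by (meson card_image_le card_mono finite_imageI le_trans)
  then show ?thesis using finite_factors by (simp add: card_PiE)
qed

text \<open>
  An element is the product of its projections to the parts; the induction collects one part after
  another.
\<close>
lemma partition_coordinates_in:
  assumes H: "subgroup H A" "H \<subseteq> M" and P: "partition_on \<T> \<P>" and m: "m \<in> M"
    and proj_H: "\<And>P. P \<in> \<P> \<Longrightarrow> pr P m \<in> H"
  shows "m \<in> H"
proof -
  have PT: "P \<subseteq> \<T>" if "P \<in> \<P>" for P using P that by (auto simp: partition_on_def)
  have finP: "finite \<P>" using P finite_factors finite_elements by blast
  have "pr (\<Union>\<Q>) m \<in> H" if "finite \<Q>" "\<Q> \<subseteq> \<P>" for \<Q>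
    using that
  proof (induction \<Q>)
    case empty
    have "pr {} m = \<one>" using m by (simp add: proj_eq_one_iff subproduct_all)
    then show ?case using H by (simp add: subgroup.one_closed)
  next
    case (insert P \<Q>)
    have "P \<inter> Q = {}" if "Q \<in> \<Q>" for Q
      using insert that P by (metis disjointD insert_subset partition_onD2 subsetD)
    then have sub: "P \<subseteq> \<T>" "\<Union>\<Q> \<subseteq> \<T>" "P \<inter> \<Union>\<Q> = {}"
      using insert.prems PT by blast+
    define z where "z = pr (P \<union> \<Union>\<Q>) m"
    have z: "z \<in> M" using sub m by (auto simp: z_def)
    have "pr P z \<otimes> pr (\<Union>\<Q>) z = z"
    proof (rule eq_if_coordinates)
      fix T assume T: "T \<in> \<T>"
      have "pr {T} (pr P z \<otimes> pr (\<Union>\<Q>) z) =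
          pr {T} (pr P z) \<otimes> pr {T} (pr (\<Union>\<Q>) z)"
        using T z sub by (intro proj_mult) auto
      moreover have cT: "pr {T} z \<in> M" using T z by simp
      moreover consider "T \<in> P" "T \<notin> \<Union>\<Q>" | "T \<in> \<Union>\<Q>" "T \<notin> P" | "T \<notin> P \<union> \<Union>\<Q>" using sub by blast
      then have "pr {T} (pr P z) \<otimes> pr {T} (pr (\<Union>\<Q>) z) = pr {T} z"
      proof cases
        case 1
        then show ?thesis using T z sub cT by (simp add: proj_proj proj_proj_disjoint)
      next
        case 2
        then have "{T} \<subseteq> \<Union>\<Q>" "{T} \<inter> P = {}" by auto
        then show ?thesis using T z sub cT by (simp only: proj_proj proj_proj_disjoint) simp
      next
        case 3
        then have "pr {T} z = \<one>" unfolding z_def using T m sub by (intro proj_proj_disjoint) auto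
        moreover have "{T} \<inter> \<Union>\<Q> = {}" "{T} \<inter> P = {}" using 3 by auto
        ultimately show ?thesis using T z sub by (simp add: proj_proj_disjoint)
      qed
      ultimately show "pr {T} (pr P z \<otimes> pr (\<Union>\<Q>) z) = pr {T} z" by simp
    qed (use z sub in auto)
    moreover have "pr P z = pr P m" "pr (\<Union>\<Q>) z = pr (\<Union>\<Q>) m"
      unfolding z_def using sub m by (auto intro!: proj_proj)
    ultimately have "z = pr P m \<otimes> pr (\<Union>\<Q>) m" by simp
    then show ?case unfolding z_def using insert proj_H H by (simp add: subgroup.m_closed)
  qed
  from this[OF finP] have "pr \<T> m \<in> H" using P by (auto simp: partition_on_def)
  then show ?thesis using proj_id[of \<T> m] m subproduct_all by simp
qed

text \<open>
  The content of the decomposition is that \<open>H\<close> contains its projections. The projection to \<open>P\<close> is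
  then the intersection of \<open>H\<close> with the subproduct over \<open>P\<close>, which is normal in \<open>M\<close>, and different
  parts meet trivially in any case.
\<close>
lemma internal_direct_product_projections_iff:
  assumes H: "subgroup H A" "H \<subseteq> M" and P: "partition_on \<T> \<P>"
  shows "internal_direct_product A H \<P> (\<lambda>P. pr P ` H) \<longleftrightarrow>
           (\<forall>P\<in>\<P>. pr P ` H \<subseteq> H)"
proof
  assume "internal_direct_product A H \<P> (\<lambda>P. pr P ` H)"
  then show "\<forall>P\<in>\<P>. pr P ` H \<subseteq> H"
    unfolding internal_direct_product_def using normal_in_subgroup_iff[OF H(1)] by blast
next
  assume sub: "\<forall>P\<in>\<P>. pr P ` H \<subseteq> H"
  have PT: "P \<subseteq> \<T>" if "P \<in> \<P>" for P using P that by (auto simp: partition_on_def)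
  have eq: "pr P ` H = H \<inter> sp P" if "P \<in> \<P>" for P
  proof
    show "pr P ` H \<subseteq> H \<inter> sp P"
      using that sub proj_decompose(1)[OF PT[OF that]] H(2) by blast
    show "H \<inter> sp P \<subseteq> pr P ` H"
      using proj_id[OF PT[OF that]] by (metis IntD1 IntD2 image_eqI subsetI)
  qed
  have gr: "subgroup (pr P ` H) A" if "P \<in> \<P>" for P
    using PT[OF that] H by (intro proj_subgroup)
  show "internal_direct_product A H \<P> (\<lambda>P. pr P ` H)"
    unfolding internal_direct_product_def
  proof (intro conjI ballI)
    fix P assume p: "P \<in> \<P>"
    show "pr P ` H \<lhd> A\<lparr>carrier := H\<rparr>"
      unfolding normal_in_subgroup_iff[OF H(1)]
    proof (intro conjI ballI)
      show "subgroup (pr P ` H) A" "pr P ` H \<subseteq> H" using gr[OF p] eq[OF p] by auto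
      fix m x assume mx: "m \<in> H" "x \<in> pr P ` H"
      then have "m \<otimes> x \<otimes> inv m \<in> H"
        using eq[OF p] H(1) by (simp add: subgroup.m_closed subgroup.m_inv_closed)
      moreover have "m \<otimes> x \<otimes> inv m \<in> sp P"
        using mx eq[OF p] H(2) by (intro subproduct_conj[OF PT[OF p]]) auto
      ultimately show "m \<otimes> x \<otimes> inv m \<in> pr P ` H" using eq[OF p] by simp
    qed
  next
    let ?Gn = "generate A (\<Union>P\<in>\<P>. pr P ` H)"
    have "?Gn \<subseteq> H" using sub H by (intro generate_subgroup_incl) auto
    moreover have "H \<subseteq> ?Gn"
    proof
      fix h assume h: "h \<in> H"
      have gs: "subgroup ?Gn A" using sub H by (intro generate_is_subgroup) (auto dest!: subgroup.subset)
      have "pr P h \<in> ?Gn" if "P \<in> \<P>" for P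
        using that h by (intro generate.incl) auto
      then show "h \<in> ?Gn"
        using \<open>?Gn \<subseteq> H\<close> H(2) h partition_coordinates_in[OF gs _ P, of h] by blast
    qed
    ultimately show "?Gn = H" by blast
  next
    fix P assume p: "P \<in> \<P>"
    have d: "Q \<subseteq> \<T> - P" if "Q \<in> \<P> - {P}" for Q
      using that p P by (auto simp: partition_on_def disjoint_def)
    have "generate A (\<Union>Q\<in>\<P> - {P}. pr Q ` H) \<subseteq> sp (\<T> - P)"
    proof (rule generate_subgroup_incl)
      show "(\<Union>Q\<in>\<P> - {P}. pr Q ` H) \<subseteq> sp (\<T> - P)"
      proof (intro UN_least)
        fix Q assume "Q \<in> \<P> - {P}"
        then show "pr Q ` H \<subseteq> sp (\<T> - P)"
          using subproduct_mono[OF d] eq[of Q] by auto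
      qed
    qed (rule subproduct_subgroup, blast)
    moreover have "pr P ` H \<subseteq> sp P" using eq[OF p] by auto
    moreover have "\<one> \<in> pr P ` H" "\<one> \<in> generate A (\<Union>Q\<in>\<P> - {P}. pr Q ` H)"
      using subgroup.one_closed[OF gr[OF p]] by (simp_all add: generate.one)
    ultimately show "pr P ` H \<inter> generate A (\<Union>Q\<in>\<P> - {P}. pr Q ` H) = {\<one>}"
      using subproduct_disjoint[of P "\<T> - P"] PT[OF p] by auto
  qed
qed

end

section \<open>Subgroups of products of simple groups\<close>

text \<open>
  Equality of the orders stands in for the factors being isomorphic; the simple factors of a minimal
  normal subgroup are even conjugate.
\<close>
locale simple_factors = direct_factors +
  assumes finite_M: "finite M"
    and factor_simple: "\<lbrakk>T \<in> \<T>; N \<lhd> A\<lparr>carrier := T\<rparr>\<rbrakk> \<Longrightarrow> N = {\<one>} \<or> N = T"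
    and factor_nontrivial: "T \<in> \<T> \<Longrightarrow> T \<noteq> {\<one>}"
    and factor_centreless: "\<lbrakk>T \<in> \<T>; z \<in> T; \<And>t. t \<in> T \<Longrightarrow> z \<otimes> t = t \<otimes> z\<rbrakk> \<Longrightarrow> z = \<one>"
    and card_factors_eq: "\<lbrakk>T \<in> \<T>; U \<in> \<T>\<rbrakk> \<Longrightarrow> card T = card U"
begin

lemma finite_factor: "T \<in> \<T> \<Longrightarrow> finite T"
  using factor_subset finite_M finite_subset by blast

lemma proj_image_subset: "\<lbrakk>T \<in> \<T>; K \<subseteq> M\<rbrakk> \<Longrightarrow> pr {T} ` K \<subseteq> T"
  using proj_factor by blast

text \<open>
  Since \<open>K\<close> projects onto \<open>U\<close>, a subgroup normalised by \<open>K\<close> projects to a normal subgroup of the simple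
  group \<open>U\<close>.
\<close>
lemma proj_image_normal_subgroup:
  assumes U: "U \<in> \<T>" and K: "K \<subseteq> M" "pr {U} ` K = U"
    and X: "subgroup X A" "X \<subseteq> K" and conj: "\<And>k x. \<lbrakk>k \<in> K; x \<in> X\<rbrakk> \<Longrightarrow> k \<otimes> x \<otimes> inv k \<in> X"
  shows "pr {U} ` X = {\<one>} \<or> pr {U} ` X = U"
proof (rule factor_simple[OF U])
  show "pr {U} ` X \<lhd> A\<lparr>carrier := U\<rparr>"
    unfolding normal_in_subgroup_iff[OF factor_subgroup[OF U]]
  proof (intro conjI ballI)
    show "subgroup (pr {U} ` X) A" using U K X by (intro proj_subgroup) auto
    show "pr {U} ` X \<subseteq> U" using proj_image_subset[OF U, of X] K(1) X(2) by auto
    fix u y assume "u \<in> U" "y \<in> pr {U} ` X"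
    then obtain k x where kx: "k \<in> K" "x \<in> X" "u = pr {U} k" "y = pr {U} x"
      using K(2) by blast
    have "k \<in> M" "x \<in> M" using kx K X by auto
    then have "u \<otimes> y \<otimes> inv u = pr {U} (k \<otimes> x \<otimes> inv k)"
      using kx U by (simp add: proj_mult proj_inv)
    then show "u \<otimes> y \<otimes> inv u \<in> pr {U} ` X" using conj[OF kx(1,2)] by simp
  qed
qed

lemma Int_subproduct:
  assumes "subgroup K A" "K \<subseteq> M" "I \<subseteq> \<T>"
  shows "subgroup (K \<inter> sp I) A"
    and "\<lbrakk>k \<in> K; x \<in> K \<inter> sp I\<rbrakk> \<Longrightarrow> k \<otimes> x \<otimes> inv k \<in> K \<inter> sp I"
proof -
  show "subgroup (K \<inter> sp I) A"
    using assms subproduct_subgroup by (intro subgroups_Inter_pair) auto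
  assume "k \<in> K" "x \<in> K \<inter> sp I"
  moreover then have "k \<otimes> x \<otimes> inv k \<in> sp I"
    using assms by (intro subproduct_conj) auto
  ultimately show "k \<otimes> x \<otimes> inv k \<in> K \<inter> sp I"
    using assms(1) by (simp add: subgroup.m_closed subgroup.m_inv_closed)
qed

text \<open>
  A local form of Scott's lemma on subdirect products. Among the sets \<open>I\<close> that contain \<open>T\<close> and for
  which \<open>K\<close> meets the subproduct over \<open>I\<close> in a group with non-trivial projection to \<open>T\<close>, take a
  smallest one; the intersection \<open>X\<close> is the strip. Minimality says that an element of \<open>X\<close> that is
  trivial at some \<open>U \<in> I\<close> is trivial at \<open>T\<close>. The kernel \<open>W\<close> of the projection of \<open>X\<close> to \<open>T\<close> cannot
  project onto any \<open>U \<in> I\<close>, since then \<open>X\<close> would lie in \<open>W\<close>; by simplicity it is trivial at every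
  \<open>U \<in> I\<close>, hence trivial, and \<open>X\<close> embeds in each \<open>U \<in> I\<close>.

  To split \<open>X\<close> off \<open>K\<close>, correct \<open>k \<in> K\<close> by an element of \<open>X\<close> so that it becomes trivial at \<open>T\<close>. Its
  commutators with \<open>X\<close> lie in \<open>X\<close> and are trivial at \<open>T\<close>, so they vanish, and triviality of the
  centres makes the corrected element trivial at all of \<open>I\<close>.
\<close>
lemma strip_through_factor:
  assumes K: "subgroup K A" "K \<subseteq> M" and S: "S \<subseteq> \<T>"
    and onto: "\<And>U. U \<in> S \<Longrightarrow> pr {U} ` K = U"
    and T: "T \<in> S" and unlinked: "pr {T} ` (K \<inter> sp S) = T"
  obtains I where "T \<in> I" "I \<subseteq> S"
    and "\<And>U. U \<in> I \<Longrightarrow> pr {U} ` (K \<inter> sp I) = U"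
    and "\<And>U x. \<lbrakk>U \<in> I; x \<in> K \<inter> sp I; pr {U} x = \<one>\<rbrakk> \<Longrightarrow> x = \<one>"
    and "\<And>k. k \<in> K \<Longrightarrow> pr I k \<in> K"
proof -
  define good where
    "good I \<longleftrightarrow> T \<in> I \<and> I \<subseteq> S \<and> pr {T} ` (K \<inter> sp I) \<noteq> {\<one>}" for I
  have "good S" using T unlinked factor_nontrivial S by (auto simp: good_def)
  then obtain I where good: "good I" and least: "\<And>J. good J \<Longrightarrow> card I \<le> card J"
    using ex_has_least_nat[of good S card] by blast
  have I: "T \<in> I" "I \<subseteq> S" "I \<subseteq> \<T>" "finite I"
    using good S finite_subset[OF _ finite_factors, of I] by (auto simp: good_def)
  have TT: "T \<in> \<T>" using T S by auto
  define X where "X = K \<inter> sp I"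
  have X: "subgroup X A" "X \<subseteq> K" "X \<subseteq> M" using Int_subproduct(1)[OF K I(3)] K by (auto simp: X_def)
  have X_conj: "k \<otimes> x \<otimes> inv k \<in> X" if "k \<in> K" "x \<in> X" for k x
    using Int_subproduct(2)[OF K I(3)] that by (auto simp: X_def)
  have "pr {T} ` X \<noteq> {\<one>}" using good by (simp add: good_def X_def)
  moreover have "pr {T} ` X = {\<one>} \<or> pr {T} ` X = T"
    using onto[OF T] X X_conj K(2) by (intro proj_image_normal_subgroup[OF TT]) auto
  ultimately have onto_T: "pr {T} ` X = T" by blast
  have kernel_T: "pr {T} x = \<one>" if x: "x \<in> X" and U: "U \<in> I" "pr {U} x = \<one>" for x U
  proof (cases "T \<in> I - {U}")
    case True
    have "card (I - {U}) < card I" using U I by (intro psubset_card_mono) auto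
    then have "\<not> good (I - {U})" using least[of "I - {U}"] by linarith
    then have "pr {T} ` (K \<inter> sp (I - {U})) = {\<one>}"
      using True I by (auto simp: good_def)
    moreover have "x \<in> sp (I - {U})"
    proof -
      have "x \<in> M" "x \<in> sp I" using x X by (auto simp: X_def)
      then have "\<forall>V\<in>\<T> - I. pr {V} x = \<one>" using subproduct_iff[OF I(3)] by blast
      then have "\<forall>V\<in>\<T> - (I - {U}). pr {V} x = \<one>" using U by blast
      then show ?thesis using subproduct_iff[of "I - {U}" x] I \<open>x \<in> M\<close> by blast
    qed
    ultimately show ?thesis using x by (auto simp: X_def)
  next
    case False
    then show ?thesis using U I by auto
  qed
  have onto_U: "pr {U} ` X = U" if U: "U \<in> I" for U
  proof -
    have "pr {U} ` X = {\<one>} \<or> pr {U} ` X = U"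
      using onto[of U] U I X X_conj K(2) by (intro proj_image_normal_subgroup[of U K]) auto
    moreover have "pr {U} ` X \<noteq> {\<one>}"
    proof
      assume "pr {U} ` X = {\<one>}"
      then have "pr {T} x = \<one>" if "x \<in> X" for x using kernel_T[OF that U] that by auto
      then have "T \<subseteq> {\<one>}" using onto_T by auto
      then show False using factor_nontrivial[OF TT] onto_T X(1) subgroup.one_closed[OF factor_subgroup[OF TT]] by auto
    qed
    ultimately show ?thesis by blast
  qed
  define W where "W = {x \<in> X. pr {T} x = \<one>}"
  have W: "subgroup W A"
  proof (rule subgroupI)
    show "W \<subseteq> carrier A" using X by (auto simp: W_def)
    show "W \<noteq> {}" using subgroup.one_closed[OF X(1)] TT by (auto simp: W_def)
    fix a assume a: "a \<in> W"
    have aM: "a \<in> M" "a \<in> X" using a X by (auto simp: W_def)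
    then show "inv a \<in> W"
      using a X(1) TT by (auto simp: W_def proj_inv subgroup.m_inv_closed)
    fix b assume b: "b \<in> W"
    have bM: "b \<in> M" "b \<in> X" using b X by (auto simp: W_def)
    show "a \<otimes> b \<in> W"
      using a b aM bM X(1) TT by (auto simp: W_def proj_mult subgroup.m_closed)
  qed
  have W_conj: "k \<otimes> x \<otimes> inv k \<in> W" if k: "k \<in> K" and x: "x \<in> W" for k x
  proof -
    have "k \<in> M" "x \<in> M" "x \<in> X" using k x X K by (auto simp: W_def)
    then show ?thesis
      using X_conj[OF k] x TT by (simp add: W_def proj_mult proj_inv)
  qed
  have W_trivial: "x = \<one>" if x: "x \<in> W" for x
  proof -
    have xX: "x \<in> X" "x \<in> sp I" using x by (auto simp: W_def X_def)
    have "pr {U} x = \<one>" if U: "U \<in> I" for U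
    proof -
      have UT: "U \<in> \<T>" using U I by auto
      have "pr {U} ` W = {\<one>} \<or> pr {U} ` W = U"
        using onto[of U] U I X W W_conj K(2)
        by (intro proj_image_normal_subgroup[of U K]) (auto simp: W_def)
      moreover have "pr {U} ` W \<noteq> U"
      proof
        assume W_onto: "pr {U} ` W = U"
        have "y \<in> W" if y: "y \<in> X" for y
        proof -
          have "pr {U} y \<in> U" using proj_factor[OF UT] y X by auto
          then obtain w where w: "w \<in> W" "pr {U} w = pr {U} y"
            using W_onto by (metis imageE)
          have wM: "w \<in> X" "w \<in> M" "y \<in> M" using w X y by (auto simp: W_def)
          have "pr {U} (inv w \<otimes> y) = \<one>" using proj_eq_iff[of "{U}" w y] w wM UT by auto
          moreover have "inv w \<otimes> y \<in> X" using wM y X(1) by (simp add: subgroup.m_closed subgroup.m_inv_closed)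
          ultimately have "pr {T} (inv w \<otimes> y) = \<one>" using kernel_T U by blast
          then have "pr {T} w = pr {T} y" using proj_eq_iff[of "{T}" w y] wM TT by auto
          then show ?thesis using w y by (simp add: W_def)
        qed
        then have "pr {T} ` X \<subseteq> {\<one>}" by (auto simp: W_def)
        then show False
          using onto_T factor_nontrivial[OF TT] subgroup.one_closed[OF factor_subgroup[OF TT]] by auto
      qed
      ultimately show ?thesis using x by auto
    qed
    then show ?thesis using eq_one_if_coordinates[OF I(3) xX(2)] by blast
  qed
  have faithful: "x = \<one>" if "U \<in> I" "x \<in> X" "pr {U} x = \<one>" for U x
    using kernel_T[OF that(2,1,3)] that(2) W_trivial[of x] unfolding W_def by blast
  have proj_K: "pr I k \<in> K" if k: "k \<in> K" for k
  proof -
    have "pr {T} k \<in> T" using proj_factor[OF TT] k K by auto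
    then obtain x where x: "x \<in> X" "pr {T} x = pr {T} k"
      using onto_T by (metis imageE)
    define k' where "k' = inv x \<otimes> k"
    have M: "x \<in> M" "k \<in> M" "x \<in> K" using x k X K by auto
    have k'K: "k' \<in> K"
      using M k K(1) by (simp add: k'_def subgroup.m_closed subgroup.m_inv_closed)
    then have k'M: "k' \<in> M" using K by auto
    note M = M(1,2) k'M k'K
    have k'T: "pr {T} k' = \<one>"
      unfolding k'_def using proj_eq_iff[of "{T}" x k] x M TT by auto
    have comm: "k' \<otimes> y = y \<otimes> k'" if y: "y \<in> X" for y
    proof -
      have yM: "y \<in> M" using y X by auto
      have "k' \<otimes> y \<otimes> inv k' \<otimes> inv y \<in> X"
        using X_conj[OF M(4) y] y X(1) by (simp add: subgroup.m_closed subgroup.m_inv_closed)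
      moreover have "pr {T} (k' \<otimes> y \<otimes> inv k' \<otimes> inv y) = \<one>"
        using M yM TT k'T by (simp add: proj_mult proj_inv)
      ultimately have "k' \<otimes> y \<otimes> inv k' \<otimes> inv y = \<one>" using faithful I by blast
      then have "k' \<otimes> y \<otimes> inv (y \<otimes> k') = \<one>" using M yM by (simp add: inv_mult_group m_assoc)
      then show ?thesis using M yM inv_equality[of "k' \<otimes> y" "inv (y \<otimes> k')"] by simp
    qed
    have "pr I k' = \<one>"
    proof (rule eq_one_if_coordinates[OF I(3)])
      show "pr I k' \<in> sp I" using M I by (intro proj_decompose(1))
      fix U assume U: "U \<in> I"
      have UT: "U \<in> \<T>" using U I by auto
      have "pr {U} k' = \<one>"
      proof (rule factor_centreless[OF UT])
        show "pr {U} k' \<in> U" using proj_factor[OF UT] M by auto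
        fix t assume "t \<in> U"
        then obtain y where y: "y \<in> X" "t = pr {U} y" using onto_U[OF U] by blast
        then have "y \<in> M" using X by auto
        then have "pr {U} (k' \<otimes> y) = pr {U} k' \<otimes> t"
          "pr {U} (y \<otimes> k') = t \<otimes> pr {U} k'"
          using y UT M by (simp_all add: proj_mult)
        then show "pr {U} k' \<otimes> t = t \<otimes> pr {U} k'" using comm[OF y(1)] by simp
      qed
      then show "pr {U} (pr I k') = \<one>" using U I M by (simp add: proj_proj)
    qed
    then have "pr I x = pr I k"
      unfolding k'_def using proj_eq_iff[of I x k] M I by auto
    moreover have "pr I x = x" using x I by (intro proj_id) (auto simp: X_def)
    ultimately show ?thesis using x X by auto
  qed
  show thesis
    using that[of I] I onto_U faithful proj_K unfolding X_def by blast
qed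

lemma strip_involvedI:
  assumes K: "subgroup K A" "K \<subseteq> M" and I: "I \<subseteq> \<T>" "2 \<le> card I"
    and onto: "\<And>U. U \<in> I \<Longrightarrow> pr {U} ` (K \<inter> sp I) = U"
    and faithful: "\<And>U x. \<lbrakk>U \<in> I; x \<in> K \<inter> sp I; pr {U} x = \<one>\<rbrakk> \<Longrightarrow> x = \<one>"
    and proj_K: "\<And>k. k \<in> K \<Longrightarrow> pr I k \<in> K"
  defines "X \<equiv> K \<inter> sp I"
  shows "full_strip A M \<T> X" "nontrivial_strip A M \<T> X" "involved A M \<T> X K"
proof -
  have X: "subgroup X A" "X \<subseteq> K" "X \<subseteq> M" using Int_subproduct(1)[OF K I(1)] K by (auto simp: X_def)
  have out: "pr {U} ` X = {\<one>}" if "U \<in> \<T> - I" for U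
  proof -
    have "pr {U} x = \<one>" if "x \<in> X" for x
      using subproduct_iff[OF I(1), of x] that X \<open>U \<in> \<T> - I\<close> by (auto simp: X_def)
    then have "pr {U} ` X \<subseteq> {\<one>}" by auto
    moreover have "\<one> \<in> pr {U} ` X"
      using subgroup.one_closed[OF X(1)] that by (intro image_eqI[of _ _ \<one>]) auto
    ultimately show ?thesis by blast
  qed
  have "pr {U} ` X \<noteq> {\<one>} \<longleftrightarrow> U \<in> I" if "U \<in> \<T>" for U
    using out[of U] onto[of U] factor_nontrivial[of U] that by (cases "U \<in> I") (simp_all add: X_def)
  then have supp: "strip_support A \<T> X = I"
    using I(1) unfolding strip_support_def by auto
  have iso: "A\<lparr>carrier := pr {U} ` X\<rparr> \<cong> A\<lparr>carrier := X\<rparr>" if U: "U \<in> I" for U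
  proof -
    have UT: "U \<in> \<T>" using U I by auto
    have "inj_on (pr {U}) X"
    proof (rule inj_onI)
      fix x y assume xy: "x \<in> X" "y \<in> X" "pr {U} x = pr {U} y"
      have M: "x \<in> M" "y \<in> M" using xy X by auto
      have "pr {U} (inv x \<otimes> y) = \<one>" using proj_eq_iff[of "{U}" x y] M xy UT by auto
      moreover have "inv x \<otimes> y \<in> X" using xy X(1) by (simp add: subgroup.m_closed subgroup.m_inv_closed)
      ultimately have "inv x \<otimes> y = \<one>" using faithful[OF U] by (simp add: X_def)
      then show "x = y" using M inv_equality[of "inv x" y] by (metis in_carrier inv_closed inv_inv)
    qed
    moreover have "pr {U} \<in> hom (A\<lparr>carrier := X\<rparr>) (A\<lparr>carrier := pr {U} ` X\<rparr>)"
      using UT X(3) by (intro homI) (auto intro!: proj_mult)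
    ultimately have "pr {U} \<in> Group.iso (A\<lparr>carrier := X\<rparr>) (A\<lparr>carrier := pr {U} ` X\<rparr>)"
      by (simp add: Group.iso_def bij_betw_def)
    then show ?thesis
      using group.iso_sym[OF subgroup_imp_group[OF X(1)]] by (auto simp: is_iso_def)
  qed
  have st: "strip A M \<T> X"
    unfolding strip_def
  proof (intro conjI ballI)
    show "subgroup X (A\<lparr>carrier := M\<rparr>)" by (rule subgroup_incl[OF X(1) M_subgroup X(3)])
    fix U assume "U \<in> \<T>"
    then show "pr {U} ` X = {\<one>} \<or> A\<lparr>carrier := pr {U} ` X\<rparr> \<cong> A\<lparr>carrier := X\<rparr>"
      using out[of U] iso[of U] by (cases "U \<in> I") simp_all
  qed
  then show fs: "full_strip A M \<T> X" unfolding full_strip_def supp using onto by (simp add: X_def)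
  show nt: "nontrivial_strip A M \<T> X" unfolding nontrivial_strip_def supp using st I by simp
  have "K = X <#> (pr (\<T> - I) ` K)"
  proof
    show "K \<subseteq> X <#> (pr (\<T> - I) ` K)"
    proof
      fix k assume k: "k \<in> K"
      have "k = pr I k \<otimes> pr (\<T> - I) k" using proj_decompose(2)[OF I(1)] k K by auto
      moreover have "pr I k \<in> X" using proj_K[OF k] proj_decompose(1)[OF I(1)] k K by (auto simp: X_def)
      ultimately show "k \<in> X <#> (pr (\<T> - I) ` K)" using k unfolding set_mult_def by blast
    qed
    have "pr (\<T> - I) k \<in> K" if k: "k \<in> K" for k
    proof -
      have M: "k \<in> M" "pr I k \<in> M" "pr (\<T> - I) k \<in> M" using k K I by auto
      have "k = pr I k \<otimes> pr (\<T> - I) k" using proj_decompose(2)[OF I(1)] k K by auto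
      then have "pr (\<T> - I) k = inv (pr I k) \<otimes> k"
        using M by (metis in_carrier inv_solve_left)
      then show ?thesis using proj_K[OF k] k K(1) by (simp add: subgroup.m_closed subgroup.m_inv_closed)
    qed
    then show "X <#> (pr (\<T> - I) ` K) \<subseteq> K"
      using X(2) K(1) by (auto simp: set_mult_def subgroup.m_closed)
  qed
  then show "involved A M \<T> X K"
    unfolding involved_def supp using nt subgroup_incl[OF K(1) M_subgroup K(2)] by simp
qed

lemma factor_subset_if_trivial_strip:
  assumes "T \<in> \<T>" "pr {T} ` (K \<inter> sp {T}) = T"
  shows "T \<subseteq> K"
proof
  fix t assume "t \<in> T"
  then obtain x where x: "x \<in> K" "x \<in> sp {T}" "t = pr {T} x" using assms(2) by blast
  then have "t = x" using proj_id[of "{T}" x] assms(1) by simp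
  then show "t \<in> K" using x by simp
qed

lemma card_ge_two_if_other: "\<lbrakk>T \<in> I; I \<noteq> {T}; I \<subseteq> \<T>\<rbrakk> \<Longrightarrow> 2 \<le> card I"
proof -
  assume a: "T \<in> I" "I \<noteq> {T}" "I \<subseteq> \<T>"
  then obtain U where U: "U \<in> I" "U \<noteq> T" by blast
  have "card {T, U} \<le> card I" using a U finite_factors by (intro card_mono) (auto intro: finite_subset)
  then show ?thesis using U by simp
qed

text \<open>
  If \<open>K\<close> contained \<open>T\<close>, then \<open>t \<in> T\<close> would be the product of some \<open>x \<in> X\<close> and an element that is
  trivial on the support of \<open>X\<close>. At another factor \<open>U\<close> of the support, \<open>t\<close> and hence \<open>x\<close> would be
  trivial, so \<open>x = 1\<close> because \<open>X\<close> is isomorphic to \<open>U\<close>, and \<open>t = 1\<close> follows.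
\<close>
lemma involved_full_stripD:
  assumes X: "full_strip A M \<T> X" "nontrivial_strip A M \<T> X" "involved A M \<T> X K"
    and T: "T \<in> strip_support A \<T> X"
  shows "pr {T} ` K = T" and "\<not> T \<subseteq> K"
proof -
  let ?I = "strip_support A \<T> X"
  have TT: "T \<in> \<T>" and IT: "?I \<subseteq> \<T>" using T by (auto simp: strip_support_def)
  have onto: "pr {U} ` X = U" if "U \<in> ?I" for U using X(1) that by (auto simp: full_strip_def)
  have "subgroup X (A\<lparr>carrier := M\<rparr>)" using X(1) by (simp add: full_strip_def strip_def)
  then have XM: "X \<subseteq> M" using subgroup.subset by fastforce
  have "subgroup K (A\<lparr>carrier := M\<rparr>)" using X(3) by (simp add: involved_def)
  then have KM: "K \<subseteq> M" "\<one> \<in> K" using subgroup.subset subgroup.one_closed by fastforce+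
  have K: "K = X <#> (pr (\<T> - ?I) ` K)" using X(3) by (simp add: involved_def)
  have "x \<in> K" if "x \<in> X" for x
  proof -
    have "x = x \<otimes> pr (\<T> - ?I) \<one>" using that XM by auto
    then show ?thesis using K that KM(2) unfolding set_mult_def by blast
  qed
  then have "T \<subseteq> pr {T} ` K" using onto[OF T] by blast
  then show "pr {T} ` K = T" using proj_image_subset[OF TT KM(1)] by blast
  show "\<not> T \<subseteq> K"
  proof
    assume TK: "T \<subseteq> K"
    have "?I \<noteq> {T}" using X(2) by (auto simp: nontrivial_strip_def)
    then obtain U where U: "U \<in> ?I" "U \<noteq> T" using T by blast
    have UT: "U \<in> \<T>" using U IT by auto
    have "A\<lparr>carrier := pr {U} ` X\<rparr> \<cong> A\<lparr>carrier := X\<rparr>"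
      using X(1) U UT by (auto simp: full_strip_def strip_def strip_support_def)
    then have "card (pr {U} ` X) = card X"
      using iso_same_order by (fastforce simp: is_iso_def order_def)
    then have inj: "inj_on (pr {U}) X"
      using XM finite_M finite_subset eq_card_imp_inj_on by blast
    have oneX: "\<one> \<in> X" using \<open>subgroup X (A\<lparr>carrier := M\<rparr>)\<close> subgroup.one_closed by fastforce
    have "t = \<one>" if t: "t \<in> T" for t
    proof -
      have "t \<in> K" using t TK by blast
      then obtain x k where xk: "x \<in> X" "k \<in> K" "t = x \<otimes> pr (\<T> - ?I) k"
        using K unfolding set_mult_def by blast
      define y where "y = pr (\<T> - ?I) k"
      have M: "x \<in> M" "k \<in> M" "y \<in> M" "t \<in> M" using xk XM KM t factor_subset[OF TT] by (auto simp: y_def)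
      have *: "pr {V} t = pr {V} x" if V: "V \<in> ?I" for V
      proof -
        have "pr {V} y = \<one>" unfolding y_def using V IT M by (intro proj_proj_disjoint) auto
        moreover have "pr {V} (x \<otimes> y) = pr {V} x \<otimes> pr {V} y"
          "pr {V} x \<in> M" using M V IT by (auto intro!: proj_mult)
        ultimately show ?thesis using xk(3) by (simp add: y_def[symmetric])
      qed
      have "pr {U} t = \<one>"
        using t TT UT U by (intro proj_trivial[of "{U}" "{T}"]) (auto simp: subproduct_single)
      then have "pr {U} x = pr {U} \<one>" using *[OF U(1)] UT by simp
      then have "x = \<one>" using inj xk oneX by (auto dest: inj_onD)
      then have "pr {T} t = \<one>" using *[OF T] TT by simp
      moreover have "pr {T} t = t" using t TT by (intro proj_id) (auto simp: subproduct_single)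
      ultimately show ?thesis by simp
    qed
    then show False using factor_nontrivial[OF TT] subgroup.one_closed[OF factor_subgroup[OF TT]] by blast
  qed
qed

text \<open>
  Restrict \<open>K\<close> to the elements that are trivial at the factors outside \<open>S\<close>, one such factor \<open>U\<close> at a
  time. If a step lost the projection onto \<open>T\<close>, then that projection would be determined by the one to
  \<open>U\<close>, and \<open>T\<close> would be an image of a set with fewer than \<open>|U| = |T|\<close> elements. This takes the place
  of comparing composition factors.
\<close>
lemma proj_avoiding_proper_factors:
  assumes K: "subgroup K A" "K \<subseteq> M"
  defines "S \<equiv> {U \<in> \<T>. pr {U} ` K = U}"
  assumes T: "T \<in> S"
  shows "pr {T} ` (K \<inter> sp S) = T"
proof -
  have TT: "T \<in> \<T>" and KT: "pr {T} ` K = T" using T by (auto simp: S_def)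
  have "pr {T} ` (K \<inter> sp (\<T> - R)) = T" if "finite R" "R \<subseteq> \<T> - S" for R
    using that
  proof (induction R)
    case empty
    then show ?case using KT K by (simp add: subproduct_all Int_absorb2)
  next
    case (insert U R)
    define L where "L = K \<inter> sp (\<T> - R)"
    define L' where "L' = K \<inter> sp (\<T> - insert U R)"
    have UT: "U \<in> \<T>" and UK: "pr {U} ` K \<noteq> U" using insert.prems by (auto simp: S_def)
    have LT: "pr {T} ` L = T" using insert by (simp add: L_def)
    have LM: "L \<subseteq> M" "L \<subseteq> K" using K by (auto simp: L_def)
    have sL: "subgroup L A" unfolding L_def using Int_subproduct(1)[OF K] by auto
    have "pr {T} ` L' = {\<one>} \<or> pr {T} ` L' = T"
      using Int_subproduct[OF K, of "\<T> - insert U R"] KT K(2)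
      by (intro proj_image_normal_subgroup[OF TT]) (auto simp: L'_def)
    moreover have "pr {T} ` L' \<noteq> {\<one>}"
    proof
      assume triv: "pr {T} ` L' = {\<one>}"
      have ker: "pr {T} x = \<one>" if x: "x \<in> L" "pr {U} x = \<one>" for x
      proof -
        have xM: "x \<in> M" using x LM by auto
        have "\<forall>V\<in>\<T> - (\<T> - R). pr {V} x = \<one>"
          using x xM subproduct_iff[of "\<T> - R" x] by (auto simp: L_def)
        then have "\<forall>V\<in>\<T> - (\<T> - insert U R). pr {V} x = \<one>" using x(2) by blast
        then have "x \<in> sp (\<T> - insert U R)"
          using xM subproduct_iff[of "\<T> - insert U R" x] by blast
        then show ?thesis using triv x by (auto simp: L'_def L_def)
      qed
      have det: "pr {T} x = pr {T} y"
        if xy: "x \<in> L" "y \<in> L" "pr {U} x = pr {U} y" for x y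
      proof -
        have M: "x \<in> M" "y \<in> M" using xy LM by auto
        have "pr {U} (inv x \<otimes> y) = \<one>" using proj_eq_iff[of "{U}" x y] xy M UT by auto
        moreover have "inv x \<otimes> y \<in> L" using xy sL by (simp add: subgroup.m_closed subgroup.m_inv_closed)
        ultimately have "pr {T} (inv x \<otimes> y) = \<one>" using ker by blast
        then show ?thesis using proj_eq_iff[of "{T}" x y] M TT by auto
      qed
      define f where "f u = pr {T} (SOME x. x \<in> L \<and> pr {U} x = u)" for u
      have "f (pr {U} x) = pr {T} x" if x: "x \<in> L" for x
      proof -
        let ?y = "SOME y. y \<in> L \<and> pr {U} y = pr {U} x"
        have "?y \<in> L \<and> pr {U} ?y = pr {U} x"
          by (rule someI[of _ x]) (use x in simp)
        then show ?thesis unfolding f_def using det[of ?y x] x by blast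
      qed
      then have "pr {T} ` L \<subseteq> f ` (pr {U} ` L)" by (metis image_eqI image_subsetI)
      moreover have fin: "finite (pr {U} ` L)" using LM finite_M by (meson finite_imageI finite_subset)
      ultimately have "card T \<le> card (pr {U} ` L)" using LT by (metis surj_card_le)
      also have "\<dots> < card U"
      proof (rule psubset_card_mono)
        show "finite U" using UT by (rule finite_factor)
        have "pr {U} ` K \<subset> U" using UK proj_image_subset[OF UT K(2)] by blast
        then show "pr {U} ` L \<subset> U" using LM(2) by blast
      qed
      finally show False using card_factors_eq[OF TT UT] by simp
    qed
    ultimately show ?case by (simp add: L'_def)
  qed
  from this[of "\<T> - S"] have "pr {T} ` (K \<inter> sp (\<T> - (\<T> - S))) = T"
    using finite_factors by blast
  moreover have "\<T> - (\<T> - S) = S" by (auto simp: S_def)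
  ultimately show ?thesis by simp
qed

text \<open>The strip through \<open>T\<close> is involved in \<open>K\<close>, so it has to be \<open>T\<close> itself.\<close>
lemma factor_subset_if_no_strip:
  assumes K: "subgroup K A" "K \<subseteq> M" and T: "T \<in> \<T>" "pr {T} ` K = T"
    and none: "\<not> (\<exists>X. full_strip A M \<T> X \<and> nontrivial_strip A M \<T> X \<and> involved A M \<T> X K)"
  shows "T \<subseteq> K"
proof -
  define S where "S = {U \<in> \<T>. pr {U} ` K = U}"
  have unl: "pr {T} ` (K \<inter> sp S) = T"
    using proj_avoiding_proper_factors[OF K] T by (simp add: S_def)
  have S: "S \<subseteq> \<T>" and sd: "T \<in> S" "\<And>U. U \<in> S \<Longrightarrow> pr {U} ` K = U"
    using T by (auto simp: S_def)
  obtain I where I: "T \<in> I" "I \<subseteq> S"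
    and onto: "\<And>U. U \<in> I \<Longrightarrow> pr {U} ` (K \<inter> sp I) = U"
    and faithful: "\<And>U x. \<lbrakk>U \<in> I; x \<in> K \<inter> sp I; pr {U} x = \<one>\<rbrakk> \<Longrightarrow> x = \<one>"
    and proj_K: "\<And>k. k \<in> K \<Longrightarrow> pr I k \<in> K"
    using strip_through_factor[OF K S sd(2,1) unl] by blast
  have IT: "I \<subseteq> \<T>" using I by (auto simp: S_def)
  have "I = {T}"
  proof (rule ccontr)
    assume "I \<noteq> {T}"
    then have two: "2 \<le> card I" by (rule card_ge_two_if_other[OF I(1) _ IT])
    have "full_strip A M \<T> (K \<inter> sp I)"
      by (rule strip_involvedI(1)[OF K IT two]) (fact onto faithful proj_K)+
    moreover have "nontrivial_strip A M \<T> (K \<inter> sp I)"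
      by (rule strip_involvedI(2)[OF K IT two]) (fact onto faithful proj_K)+
    moreover have "involved A M \<T> (K \<inter> sp I) K"
      by (rule strip_involvedI(3)[OF K IT two]) (fact onto faithful proj_K)+
    ultimately show False using none by blast
  qed
  then show ?thesis using factor_subset_if_trivial_strip[OF T(1)] onto[of T] by simp
qed

text \<open>
  The strip through \<open>T\<close> has a second factor \<open>U\<close> in its support, and on \<open>K\<close> both projections factor
  faithfully through the projection to the strip.
\<close>
lemma linked_partner:
  assumes K: "subgroup K A" "K \<subseteq> M" and sd: "\<And>U. U \<in> \<T> \<Longrightarrow> pr {U} ` K = U"
    and T: "T \<in> \<T>" "\<not> T \<subseteq> K"
  obtains U where "U \<in> \<T>" "U \<noteq> T" "\<And>k. k \<in> K \<Longrightarrow> pr {T} k = \<one> \<longleftrightarrow> pr {U} k = \<one>"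
proof -
  have unl: "pr {T} ` (K \<inter> sp \<T>) = T"
    using sd[OF T(1)] K(2) by (simp add: subproduct_all Int_absorb2)
  obtain I where I: "T \<in> I" "I \<subseteq> \<T>"
    and onto: "\<And>U. U \<in> I \<Longrightarrow> pr {U} ` (K \<inter> sp I) = U"
    and faithful: "\<And>U x. \<lbrakk>U \<in> I; x \<in> K \<inter> sp I; pr {U} x = \<one>\<rbrakk> \<Longrightarrow> x = \<one>"
    and proj_K: "\<And>k. k \<in> K \<Longrightarrow> pr I k \<in> K"
    using strip_through_factor[OF K _ sd T(1) unl] by blast
  have "I \<noteq> {T}" using factor_subset_if_trivial_strip[OF T(1)] onto[OF I(1)] T(2) by auto
  then obtain U where U: "U \<in> I" "U \<noteq> T" using I(1) by blast
  have ker: "pr {V'} k = \<one>" if k: "k \<in> K" "V \<in> I" "V' \<in> I" "pr {V} k = \<one>" for k V V'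
  proof -
    have kM: "k \<in> M" using k K by auto
    have "pr I k \<in> K \<inter> sp I" using proj_K k proj_decompose(1)[OF I(2) kM] by auto
    moreover have "pr {V} (pr I k) = \<one>" using k I kM by (simp add: proj_proj)
    ultimately have "pr I k = \<one>" using faithful k(2) by blast
    then have "pr {V'} (pr I k) = \<one>" using k I by auto
    then show ?thesis using k I kM by (simp add: proj_proj)
  qed
  show thesis using that[of U] U I ker by blast
qed

text \<open>
  Call two factors equivalent if their projections have the same kernel in \<open>K\<close>. An element of \<open>K\<close> is
  determined by one coordinate per class, so \<open>|K|\<close> is at most \<open>q\<close> to the number of classes, where \<open>q\<close>
  is the order of the factors. A factor that is not contained in \<open>K\<close> shares its class with another
  such factor, so \<open>p\<close> factors of this kind contribute at most \<open>p / 2\<close> classes.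
\<close>
lemma card_subdirect_le:
  assumes K: "subgroup K A" "K \<subseteq> M" and sd: "\<And>U. U \<in> \<T> \<Longrightarrow> pr {U} ` K = U"
  shows "(card K)\<^sup>2 * (\<Prod>T | T \<in> \<T> \<and> \<not> T \<subseteq> K. card T) \<le> (card M)\<^sup>2"
proof (cases "\<T> = {}")
  case True
  then have "M = {\<one>}" using subproduct_all subproduct_empty by simp
  moreover have "\<one> \<in> K" using K(1) by (rule subgroup.one_closed)
  ultimately have "K = M" using K(2) by auto
  then show ?thesis using True by simp
next
  case False
  then obtain T0 where T0: "T0 \<in> \<T>" by blast
  define q where "q = card T0"
  have q: "card T = q" if "T \<in> \<T>" for T using card_factors_eq[OF that T0] by (simp add: q_def)
  have q0: "q > 0" unfolding q_def using finite_factor[OF T0] subgroup.one_closed[OF factor_subgroup[OF T0]]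
    by (auto simp: card_gt_0_iff)
  define P where "P = {T \<in> \<T>. \<not> T \<subseteq> K}"
  define N where "N T = {k \<in> K. pr {T} k = \<one>}" for T
  have finP: "finite P" "P \<subseteq> \<T>" using finite_factors by (auto simp: P_def)
  \<comment> \<open>Every fibre of \<open>N\<close> over \<open>P\<close> has at least two elements.\<close>
  have "2 * card (N ` P) \<le> card P"
  proof -
    have "card P = (\<Sum>n\<in>N ` P. card {T \<in> P. N T = n})"
      using sum.image_gen[OF finP(1), of "\<lambda>_. 1::nat" N] by simp
    moreover have "2 \<le> card {T \<in> P. N T = n}" if n: "n \<in> N ` P" for n
    proof -
      obtain T where T: "T \<in> P" "n = N T" using n by auto
      then have "T \<in> \<T>" "\<not> T \<subseteq> K" by (auto simp: P_def)
      then obtain U where U: "U \<in> \<T>" "U \<noteq> T" "\<And>k. k \<in> K \<Longrightarrow> pr {T} k = \<one> \<longleftrightarrow> pr {U} k = \<one>"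
        using linked_partner[OF K sd] by metis
      have NU: "N U = N T" using U(3) by (auto simp: N_def)
      have "\<not> U \<subseteq> K"
      proof
        assume UK: "U \<subseteq> K"
        have "u = \<one>" if u: "u \<in> U" for u
        proof -
          have us: "u \<in> sp {U}" using u U(1) by (simp add: subproduct_single)
          have "pr {T} u = \<one>" using us U \<open>T \<in> \<T>\<close> by (intro proj_trivial[of "{T}" "{U}"]) auto
          then have "pr {U} u = \<one>" using U(3)[of u] UK u by blast
          then show ?thesis using proj_id[of "{U}" u] us U(1) by simp
        qed
        then show False using factor_nontrivial[OF U(1)] subgroup.one_closed[OF factor_subgroup[OF U(1)]] by blast
      qed
      then have "{T, U} \<subseteq> {T \<in> P. N T = n}" using T U NU by (auto simp: P_def)
      then have "card {T, U} \<le> card {T \<in> P. N T = n}" using finP(1) by (intro card_mono) auto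
      then show ?thesis using U(2) by simp
    qed
    ultimately show ?thesis
      using sum_mono[of "N ` P" "\<lambda>_. 2" "\<lambda>n. card {T \<in> P. N T = n}"] by simp
  qed
  moreover have "card (N ` \<T>) \<le> card (N ` P) + (card \<T> - card P)"
  proof -
    have "N ` \<T> = N ` P \<union> N ` (\<T> - P)" using finP(2) by blast
    then have "card (N ` \<T>) \<le> card (N ` P) + card (N ` (\<T> - P))" by (simp add: card_Un_le)
    also have "card (N ` (\<T> - P)) \<le> card (\<T> - P)" using finite_factors by (intro card_image_le) auto
    also have "card (\<T> - P) = card \<T> - card P" using finP by (intro card_Diff_subset) auto
    finally show ?thesis by simp
  qed
  moreover have "card P \<le> card \<T>" using finP finite_factors by (intro card_mono) auto
  ultimately have count: "2 * card (N ` \<T>) + card P \<le> 2 * card \<T>" by linarith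
  \<comment> \<open>One representative of each class.\<close>
  define R where "R = inv_into \<T> N ` (N ` \<T>)"
  have R: "R \<subseteq> \<T>" unfolding R_def by (auto intro: inv_into_into)
  have NR: "\<exists>U\<in>R. N U = N T" if "T \<in> \<T>" for T
    using that f_inv_into_f[of "N T" N \<T>] unfolding R_def
    by (intro bexI[of _ "inv_into \<T> N (N T)"]) auto
  have cR: "card R \<le> card (N ` \<T>)" unfolding R_def using finite_factors by (intro card_image_le) auto
  have "card K \<le> (\<Prod>T\<in>R. card T)"
  proof (rule card_le_prod_coordinates[OF R _ K(2)])
    show "finite T" if "T \<in> R" for T using that R finite_factor by blast
    fix k l assume kl: "k \<in> K" "l \<in> K" and eq: "\<And>T. T \<in> R \<Longrightarrow> pr {T} k = pr {T} l"
    have M: "k \<in> M" "l \<in> M" using kl K by auto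
    have klK: "inv k \<otimes> l \<in> K" using kl K(1) by (simp add: subgroup.m_closed subgroup.m_inv_closed)
    show "k = l"
    proof (rule eq_if_coordinates[OF M])
      fix T assume T: "T \<in> \<T>"
      obtain U where U: "U \<in> R" "N U = N T" using NR[OF T] by blast
      have "pr {U} (inv k \<otimes> l) = \<one>" using proj_eq_iff[of "{U}" k l] M eq[OF U(1)] U(1) R by auto
      then have "inv k \<otimes> l \<in> N T" using U(2) klK by (auto simp: N_def)
      then show "pr {T} k = pr {T} l" using proj_eq_iff[of "{T}" k l] M T by (auto simp: N_def)
    qed
  qed
  also have "\<dots> = q ^ card R" using q R by (simp add: subset_iff)
  also have "\<dots> \<le> q ^ card (N ` \<T>)" using cR q0 by (intro power_increasing) auto
  finally have cK: "card K \<le> q ^ card (N ` \<T>)" .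
  have "(\<Prod>T | T \<in> \<T> \<and> \<not> T \<subseteq> K. card T) = q ^ card P"
    using q by (simp add: P_def)
  then have "(card K)\<^sup>2 * (\<Prod>T | T \<in> \<T> \<and> \<not> T \<subseteq> K. card T) \<le> (q ^ card (N ` \<T>))\<^sup>2 * q ^ card P"
    using cK by (simp add: power_mono)
  also have "\<dots> = q ^ (2 * card (N ` \<T>) + card P)" by (simp add: power_add power_even_eq)
  also have "\<dots> \<le> q ^ (2 * card \<T>)" using count q0 by (intro power_increasing) auto
  also have "\<dots> = (\<Prod>T\<in>\<T>. card T)\<^sup>2" using q by (simp add: power_even_eq)
  also have "\<dots> \<le> (card M)\<^sup>2" using card_prod_factors_le[OF finite_M] by (intro power_mono) auto
  finally show ?thesis .
qed

end

section \<open>Powers dividing a factorial\<close>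

text \<open>
  This lemma and the next one are the recursive form of Legendre's formula for the multiplicity of a
  prime in a factorial.
\<close>
lemma multiplicity_fact_add:
  fixes p :: nat
  assumes p: "prime p" and r: "r < p"
  shows "multiplicity p (fact (p * k + r) :: nat) = multiplicity p (fact (p * k) :: nat)"
  using r
proof (induction r)
  case (Suc r)
  have "\<not> p dvd p * k + Suc r"
    using Suc.prems dvd_add_right_iff[of p "p * k" "Suc r"] nat_dvd_not_less[of "Suc r" p] by simp
  then have z: "multiplicity p (p * k + Suc r) = 0" by (rule not_dvd_imp_multiplicity_0)
  have "(fact (p * k + Suc r) :: nat) = (p * k + Suc r) * fact (p * k + r)"
    by (simp add: algebra_simps)
  then have "multiplicity p (fact (p * k + Suc r) :: nat) =
      multiplicity p (p * k + Suc r) + multiplicity p (fact (p * k + r) :: nat)"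
    using p prime_elem_multiplicity_mult_distrib[of p "p * k + Suc r" "fact (p * k + r)"]
    by (simp del: fact_Suc add: fact_nonzero)
  with z Suc show ?case by simp
qed simp

lemma multiplicity_fact_mult:
  fixes p :: nat
  assumes p: "prime p"
  shows "multiplicity p (fact (p * k) :: nat) = k + multiplicity p (fact k :: nat)"
proof (induction k)
  case (Suc k)
  have p0: "p > 0" using p by (rule prime_gt_0_nat)
  have "p * Suc k = Suc (p * k + (p - 1))" using p0 by simp
  then have "(fact (p * Suc k) :: nat) = (p * Suc k) * fact (p * k + (p - 1))"
    by (metis fact_Suc of_nat_id)
  also have "\<dots> = p * (Suc k * fact (p * k + (p - 1)))" by (simp only: mult.assoc)
  finally have "multiplicity p (fact (p * Suc k) :: nat) =
      multiplicity p p + (multiplicity p (Suc k) + multiplicity p (fact (p * k + (p - 1)) :: nat))"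
    using p p0 by (simp only: prime_elem_multiplicity_mult_distrib prime_imp_prime_elem
        mult_eq_0_iff fact_nonzero Suc_not_Zero simp_thms)
  also have "multiplicity p (fact (p * k + (p - 1)) :: nat) = k + multiplicity p (fact k :: nat)"
    using multiplicity_fact_add[OF p, of "p - 1" k] Suc p0 by simp
  also have "multiplicity p p = 1" using p by (simp add: prime_gt_0_nat prime_gt_1_nat)
  also have "1 + (multiplicity p (Suc k) + (k + multiplicity p (fact k :: nat))) =
      Suc k + (multiplicity p (Suc k) + multiplicity p (fact k :: nat))" by simp
  also have "multiplicity p (Suc k) + multiplicity p (fact k :: nat) = multiplicity p (fact (Suc k) :: nat)"
    using p prime_elem_multiplicity_mult_distrib[of p "Suc k" "fact k"] by simp
  finally show ?case .
qed simp

lemma multiplicity_fact_less: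
  fixes p :: nat
  assumes p: "prime p" and n: "n > 0"
  shows "multiplicity p (fact n :: nat) < n"
  using n
proof (induction n rule: less_induct)
  case (less n)
  define k where "k = n div p"
  have n: "n = p * k + n mod p" by (simp add: k_def)
  have "n mod p < p" using p by (simp add: prime_gt_0_nat)
  then have v: "multiplicity p (fact n :: nat) = k + multiplicity p (fact k :: nat)"
    using n multiplicity_fact_add[OF p, of "n mod p" k] multiplicity_fact_mult[OF p, of k] by simp
  show ?case
  proof (cases "k = 0")
    case True
    then show ?thesis using v less.prems by simp
  next
    case False
    have "2 * k \<le> p * k" using prime_ge_2_nat[OF p] by simp
    then have le: "2 * k \<le> n" using n by linarith
    then have "multiplicity p (fact k :: nat) < k" using less.IH[of k] False less.prems by simp
    then show ?thesis using v le by simp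
  qed
qed

text \<open>
  Rules out a faithful action of \<open>M\<close> on the \<open>n\<close> partitions of a decomposition of \<open>m ^ n\<close> points.
\<close>
lemma power_not_dvd_fact:
  fixes m n :: nat
  assumes "m \<ge> 2" "n > 0"
  shows "\<not> m ^ n dvd fact n"
proof
  assume dvd: "m ^ n dvd fact n"
  obtain p where p: "prime p" "p dvd m" using assms(1) prime_factor_nat[of m] by auto
  have "p ^ n dvd fact n" using dvd_trans[OF dvd_power_same[OF p(2)] dvd] .
  then have "n \<le> multiplicity p (fact n :: nat)"
    using p(1) by (intro multiplicity_geI) (auto dest: prime_gt_1_nat)
  then show False using multiplicity_fact_less[OF p(1) assms(2)] by simp
qed

lemma card_Bij:
  assumes "finite S"
  shows "card (Bij S) = fact (card S)"
proof -
  have "bij_betw (\<lambda>p. restrict p S) {p. p permutes S} (Bij S)"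
  proof (rule bij_betw_byWitness[where f' = "\<lambda>f x. if x \<in> S then f x else x"])
    show "\<forall>p\<in>{p. p permutes S}. (\<lambda>x. if x \<in> S then restrict p S x else x) = p"
      by (auto simp: permutes_not_in)
    show "\<forall>f\<in>Bij S. restrict (\<lambda>x. if x \<in> S then f x else x) S = f"
      by (auto simp: Bij_def extensional_def fun_eq_iff)
    show "(\<lambda>p. restrict p S) ` {p. p permutes S} \<subseteq> Bij S"
      by (auto simp: Bij_def permutes_imp_bij)
    show "(\<lambda>f x. if x \<in> S then f x else x) ` Bij S \<subseteq> {p. p permutes S}"
      by (auto simp: Bij_def intro!: bij_imp_permutes cong: bij_betw_cong)
  qed
  then show ?thesis using card_permutations[OF refl assms] bij_betw_same_card by metis
qed

section \<open>Non-abelian minimal normal subgroups\<close>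

lemma (in group) conj_subgroup_eq: "conj_subgroup G g T = (\<lambda>t. g \<otimes> t \<otimes> inv g) ` T"
  by (auto simp: conj_subgroup_def l_coset_def r_coset_def)

lemma (in group) conjugation_hom: "g \<in> carrier G \<Longrightarrow> group_hom G G (\<lambda>x. g \<otimes> x \<otimes> inv g)"
proof (intro group_hom.intro group_hom_axioms.intro homI group_axioms)
  fix x y assume *: "g \<in> carrier G" "x \<in> carrier G" "y \<in> carrier G"
  have "g \<otimes> x \<otimes> inv g \<otimes> (g \<otimes> y \<otimes> inv g) = g \<otimes> x \<otimes> (inv g \<otimes> g) \<otimes> y \<otimes> inv g"
    using * by (simp only: m_assoc m_closed inv_closed)
  then show "g \<otimes> (x \<otimes> y) \<otimes> inv g = g \<otimes> x \<otimes> inv g \<otimes> (g \<otimes> y \<otimes> inv g)"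
    using * by (simp add: m_assoc)
qed simp

lemma (in group) conj_conj:
  assumes "g \<in> carrier G" "h \<in> carrier G" "T \<subseteq> carrier G"
  shows "conj_subgroup G g (conj_subgroup G h T) = conj_subgroup G (g \<otimes> h) T"
  unfolding conj_subgroup_eq image_image using assms
  by (intro image_cong refl) (auto simp: m_assoc inv_mult_group subset_iff)

lemma (in group) conj_one: "T \<subseteq> carrier G \<Longrightarrow> conj_subgroup G \<one> T = T"
  unfolding conj_subgroup_eq by (force simp: subset_iff image_iff)

lemma (in group) conj_inv:
  assumes "g \<in> carrier G" "T \<subseteq> carrier G"
  shows "conj_subgroup G (inv g) (conj_subgroup G g T) = T"
    and "conj_subgroup G g (conj_subgroup G (inv g) T) = T"
  using assms by (simp_all add: conj_conj conj_one)

lemma (in group) conj_mono: "S \<subseteq> T \<Longrightarrow> conj_subgroup G g S \<subseteq> conj_subgroup G g T"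
  unfolding conj_subgroup_eq by blast

lemma (in group) conj_iso:
  assumes g: "g \<in> carrier G" and T: "subgroup T G"
  shows "(\<lambda>x. g \<otimes> x \<otimes> inv g) \<in> Group.iso (G\<lparr>carrier := T\<rparr>) (G\<lparr>carrier := conj_subgroup G g T\<rparr>)"
proof -
  interpret c: group_hom G G "\<lambda>x. g \<otimes> x \<otimes> inv g" using g by (rule conjugation_hom)
  have "inj_on (\<lambda>x. g \<otimes> x \<otimes> inv g) T"
  proof (rule inj_onI)
    have undo: "inv g \<otimes> (g \<otimes> x \<otimes> inv g) \<otimes> g = x" if "x \<in> T" for x
    proof -
      have "x \<in> carrier G" using that T subgroup.subset by blast
      then have "inv g \<otimes> (g \<otimes> x \<otimes> inv g) \<otimes> g = inv g \<otimes> (g \<otimes> x)" using g by (simp add: m_assoc)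
      then show ?thesis using g \<open>x \<in> carrier G\<close> by (simp add: m_assoc[symmetric])
    qed
    fix x y assume xy: "x \<in> T" "y \<in> T" "g \<otimes> x \<otimes> inv g = g \<otimes> y \<otimes> inv g"
    have "inv g \<otimes> (g \<otimes> x \<otimes> inv g) \<otimes> g = y" by (simp only: xy(3) undo[OF xy(2)])
    then show "x = y" by (simp only: undo[OF xy(1)])
  qed
  then show ?thesis
    unfolding Group.iso_def bij_betw_def hom_def conj_subgroup_eq
    using c.hom_mult subgroup.subset[OF T] by (auto simp: subset_iff)
qed

locale nonabelian_minimal_normal = group A for A (structure) +
  fixes G M :: "'a set" and \<T> :: "'a set set"
  assumes G_subgroup: "subgroup G A" and finite_G: "finite G"
    and minimal: "minimal_normal (A\<lparr>carrier := G\<rparr>) M"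
    and nonabelian: "\<not> comm_group (A\<lparr>carrier := M\<rparr>)"
    and factors: "\<T> = simple_normal_subgroups A M"
    and direct: "internal_direct_product A M \<T> (\<lambda>T. T)"
begin

lemma G_carrier: "g \<in> G \<Longrightarrow> g \<in> carrier A"
  using subgroup.subset[OF G_subgroup] by blast

lemma G_closed [simp]:
  "\<one> \<in> G" "\<lbrakk>g \<in> G; h \<in> G\<rbrakk> \<Longrightarrow> g \<otimes> h \<in> G" "g \<in> G \<Longrightarrow> inv g \<in> G"
  using G_subgroup by (simp_all add: subgroup.one_closed subgroup.m_closed subgroup.m_inv_closed)

lemma M_normal: "M \<lhd> A\<lparr>carrier := G\<rparr>"
  using minimal by (simp add: minimal_normal_def)

lemma M_sub: "subgroup M A" "M \<subseteq> G"
  using M_normal[unfolded normal_in_subgroup_iff[OF G_subgroup]] by simp_all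

lemma M_conj: "\<lbrakk>g \<in> G; m \<in> M\<rbrakk> \<Longrightarrow> g \<otimes> m \<otimes> inv g \<in> M"
  using M_normal[unfolded normal_in_subgroup_iff[OF G_subgroup]] by simp

lemma minimalD:
  assumes "subgroup N A" "N \<subseteq> M" "\<And>g n. \<lbrakk>g \<in> G; n \<in> N\<rbrakk> \<Longrightarrow> g \<otimes> n \<otimes> inv g \<in> N"
  shows "N = {\<one>} \<or> N = M"
proof -
  have "N \<lhd> A\<lparr>carrier := G\<rparr>"
    unfolding normal_in_subgroup_iff[OF G_subgroup] using assms M_sub(2) by auto
  then show ?thesis using minimal assms(2) by (simp add: minimal_normal_def)
qed

sublocale direct_factors A M \<T>
proof (intro direct_factors.intro direct_factors_axioms.intro)
  show "group A" by (rule group_axioms)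
  have finM: "finite M" using M_sub(2) finite_G finite_subset by blast
  show "subgroup M A" by (rule M_sub)
  have "\<T> \<subseteq> Pow M"
  proof
    fix T assume "T \<in> \<T>"
    then have "T \<lhd> A\<lparr>carrier := M\<rparr>" by (simp add: factors simple_normal_subgroups_def)
    then show "T \<in> Pow M" using normal_in_subgroup_iff[OF M_sub(1)] by auto
  qed
  then show "finite \<T>" using finM finite_subset by blast
  show "T \<lhd> A\<lparr>carrier := M\<rparr>" if "T \<in> \<T>" for T
    using that by (simp add: factors simple_normal_subgroups_def)
  show "generate A (\<Union>\<T>) = M" using direct by (simp add: internal_direct_product_def)
  show "T \<inter> generate A (\<Union>(\<T> - {T})) = {\<one>}" if "T \<in> \<T>" for T
    using direct that by (simp add: internal_direct_product_def)
qed

lemma factor_simple_group: "T \<in> \<T> \<Longrightarrow> simple_group (A\<lparr>carrier := T\<rparr>)"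
  by (simp add: factors simple_normal_subgroups_def)

lemma conj_factor:
  assumes g: "g \<in> G" and T: "T \<in> \<T>"
  shows "conj_subgroup A g T \<in> \<T>"
proof -
  have gA: "g \<in> carrier A" using g by (rule G_carrier)
  have sT: "subgroup T A" "T \<subseteq> M" using factor_subgroup factor_subset T by auto
  have TA: "T \<subseteq> carrier A" using sT(1) by (rule subgroup.subset)
  interpret c: group_hom A A "\<lambda>x. g \<otimes> x \<otimes> inv g" using gA by (rule conjugation_hom)
  have s: "subgroup (conj_subgroup A g T) A"
    unfolding conj_subgroup_eq using sT(1) by (rule c.subgroup_img_is_subgroup)
  have "conj_subgroup A g T \<lhd> A\<lparr>carrier := M\<rparr>"
    unfolding normal_in_subgroup_iff[OF M_subgroup]
  proof (intro conjI ballI)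
    show "subgroup (conj_subgroup A g T) A" by (rule s)
    show "conj_subgroup A g T \<subseteq> M" using M_conj[OF g] sT(2) by (auto simp: conj_subgroup_eq)
    fix m x assume m: "m \<in> M" and "x \<in> conj_subgroup A g T"
    then obtain t where t: "t \<in> T" "x = g \<otimes> t \<otimes> inv g" by (auto simp: conj_subgroup_eq)
    define n where "n = inv g \<otimes> m \<otimes> inv (inv g)"
    have n: "n \<in> M" unfolding n_def using M_conj[of "inv g" m] g m by simp
    have c: "m \<in> carrier A" "n \<in> carrier A" "t \<in> carrier A" using m n t(1) TA by auto
    have "m = g \<otimes> n \<otimes> inv g"
      using c gA by (simp add: n_def m_assoc) (simp add: m_assoc[symmetric])
    then have "m \<otimes> x \<otimes> inv m = (g \<otimes> n \<otimes> inv g) \<otimes> (g \<otimes> t \<otimes> inv g) \<otimes> inv (g \<otimes> n \<otimes> inv g)"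
      using t by simp
    also have "\<dots> = g \<otimes> (n \<otimes> t \<otimes> inv n) \<otimes> inv g"
      using c c.hom_mult[of n t] c.hom_mult[of "n \<otimes> t" "inv n"] c.hom_inv[of n] by simp
    finally show "m \<otimes> x \<otimes> inv m \<in> conj_subgroup A g T"
      using factor_conj[OF T n t(1)] by (auto simp: conj_subgroup_eq)
  qed
  moreover have "simple_group (A\<lparr>carrier := conj_subgroup A g T\<rparr>)"
    by (rule simple_group.iso_simple[OF factor_simple_group[OF T] subgroup_imp_group[OF s] conj_iso[OF gA sT(1)]])
  ultimately show ?thesis by (simp add: factors simple_normal_subgroups_def)
qed

lemma conj_subproduct:
  assumes g: "g \<in> G" and I: "I \<subseteq> \<T>"
  shows "conj_subgroup A g (sp I) = sp (conj_subgroup A g ` I)"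
proof -
  interpret c: group_hom A A "\<lambda>x. g \<otimes> x \<otimes> inv g" using G_carrier[OF g] by (rule conjugation_hom)
  have sub: "\<Union>I \<subseteq> carrier A" using I factor_subset M_carrier by blast
  have "\<Union>(conj_subgroup A g ` I) = (\<lambda>x. g \<otimes> x \<otimes> inv g) ` \<Union>I" by (auto simp: conj_subgroup_eq)
  then show ?thesis
    unfolding subproduct_def using c.generate_img[OF sub] by (simp add: conj_subgroup_eq)
qed

lemma factor_carrier: "T \<in> \<T> \<Longrightarrow> T \<subseteq> carrier A"
  using factor_subgroup by (rule subgroup.subset)

lemma conj_inj_factors: "g \<in> G \<Longrightarrow> inj_on (conj_subgroup A g) \<T>"
  using conj_inv(1)[OF G_carrier factor_carrier] by (metis inj_on_inverseI)

lemma conj_image_factors: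
  assumes g: "g \<in> G"
  shows "conj_subgroup A g ` \<T> = \<T>"
proof
  show "conj_subgroup A g ` \<T> \<subseteq> \<T>" using conj_factor[OF g] by blast
  show "\<T> \<subseteq> conj_subgroup A g ` \<T>"
  proof
    fix T assume T: "T \<in> \<T>"
    have "T = conj_subgroup A g (conj_subgroup A (inv g) T)"
      using conj_inv(2)[OF G_carrier[OF g] factor_carrier[OF T]] by simp
    moreover have "conj_subgroup A (inv g) T \<in> \<T>" using conj_factor[of "inv g"] g T by simp
    ultimately show "T \<in> conj_subgroup A g ` \<T>" by blast
  qed
qed

lemma nontrivial_factor: "T \<in> \<T> \<Longrightarrow> T \<noteq> {\<one>}"
  using simple_group.simple_not_triv[OF factor_simple_group] by auto

text \<open>
  The product of a \<open>G\<close>-orbit of factors is a non-trivial normal subgroup of \<open>G\<close>, hence all of \<open>M\<close>. A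
  factor outside the orbit would meet it trivially.
\<close>
lemma conj_transitive:
  assumes T: "T \<in> \<T>" and U: "U \<in> \<T>"
  shows "\<exists>g\<in>G. conj_subgroup A g T = U"
proof -
  define \<O> where "\<O> = (\<lambda>g. conj_subgroup A g T) ` G"
  have O: "\<O> \<subseteq> \<T>" using conj_factor[OF _ T] by (auto simp: \<O>_def)
  have TO: "T \<in> \<O>" unfolding \<O>_def using conj_one[OF factor_carrier[OF T]] by (intro image_eqI[of _ _ \<one>]) auto
  have inv: "conj_subgroup A g ` \<O> \<subseteq> \<O>" if "g \<in> G" for g
    unfolding \<O>_def using conj_conj[OF G_carrier G_carrier factor_carrier[OF T]] that by auto
  have "sp \<O> = {\<one>} \<or> sp \<O> = M"
  proof (rule minimalD)
    show "subgroup (sp \<O>) A" "sp \<O> \<subseteq> M"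
      using O by (simp_all add: subproduct_subgroup subproduct_subset)
    fix g n assume "g \<in> G" "n \<in> sp \<O>"
    then have "g \<otimes> n \<otimes> inv g \<in> conj_subgroup A g (sp \<O>)" by (auto simp: conj_subgroup_eq)
    then show "g \<otimes> n \<otimes> inv g \<in> sp \<O>"
      using conj_subproduct[OF \<open>g \<in> G\<close> O] subproduct_mono[OF inv[OF \<open>g \<in> G\<close>]] by auto
  qed
  moreover have "sp \<O> \<noteq> {\<one>}"
    using factor_in_subproduct[OF TO] nontrivial_factor[OF T] subgroup.one_closed[OF factor_subgroup[OF T]] by blast
  ultimately have all: "sp \<O> = M" by blast
  have "U \<in> \<O>"
  proof (rule ccontr)
    assume "U \<notin> \<O>"
    then have "sp {U} \<inter> sp \<O> = {\<one>}" using U O by (intro subproduct_disjoint) auto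
    then have "U = {\<one>}" using all factor_subset[OF U] subproduct_single[OF U] by auto
    then show False using nontrivial_factor[OF U] by simp
  qed
  then show ?thesis by (auto simp: \<O>_def)
qed

lemma centre_trivial:
  assumes T: "T \<in> \<T>" and z: "z \<in> T" "\<And>t. t \<in> T \<Longrightarrow> z \<otimes> t = t \<otimes> z"
  shows "z = \<one>"
proof (rule ccontr)
  assume "z \<noteq> \<one>"
  note sT = factor_subgroup[OF T] and cT = factor_carrier[OF T]
  define Z where "Z = {x \<in> T. \<forall>t\<in>T. x \<otimes> t = t \<otimes> x}"
  have Tc: "x \<in> carrier A" if "x \<in> T" for x using that cT by blast
  have "Z \<lhd> A\<lparr>carrier := T\<rparr>"
    unfolding normal_in_subgroup_iff[OF sT]
  proof (intro conjI ballI)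
    show "subgroup Z A"
    proof (rule subgroupI)
      show "Z \<subseteq> carrier A" using cT by (auto simp: Z_def)
      show "Z \<noteq> {}" using z by (auto simp: Z_def)
      fix a assume a: "a \<in> Z"
      have "a \<in> T" using a unfolding Z_def by blast
      then have ai: "inv a \<in> T" using sT by (simp add: subgroup.m_inv_closed)
      have "inv a \<otimes> t = t \<otimes> inv a" if t: "t \<in> T" for t
      proof -
        have c: "a \<in> carrier A" "t \<in> carrier A" and at: "a \<otimes> t = t \<otimes> a" using a t Tc by (auto simp: Z_def)
        have "inv a \<otimes> t = inv a \<otimes> (t \<otimes> a) \<otimes> inv a" using c by (simp add: m_assoc)
        also have "\<dots> = inv a \<otimes> (a \<otimes> t) \<otimes> inv a" using at by simp
        also have "\<dots> = t \<otimes> inv a" using c by (simp add: m_assoc[symmetric])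
        finally show ?thesis .
      qed
      then show "inv a \<in> Z" using ai unfolding Z_def by blast
      fix b assume b: "b \<in> Z"
      have "a \<otimes> b \<otimes> t = t \<otimes> (a \<otimes> b)" if t: "t \<in> T" for t
      proof -
        have c: "a \<in> carrier A" "b \<in> carrier A" "t \<in> carrier A"
          and at: "a \<otimes> t = t \<otimes> a" "b \<otimes> t = t \<otimes> b" using a b t Tc by (auto simp: Z_def)
        have "a \<otimes> b \<otimes> t = a \<otimes> (t \<otimes> b)" using c at by (simp add: m_assoc)
        also have "\<dots> = t \<otimes> a \<otimes> b" using c at(1) by (simp add: m_assoc[symmetric])
        finally show ?thesis using c by (simp add: m_assoc)
      qed
      moreover have "a \<in> T" "b \<in> T" using a b unfolding Z_def by blast+
      then have "a \<otimes> b \<in> T" using sT by (simp add: subgroup.m_closed)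
      ultimately show "a \<otimes> b \<in> Z" unfolding Z_def by blast
    qed
    show "Z \<subseteq> T" by (auto simp: Z_def)
    fix m x assume mx: "m \<in> T" "x \<in> Z"
    then have c: "m \<in> carrier A" "x \<in> carrier A" using Tc by (auto simp: Z_def)
    have "x \<otimes> m = m \<otimes> x" using mx unfolding Z_def by blast
    then have "m \<otimes> x \<otimes> inv m = x \<otimes> m \<otimes> inv m" by simp
    also have "\<dots> = x" using c by (simp add: m_assoc)
    finally have "m \<otimes> x \<otimes> inv m = x" .
    then show "m \<otimes> x \<otimes> inv m \<in> Z" using mx by simp
  qed
  then have "Z = T \<or> Z = {\<one>}"
    using simple_group.no_real_normal_subgroup[OF factor_simple_group[OF T]] by fastforce
  moreover have "z \<in> Z" using z by (simp add: Z_def)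
  ultimately have ZT: "Z = T" using \<open>z \<noteq> \<one>\<close> by auto
  \<comment> \<open>One abelian factor makes all of them abelian, since they are conjugate, and then \<open>M\<close> is.\<close>
  have comm_U: "x \<otimes> y = y \<otimes> x" if U: "U \<in> \<T>" and xy: "x \<in> U" "y \<in> U" for U x y
  proof -
    obtain g where g: "g \<in> G" "conj_subgroup A g T = U" using conj_transitive[OF T U] by blast
    interpret c: group_hom A A "\<lambda>x. g \<otimes> x \<otimes> inv g" using G_carrier[OF g(1)] by (rule conjugation_hom)
    obtain s t where st: "s \<in> T" "x = g \<otimes> s \<otimes> inv g" "t \<in> T" "y = g \<otimes> t \<otimes> inv g"
      using xy g(2) by (auto simp: conj_subgroup_eq)
    have "s \<otimes> t = t \<otimes> s" using st(1,3) ZT unfolding Z_def by blast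
    moreover have "x \<otimes> y = g \<otimes> (s \<otimes> t) \<otimes> inv g" "y \<otimes> x = g \<otimes> (t \<otimes> s) \<otimes> inv g"
      using st c.hom_mult[of s t] c.hom_mult[of t s] Tc by simp_all
    ultimately show ?thesis by simp
  qed
  have "m \<otimes> n = n \<otimes> m" if mn: "m \<in> M" "n \<in> M" for m n
  proof (rule eq_if_coordinates)
    fix U assume U: "U \<in> \<T>"
    then have "pr {U} m \<otimes> pr {U} n = pr {U} n \<otimes> pr {U} m"
      using comm_U[OF U] proj_factor[OF U] mn by simp
    then show "pr {U} (m \<otimes> n) = pr {U} (n \<otimes> m)" using mn U by (simp add: proj_mult)
  qed (use mn in auto)
  then have "comm_group (A\<lparr>carrier := M\<rparr>)"
    using subgroup_imp_group[OF M_subgroup] by (intro group.group_comm_groupI) auto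
  then show False using nonabelian by simp
qed

sublocale simple_factors A M \<T>
proof (intro simple_factors.intro simple_factors_axioms.intro)
  show "direct_factors A M \<T>" by (rule direct_factors_axioms)
  show "finite M" using M_sub(2) finite_G finite_subset by blast
  show "N = {\<one>} \<or> N = T" if "T \<in> \<T>" "N \<lhd> A\<lparr>carrier := T\<rparr>" for T N
    using simple_group.no_real_normal_subgroup[OF factor_simple_group[OF that(1)] that(2)] by auto
  show "T \<noteq> {\<one>}" if "T \<in> \<T>" for T using that by (rule nontrivial_factor)
  show "z = \<one>" if "T \<in> \<T>" "z \<in> T" "\<And>t. t \<in> T \<Longrightarrow> z \<otimes> t = t \<otimes> z" for T z
    using that by (rule centre_trivial)
  show "card T = card U" if TU: "T \<in> \<T>" "U \<in> \<T>" for T U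
  proof -
    obtain g where g: "g \<in> G" "conj_subgroup A g T = U" using conj_transitive[OF TU] by blast
    have "(\<lambda>x. g \<otimes> x \<otimes> inv g) \<in> Group.iso (A\<lparr>carrier := T\<rparr>) (A\<lparr>carrier := U\<rparr>)"
      using conj_iso[OF G_carrier[OF g(1)] factor_subgroup[OF TU(1)]] g(2) by simp
    then show ?thesis by (auto simp: Group.iso_def intro: bij_betw_same_card)
  qed
qed

end

section \<open>Permutation groups with a non-abelian plinth\<close>

lemma (in group) card_eq_card_image_mult_card_fibre:
  assumes M: "subgroup M G" "finite M" and K: "K \<subseteq> M"
    and fibre: "\<And>m n. \<lbrakk>m \<in> M; n \<in> M\<rbrakk> \<Longrightarrow> f m = f n \<longleftrightarrow> inv m \<otimes> n \<in> K"
  shows "card M = card (f ` M) * card K"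
proof -
  have Mc: "m \<in> carrier G" if "m \<in> M" for m using that subgroup.subset[OF M(1)] by blast
  have "card {n \<in> M. f n = y} = card K" if y: "y \<in> f ` M" for y
  proof -
    obtain m where m: "m \<in> M" "y = f m" using y by blast
    have "{n \<in> M. f n = y} = (\<lambda>k. m \<otimes> k) ` K"
    proof
      show "{n \<in> M. f n = y} \<subseteq> (\<lambda>k. m \<otimes> k) ` K"
      proof
        fix n assume "n \<in> {n \<in> M. f n = y}"
        then have n: "n \<in> M" "f m = f n" using m by auto
        then have "inv m \<otimes> n \<in> K" using fibre m(1) by blast
        moreover have "m \<otimes> (inv m \<otimes> n) = n" using n m Mc by (simp add: m_assoc[symmetric])
        ultimately show "n \<in> (\<lambda>k. m \<otimes> k) ` K" by (metis image_eqI)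
      qed
      show "(\<lambda>k. m \<otimes> k) ` K \<subseteq> {n \<in> M. f n = y}"
      proof
        fix n assume "n \<in> (\<lambda>k. m \<otimes> k) ` K"
        then obtain k where k: "k \<in> K" "n = m \<otimes> k" by blast
        have kM: "k \<in> M" using k K by blast
        have n: "n \<in> M" using k kM m M(1) by (simp add: subgroup.m_closed)
        have "inv m \<otimes> n = k" using k kM m Mc by (simp add: m_assoc[symmetric])
        then have "f m = f n" using fibre[OF m(1) n] k by simp
        then show "n \<in> {n \<in> M. f n = y}" using n m by simp
      qed
    qed
    moreover have "inj_on (\<lambda>k. m \<otimes> k) K"
    proof (rule inj_onI)
      have undo: "inv m \<otimes> (m \<otimes> k) = k" if "k \<in> K" for k
        using that K m Mc by (simp add: m_assoc[symmetric] subset_iff)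
      fix k l assume "k \<in> K" "l \<in> K" "m \<otimes> k = m \<otimes> l"
      then show "k = l" using undo by metis
    qed
    ultimately show ?thesis by (simp add: card_image)
  qed
  moreover have "card M = (\<Sum>y\<in>f ` M. card {n \<in> M. f n = y})"
    using sum.image_gen[OF M(2), of "\<lambda>_. 1::nat" f] by simp
  ultimately show ?thesis by simp
qed

locale plinth_factors =
  fixes \<Omega> :: "'a set" and G M :: "('a \<Rightarrow> 'a) set" and \<T> :: "('a \<Rightarrow> 'a) set set" and \<omega> :: 'a
  assumes G_sub: "subgroup G (BijGroup \<Omega>)" and fin_G: "finite G"
    and plinth: "plinth \<Omega> G M" and nonab: "\<not> comm_group (perm_group \<Omega> M)"
    and facs: "\<T> = simple_normal_subgroups (BijGroup \<Omega>) M"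
    and dir: "internal_direct_product (BijGroup \<Omega>) M \<T> (\<lambda>T. T)"
    and point: "\<omega> \<in> \<Omega>"
begin

abbreviation B where "B \<equiv> BijGroup \<Omega>"

abbreviation mult_B (infixl \<open>\<cdot>\<close> 70) where "f \<cdot> g \<equiv> f \<otimes>\<^bsub>B\<^esub> g"

sublocale nonabelian_minimal_normal B G M \<T>
proof (intro nonabelian_minimal_normal.intro nonabelian_minimal_normal_axioms.intro)
  show "group B" by (rule group_BijGroup)
  show "minimal_normal (B\<lparr>carrier := G\<rparr>) M" using plinth by (simp add: plinth_def)
qed (fact G_sub fin_G nonab facs dir)+

subsection \<open>Permutations acting on points and on subsets\<close>

lemma act_in: "\<lbrakk>f \<in> carrier B; x \<in> \<Omega>\<rbrakk> \<Longrightarrow> f x \<in> \<Omega>"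
  by (auto simp: BijGroup_def Bij_def bij_betw_def)

lemma act_mult: "\<lbrakk>f \<in> carrier B; g \<in> carrier B; x \<in> \<Omega>\<rbrakk> \<Longrightarrow> (f \<cdot> g) x = f (g x)"
  by (simp add: BijGroup_def compose_eq)

lemma act_one: "x \<in> \<Omega> \<Longrightarrow> \<one>\<^bsub>B\<^esub> x = x"
  by (simp add: BijGroup_def)

lemma act_inv:
  assumes "f \<in> carrier B" "x \<in> \<Omega>"
  shows "(inv\<^bsub>B\<^esub> f) (f x) = x" and "f ((inv\<^bsub>B\<^esub> f) x) = x"
  using assms act_mult[of "inv\<^bsub>B\<^esub> f" f x] act_mult[of f "inv\<^bsub>B\<^esub> f" x] act_one by auto

lemma act_eqI:
  assumes f: "f \<in> carrier B" and g: "g \<in> carrier B" and eq: "\<And>x. x \<in> \<Omega> \<Longrightarrow> f x = g x"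
  shows "f = g"
proof (rule extensionalityI[of _ \<Omega>])
  show "f \<in> extensional \<Omega>" "g \<in> extensional \<Omega>" using f g by (simp_all add: BijGroup_def Bij_def)
qed (rule eq)

lemma image_in: "\<lbrakk>f \<in> carrier B; X \<subseteq> \<Omega>\<rbrakk> \<Longrightarrow> f ` X \<subseteq> \<Omega>"
  using act_in by blast

lemma image_mult: "\<lbrakk>f \<in> carrier B; g \<in> carrier B; X \<subseteq> \<Omega>\<rbrakk> \<Longrightarrow> (f \<cdot> g) ` X = f ` g ` X"
  unfolding image_image by (intro image_cong refl act_mult) auto

lemma image_one: "X \<subseteq> \<Omega> \<Longrightarrow> \<one>\<^bsub>B\<^esub> ` X = X"
  using act_one by (auto simp: image_iff subset_iff)

lemma image_inv:
  assumes "f \<in> carrier B" "X \<subseteq> \<Omega>"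
  shows "(inv\<^bsub>B\<^esub> f) ` f ` X = X" and "f ` (inv\<^bsub>B\<^esub> f) ` X = X"
  using assms image_mult[of "inv\<^bsub>B\<^esub> f" f X] image_mult[of f "inv\<^bsub>B\<^esub> f" X] image_one by auto

lemma M_transitive: "\<lbrakk>x \<in> \<Omega>; y \<in> \<Omega>\<rbrakk> \<Longrightarrow> \<exists>m\<in>M. m x = y"
  using plinth transitive_action.unique_orbit[of "perm_group \<Omega> M" \<Omega> id x y] by (simp add: plinth_def)

abbreviation H where "H \<equiv> point_stabilizer \<Omega> M \<omega>"

lemma H_iff: "m \<in> H \<longleftrightarrow> m \<in> M \<and> m \<omega> = \<omega>"
  by (simp add: stabilizer_def)

lemma H_subset: "H \<subseteq> M"
  using H_iff by blast

lemma H_subgroup: "subgroup H B"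
proof (rule subgroupI)
  show "H \<subseteq> carrier B" using H_subset M_carrier by blast
  show "H \<noteq> {}" using H_iff[of "\<one>\<^bsub>B\<^esub>"] act_one[OF point] by auto
  fix a assume a: "a \<in> H"
  then show "inv\<^bsub>B\<^esub> a \<in> H" using act_inv(1)[of a \<omega>] point by (auto simp: H_iff)
  fix b assume "b \<in> H"
  then show "a \<cdot> b \<in> H" using a act_mult[of a b \<omega>] point by (auto simp: H_iff)
qed

text \<open>Since \<open>M\<close> is transitive, a normal subset of \<open>M\<close> that fixes one point fixes all of them.\<close>
lemma normal_in_stabilizer_trivial:
  assumes N: "N \<subseteq> M" "\<And>m n. \<lbrakk>m \<in> M; n \<in> N\<rbrakk> \<Longrightarrow> m \<cdot> n \<cdot> inv\<^bsub>B\<^esub> m \<in> N" and NH: "N \<subseteq> H"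
  shows "N \<subseteq> {\<one>\<^bsub>B\<^esub>}"
proof
  fix n assume n: "n \<in> N"
  have nc: "n \<in> carrier B" using n N(1) by auto
  have "n = \<one>\<^bsub>B\<^esub>"
  proof (rule act_eqI)
    fix x assume x: "x \<in> \<Omega>"
    obtain m where m: "m \<in> M" "m \<omega> = x" using M_transitive[OF point x] by blast
    have mc: "m \<in> carrier B" using m by auto
    have "inv\<^bsub>B\<^esub> m \<cdot> n \<cdot> inv\<^bsub>B\<^esub> (inv\<^bsub>B\<^esub> m) \<in> H" using N(2)[of "inv\<^bsub>B\<^esub> m" n] NH m n by auto
    then have "(inv\<^bsub>B\<^esub> m \<cdot> n \<cdot> m) \<omega> = \<omega>" using mc by (simp add: H_iff)
    moreover have "(inv\<^bsub>B\<^esub> m \<cdot> n \<cdot> m) \<omega> = (inv\<^bsub>B\<^esub> m) (n x)"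
      using mc nc point x m(2) act_mult[of "inv\<^bsub>B\<^esub> m" n x]
        act_mult[of "inv\<^bsub>B\<^esub> m \<cdot> n" m \<omega>] by simp
    ultimately have "m ((inv\<^bsub>B\<^esub> m) (n x)) = m \<omega>" by simp
    then have "n x = x" using act_inv(2)[OF mc act_in[OF nc x]] m(2) by simp
    then show "n x = \<one>\<^bsub>B\<^esub> x" using act_one[OF x] by simp
  qed (use nc in auto)
  then show "n \<in> {\<one>\<^bsub>B\<^esub>}" by simp
qed

lemma factor_not_in_stabilizer:
  assumes T: "T \<in> \<T>"
  shows "\<not> T \<subseteq> H"
proof
  assume "T \<subseteq> H"
  then have "T \<subseteq> {\<one>\<^bsub>B\<^esub>}"
    using normal_in_stabilizer_trivial[OF factor_subset[OF T] factor_conj[OF T]] by simp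
  then show False
    using nontrivial_factor[OF T] subgroup.one_closed[OF factor_subgroup[OF T]] by blast
qed

lemma finite_points: "finite \<Omega>"
proof -
  have "\<Omega> \<subseteq> (\<lambda>m. m \<omega>) ` M" using M_transitive[OF point] by blast
  then show ?thesis using finite_M finite_surj by blast
qed

lemma card_points: "card M = card \<Omega> * card H"
proof -
  have "m \<omega> = n \<omega> \<longleftrightarrow> inv\<^bsub>B\<^esub> m \<cdot> n \<in> H" if mn: "m \<in> M" "n \<in> M" for m n
  proof -
    have c: "m \<in> carrier B" "n \<in> carrier B" using mn by auto
    have eq: "(inv\<^bsub>B\<^esub> m \<cdot> n) \<omega> = (inv\<^bsub>B\<^esub> m) (n \<omega>)" using c point by (simp add: act_mult)
    show ?thesis
    proof
      assume "m \<omega> = n \<omega>"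
      then have "(inv\<^bsub>B\<^esub> m) (n \<omega>) = \<omega>" using act_inv(1)[OF c(1) point] by simp
      then show "inv\<^bsub>B\<^esub> m \<cdot> n \<in> H" using eq mn by (simp add: H_iff)
    next
      assume "inv\<^bsub>B\<^esub> m \<cdot> n \<in> H"
      then have "(inv\<^bsub>B\<^esub> m) (n \<omega>) = \<omega>" using eq by (simp add: H_iff)
      then show "m \<omega> = n \<omega>" using act_inv(2)[OF c(1) act_in[OF c(2) point]] by simp
    qed
  qed
  then have "card M = card ((\<lambda>m. m \<omega>) ` M) * card H"
    by (rule card_eq_card_image_mult_card_fibre[OF M_subgroup finite_M H_subset])
  moreover have "(\<lambda>m. m \<omega>) ` M = \<Omega>" using M_transitive[OF point] act_in point by auto
  ultimately show ?thesis by simp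
qed

subsection \<open>Invariant partitions\<close>

abbreviation act :: "('a \<Rightarrow> 'a) \<Rightarrow> 'a set set \<Rightarrow> 'a set set" where
  "act g \<Gamma> \<equiv> ((`) g) ` \<Gamma>"

definition blk :: "'a set set \<Rightarrow> 'a \<Rightarrow> 'a set" where
  "blk \<Gamma> x = (THE \<gamma>. \<gamma> \<in> \<Gamma> \<and> x \<in> \<gamma>)"

lemma blk:
  assumes "partition_on \<Omega> \<Gamma>" "x \<in> \<Omega>"
  shows "blk \<Gamma> x \<in> \<Gamma>" and "x \<in> blk \<Gamma> x" and "\<lbrakk>\<gamma> \<in> \<Gamma>; x \<in> \<gamma>\<rbrakk> \<Longrightarrow> \<gamma> = blk \<Gamma> x"
proof -
  obtain \<gamma> where \<gamma>: "\<gamma> \<in> \<Gamma>" "x \<in> \<gamma>" using assms by (auto simp: partition_on_def)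
  have u: "\<delta> = \<gamma>" if "\<delta> \<in> \<Gamma> \<and> x \<in> \<delta>" for \<delta>
    using disjointD[OF partition_onD2[OF assms(1)], of \<delta> \<gamma>] that \<gamma> by blast
  have eq: "blk \<Gamma> x = \<gamma>" unfolding blk_def by (rule the_equality) (use \<gamma> u in blast)+
  show "blk \<Gamma> x \<in> \<Gamma>" "x \<in> blk \<Gamma> x" using eq \<gamma> by auto
  show "\<lbrakk>\<gamma> \<in> \<Gamma>; x \<in> \<gamma>\<rbrakk> \<Longrightarrow> \<gamma> = blk \<Gamma> x" for \<gamma> using eq u by blast
qed

lemma block_subset: "\<lbrakk>partition_on \<Omega> \<Gamma>; \<gamma> \<in> \<Gamma>\<rbrakk> \<Longrightarrow> \<gamma> \<subseteq> \<Omega>"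
  by (auto simp: partition_on_def)

lemma act_act:
  assumes "f \<in> carrier B" "g \<in> carrier B" "partition_on \<Omega> \<Gamma>"
  shows "act (f \<cdot> g) \<Gamma> = act f (act g \<Gamma>)"
proof -
  have "(f \<cdot> g) ` \<gamma> = f ` g ` \<gamma>" if "\<gamma> \<in> \<Gamma>" for \<gamma>
    using block_subset[OF assms(3) that] by (rule image_mult[OF assms(1,2)])
  then show ?thesis by (simp add: image_image[of "(`) f"])
qed

lemma act_one_partition: "partition_on \<Omega> \<Gamma> \<Longrightarrow> act \<one>\<^bsub>B\<^esub> \<Gamma> = \<Gamma>"
  using block_subset image_one by (auto simp: image_iff)

definition block_stab :: "'a set set \<Rightarrow> ('a \<Rightarrow> 'a) set" where
  "block_stab \<Gamma> = {m \<in> M. m ` blk \<Gamma> \<omega> = blk \<Gamma> \<omega>}"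

lemma block_stabilizers_eq: "block_stabilizers \<Omega> M \<omega> \<E> = block_stab ` \<E>"
  by (auto simp: block_stabilizers_def block_stab_def stabilizer_def blk_def)

definition M_invariant :: "'a set set \<Rightarrow> bool" where
  "M_invariant \<Gamma> \<longleftrightarrow> partition_on \<Omega> \<Gamma> \<and> (\<forall>m\<in>M. act m \<Gamma> = \<Gamma>)"

context
  fixes \<Gamma> assumes inv: "M_invariant \<Gamma>"
begin

lemma inv_partition: "partition_on \<Omega> \<Gamma>"
  using inv by (simp add: M_invariant_def)

lemma blk_act:
  assumes m: "m \<in> M" and x: "x \<in> \<Omega>"
  shows "blk \<Gamma> (m x) = m ` blk \<Gamma> x"
proof -
  have "m ` blk \<Gamma> x \<in> act m \<Gamma>" using blk(1)[OF inv_partition x] by blast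
  then have "m ` blk \<Gamma> x \<in> \<Gamma>" using inv m by (simp add: M_invariant_def)
  moreover have "m x \<in> m ` blk \<Gamma> x" using blk(2)[OF inv_partition x] by blast
  ultimately show ?thesis using blk(3)[OF inv_partition act_in[OF in_carrier[OF m] x]] by blast
qed

lemma blk_eq_iff:
  assumes "x \<in> \<Omega>" "y \<in> \<Omega>"
  shows "blk \<Gamma> x = blk \<Gamma> y \<longleftrightarrow> x \<in> blk \<Gamma> y"
  using blk[OF inv_partition assms(1)] blk[OF inv_partition assms(2)] by metis

lemma block_stab_iff: "m \<in> block_stab \<Gamma> \<longleftrightarrow> m \<in> M \<and> m \<omega> \<in> blk \<Gamma> \<omega>"
proof -
  have "m ` blk \<Gamma> \<omega> = blk \<Gamma> \<omega> \<longleftrightarrow> m \<omega> \<in> blk \<Gamma> \<omega>" if m: "m \<in> M"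
    using blk_act[OF m point] blk_eq_iff[OF act_in[OF in_carrier[OF m] point] point] by simp
  then show ?thesis by (auto simp: block_stab_def)
qed

lemma block_stab_subset: "block_stab \<Gamma> \<subseteq> M"
  by (auto simp: block_stab_def)

lemma stab_subset_block_stab: "H \<subseteq> block_stab \<Gamma>"
  using blk(2)[OF inv_partition point] H_iff block_stab_iff by auto

lemma block_stab_subgroup: "subgroup (block_stab \<Gamma>) B"
proof (rule subgroupI)
  have sub: "blk \<Gamma> \<omega> \<subseteq> \<Omega>" using block_subset[OF inv_partition] blk(1)[OF inv_partition point] by blast
  show "block_stab \<Gamma> \<subseteq> carrier B" using block_stab_subset M_carrier by blast
  show "block_stab \<Gamma> \<noteq> {}" using stab_subset_block_stab subgroup.one_closed[OF H_subgroup] by blast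
  fix a assume a: "a \<in> block_stab \<Gamma>"
  then have aM: "a \<in> M" "a ` blk \<Gamma> \<omega> = blk \<Gamma> \<omega>" by (auto simp: block_stab_def)
  have "(inv\<^bsub>B\<^esub> a) ` blk \<Gamma> \<omega> = blk \<Gamma> \<omega>"
    using image_inv(1)[OF in_carrier[OF aM(1)] sub] aM(2) by simp
  then show "inv\<^bsub>B\<^esub> a \<in> block_stab \<Gamma>" using aM by (simp add: block_stab_def)
  fix b assume "b \<in> block_stab \<Gamma>"
  then have bM: "b \<in> M" "b ` blk \<Gamma> \<omega> = blk \<Gamma> \<omega>" by (auto simp: block_stab_def)
  have "(a \<cdot> b) ` blk \<Gamma> \<omega> = blk \<Gamma> \<omega>"
    using image_mult[OF in_carrier[OF aM(1)] in_carrier[OF bM(1)] sub] aM(2) bM(2) by simp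
  then show "a \<cdot> b \<in> block_stab \<Gamma>" using aM bM by (simp add: block_stab_def)
qed

lemma blk_eq_orbit: "blk \<Gamma> \<omega> = (\<lambda>k. k \<omega>) ` block_stab \<Gamma>"
proof
  show "(\<lambda>k. k \<omega>) ` block_stab \<Gamma> \<subseteq> blk \<Gamma> \<omega>" using block_stab_iff by blast
  show "blk \<Gamma> \<omega> \<subseteq> (\<lambda>k. k \<omega>) ` block_stab \<Gamma>"
  proof
    fix x assume x: "x \<in> blk \<Gamma> \<omega>"
    then have "x \<in> \<Omega>" using block_subset[OF inv_partition] blk(1)[OF inv_partition point] by blast
    then obtain m where "m \<in> M" "m \<omega> = x" using M_transitive[OF point] by blast
    then show "x \<in> (\<lambda>k. k \<omega>) ` block_stab \<Gamma>" using x block_stab_iff by blast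
  qed
qed

lemma blocks_eq: "\<Gamma> = (\<lambda>m. m ` blk \<Gamma> \<omega>) ` M"
proof
  show "(\<lambda>m. m ` blk \<Gamma> \<omega>) ` M \<subseteq> \<Gamma>"
    using blk_act[OF _ point] blk(1)[OF inv_partition act_in[OF in_carrier point]] by auto
  show "\<Gamma> \<subseteq> (\<lambda>m. m ` blk \<Gamma> \<omega>) ` M"
  proof
    fix \<gamma> assume \<gamma>: "\<gamma> \<in> \<Gamma>"
    then obtain x where x: "x \<in> \<gamma>" "x \<in> \<Omega>"
      using partition_onD3[OF inv_partition] block_subset[OF inv_partition \<gamma>] \<gamma> by (metis all_not_in_conv subsetD)
    obtain m where m: "m \<in> M" "m \<omega> = x" using M_transitive[OF point x(2)] by blast
    have "\<gamma> = blk \<Gamma> x" using blk(3)[OF inv_partition x(2) \<gamma> x(1)] .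
    then have "\<gamma> = m ` blk \<Gamma> \<omega>" using blk_act[OF m(1) point] m(2) by simp
    then show "\<gamma> \<in> (\<lambda>m. m ` blk \<Gamma> \<omega>) ` M" using m by blast
  qed
qed

lemma card_blocks: "card M = card \<Gamma> * card (block_stab \<Gamma>)"
proof -
  have sub: "blk \<Gamma> \<omega> \<subseteq> \<Omega>" using block_subset[OF inv_partition] blk(1)[OF inv_partition point] by blast
  have "m ` blk \<Gamma> \<omega> = n ` blk \<Gamma> \<omega> \<longleftrightarrow> inv\<^bsub>B\<^esub> m \<cdot> n \<in> block_stab \<Gamma>" if mn: "m \<in> M" "n \<in> M" for m n
  proof -
    have c: "m \<in> carrier B" "n \<in> carrier B" using mn by auto
    have eq: "(inv\<^bsub>B\<^esub> m \<cdot> n) ` blk \<Gamma> \<omega> = (inv\<^bsub>B\<^esub> m) ` n ` blk \<Gamma> \<omega>"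
      using c sub by (intro image_mult) auto
    show ?thesis
    proof
      assume "m ` blk \<Gamma> \<omega> = n ` blk \<Gamma> \<omega>"
      then have "(inv\<^bsub>B\<^esub> m) ` n ` blk \<Gamma> \<omega> = blk \<Gamma> \<omega>" using image_inv(1)[OF c(1) sub] by simp
      then show "inv\<^bsub>B\<^esub> m \<cdot> n \<in> block_stab \<Gamma>" using eq mn by (simp add: block_stab_def)
    next
      assume "inv\<^bsub>B\<^esub> m \<cdot> n \<in> block_stab \<Gamma>"
      then have "(inv\<^bsub>B\<^esub> m) ` n ` blk \<Gamma> \<omega> = blk \<Gamma> \<omega>" using eq by (simp add: block_stab_def)
      then show "m ` blk \<Gamma> \<omega> = n ` blk \<Gamma> \<omega>"
        using image_inv(2)[OF c(1) image_in[OF c(2) sub]] by simp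
    qed
  qed
  then have "card M = card ((\<lambda>m. m ` blk \<Gamma> \<omega>) ` M) * card (block_stab \<Gamma>)"
    by (rule card_eq_card_image_mult_card_fibre[OF M_subgroup finite_M block_stab_subset])
  then show ?thesis using blocks_eq by simp
qed

text \<open>
  The blocks are the \<open>M\<close>-translates of one block. This frees statements about \<open>block_stab\<close> from the
  base point, which elements of \<open>G\<close> need not fix.
\<close>
lemma normal_subset_block_stab_iff:
  assumes N: "N \<subseteq> M" "\<And>m n. \<lbrakk>m \<in> M; n \<in> N\<rbrakk> \<Longrightarrow> m \<cdot> n \<cdot> inv\<^bsub>B\<^esub> m \<in> N"
  shows "N \<subseteq> block_stab \<Gamma> \<longleftrightarrow> (\<forall>n\<in>N. \<forall>\<gamma>\<in>\<Gamma>. n ` \<gamma> = \<gamma>)"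
proof
  assume "\<forall>n\<in>N. \<forall>\<gamma>\<in>\<Gamma>. n ` \<gamma> = \<gamma>"
  then show "N \<subseteq> block_stab \<Gamma>" using N(1) blk(1)[OF inv_partition point] by (auto simp: block_stab_def)
next
  assume NK: "N \<subseteq> block_stab \<Gamma>"
  have sub: "blk \<Gamma> \<omega> \<subseteq> \<Omega>" using block_subset[OF inv_partition] blk(1)[OF inv_partition point] by blast
  show "\<forall>n\<in>N. \<forall>\<gamma>\<in>\<Gamma>. n ` \<gamma> = \<gamma>"
  proof (intro ballI)
    fix n \<gamma> assume n: "n \<in> N" and "\<gamma> \<in> \<Gamma>"
    then obtain m where m: "m \<in> M" "\<gamma> = m ` blk \<Gamma> \<omega>" using blocks_eq by blast
    have c: "m \<in> carrier B" "n \<in> carrier B" using m n N(1) by auto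
    define n' where "n' = inv\<^bsub>B\<^esub> m \<cdot> n \<cdot> m"
    have "n' \<in> N" using N(2)[of "inv\<^bsub>B\<^esub> m" n] m n c by (simp add: n'_def)
    then have n'K: "n' ` blk \<Gamma> \<omega> = blk \<Gamma> \<omega>" and n'c: "n' \<in> carrier B"
      using NK N(1) by (auto simp: block_stab_def)
    have "n \<cdot> m = m \<cdot> n'" using c by (simp add: n'_def m_assoc[symmetric])
    then have "n ` m ` blk \<Gamma> \<omega> = m ` n' ` blk \<Gamma> \<omega>"
      using image_mult[OF c(2,1) sub] image_mult[OF c(1) n'c sub] by simp
    then show "n ` \<gamma> = \<gamma>" using n'K m(2) by simp
  qed
qed

lemma factor_subset_block_stab_iff:
  "T \<in> \<T> \<Longrightarrow> T \<subseteq> block_stab \<Gamma> \<longleftrightarrow> (\<forall>t\<in>T. \<forall>\<gamma>\<in>\<Gamma>. t ` \<gamma> = \<gamma>)"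
  by (rule normal_subset_block_stab_iff[OF factor_subset factor_conj])

end

lemma factor_subset_block_stab_act:
  assumes inv: "M_invariant \<Gamma>" "M_invariant (act g \<Gamma>)" and g: "g \<in> G" and T: "T \<in> \<T>"
    and TK: "T \<subseteq> block_stab \<Gamma>"
  shows "conj_subgroup B g T \<subseteq> block_stab (act g \<Gamma>)"
proof -
  have gc: "g \<in> carrier B" using g by (rule G_carrier)
  have fix': "\<forall>t\<in>T. \<forall>\<gamma>\<in>\<Gamma>. t ` \<gamma> = \<gamma>" using factor_subset_block_stab_iff[OF inv(1) T] TK by blast
  have "u ` \<delta> = \<delta>" if u: "u \<in> conj_subgroup B g T" and \<delta>: "\<delta> \<in> act g \<Gamma>" for u \<delta>
  proof -
    obtain t where t: "t \<in> T" "u = g \<cdot> t \<cdot> inv\<^bsub>B\<^esub> g" using u by (auto simp: conj_subgroup_eq)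
    obtain \<gamma> where \<gamma>: "\<gamma> \<in> \<Gamma>" "\<delta> = g ` \<gamma>" using \<delta> by blast
    have sub: "\<gamma> \<subseteq> \<Omega>" using block_subset[OF inv_partition[OF inv(1)] \<gamma>(1)] .
    have tc: "t \<in> carrier B" "u \<in> carrier B" using t T factor_carrier gc by auto
    have "u \<cdot> g = g \<cdot> t" using gc tc t(2) by (simp add: m_assoc)
    then have "u ` g ` \<gamma> = g ` t ` \<gamma>"
      using image_mult[OF tc(2) gc sub] image_mult[OF gc tc(1) sub] by simp
    then show ?thesis using \<gamma> fix' t(1) by simp
  qed
  then show ?thesis using factor_subset_block_stab_iff[OF inv(2) conj_factor[OF g T]] by blast
qed

end

section \<open>Orbits of normal subgroups as invariant partitions\<close>

context plinth_factors
begin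

text \<open>Both partitions consist of the \<open>M\<close>-translates of the orbit of \<open>\<omega>\<close> under the common stabiliser.\<close>
lemma M_invariant_eqI:
  assumes "M_invariant \<Gamma>" "M_invariant \<Delta>" "block_stab \<Gamma> = block_stab \<Delta>"
  shows "\<Gamma> = \<Delta>"
  using blocks_eq[OF assms(1)] blocks_eq[OF assms(2)]
    blk_eq_orbit[OF assms(1)] blk_eq_orbit[OF assms(2)] assms(3) by simp

definition orb :: "('a \<Rightarrow> 'a) set set \<Rightarrow> 'a \<Rightarrow> 'a set" where
  "orb I x = (\<lambda>n. n x) ` sp I"

definition orbit_partition :: "('a \<Rightarrow> 'a) set set \<Rightarrow> 'a set set" where
  "orbit_partition I = orb I ` \<Omega>"

lemma subproduct_carrier: "\<lbrakk>I \<subseteq> \<T>; n \<in> sp I\<rbrakk> \<Longrightarrow> n \<in> carrier B"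
  using subproduct_subset M_carrier by blast

lemma orb_subset: "\<lbrakk>I \<subseteq> \<T>; x \<in> \<Omega>\<rbrakk> \<Longrightarrow> orb I x \<subseteq> \<Omega>"
  unfolding orb_def using subproduct_carrier act_in by blast

lemma orb_refl: "\<lbrakk>I \<subseteq> \<T>; x \<in> \<Omega>\<rbrakk> \<Longrightarrow> x \<in> orb I x"
  unfolding orb_def using subproduct_closed(1)[of I] act_one[of x] by (intro image_eqI[of _ _ "\<one>\<^bsub>B\<^esub>"]) auto

lemma orb_eqI:
  assumes I: "I \<subseteq> \<T>" and x: "x \<in> \<Omega>" and y: "y \<in> orb I x"
  shows "orb I y = orb I x"
proof -
  obtain n where n: "n \<in> sp I" "y = n x" using y by (auto simp: orb_def)
  have nc: "n \<in> carrier B" using n I subproduct_carrier by blast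
  show ?thesis
  proof
    show "orb I y \<subseteq> orb I x"
    proof
      fix z assume "z \<in> orb I y"
      then obtain k where k: "k \<in> sp I" "z = k y" by (auto simp: orb_def)
      then have "z = (k \<cdot> n) x" using n nc I x subproduct_carrier by (simp add: act_mult)
      moreover have "k \<cdot> n \<in> sp I" using k n I by (simp add: subproduct_closed)
      ultimately show "z \<in> orb I x" by (simp add: orb_def)
    qed
    show "orb I x \<subseteq> orb I y"
    proof
      fix z assume "z \<in> orb I x"
      then obtain k where k: "k \<in> sp I" "z = k x" by (auto simp: orb_def)
      have kc: "k \<in> carrier B" using k I subproduct_carrier by blast
      have "(k \<cdot> inv\<^bsub>B\<^esub> n) y = k ((inv\<^bsub>B\<^esub> n) y)"
        using kc nc n x by (intro act_mult) (auto intro: act_in)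
      then have "z = (k \<cdot> inv\<^bsub>B\<^esub> n) y" using k n nc x by (simp add: act_inv)
      moreover have "k \<cdot> inv\<^bsub>B\<^esub> n \<in> sp I" using k n I by (simp add: subproduct_closed)
      ultimately show "z \<in> orb I y" by (simp add: orb_def)
    qed
  qed
qed

lemma orbit_partition_partition:
  assumes I: "I \<subseteq> \<T>"
  shows "partition_on \<Omega> (orbit_partition I)"
proof (rule partition_onI)
  show "\<Union>(orbit_partition I) = \<Omega>" using orb_subset[OF I] orb_refl[OF I] by (auto simp: orbit_partition_def)
  show "{} \<notin> orbit_partition I" using orb_refl[OF I] by (auto simp: orbit_partition_def)
  show "disjnt p q" if pq: "p \<in> orbit_partition I" "q \<in> orbit_partition I" "p \<noteq> q" for p q
  proof (rule ccontr)
    assume "\<not> disjnt p q"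
    then obtain z where z: "z \<in> p" "z \<in> q" by (auto simp: disjnt_def)
    obtain x y where xy: "x \<in> \<Omega>" "p = orb I x" "y \<in> \<Omega>" "q = orb I y"
      using pq(1,2) by (auto simp: orbit_partition_def)
    have "orb I z = orb I x" "orb I z = orb I y"
      using orb_eqI[OF I xy(1)] orb_eqI[OF I xy(3)] z xy(2,4) by blast+
    then show False using pq(3) xy(2,4) by metis
  qed
qed

lemma orb_image:
  assumes g: "g \<in> G" and I: "I \<subseteq> \<T>" and x: "x \<in> \<Omega>"
  shows "g ` orb I x = orb (conj_subgroup B g ` I) (g x)"
proof -
  have gc: "g \<in> carrier B" using g by (rule G_carrier)
  have step: "g (n x) = (g \<cdot> n \<cdot> inv\<^bsub>B\<^esub> g) (g x)" if n: "n \<in> sp I" for n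
  proof -
    have nc: "n \<in> carrier B" using n I subproduct_carrier by blast
    have "(g \<cdot> n \<cdot> inv\<^bsub>B\<^esub> g) (g x) = (g \<cdot> n) ((inv\<^bsub>B\<^esub> g) (g x))"
      using gc nc x by (intro act_mult) (auto intro: act_in)
    then show ?thesis using gc nc x by (simp add: act_inv act_mult)
  qed
  have "g ` orb I x = (\<lambda>n. (g \<cdot> n \<cdot> inv\<^bsub>B\<^esub> g) (g x)) ` sp I"
    unfolding orb_def image_image by (rule image_cong[OF refl step])
  also have "\<dots> = (\<lambda>k. k (g x)) ` conj_subgroup B g (sp I)"
    by (simp add: conj_subgroup_eq image_image)
  finally show ?thesis by (simp add: orb_def conj_subproduct[OF g I])
qed

lemma act_orbit_partition:
  assumes g: "g \<in> G" and I: "I \<subseteq> \<T>"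
  shows "act g (orbit_partition I) = orbit_partition (conj_subgroup B g ` I)"
proof -
  have gc: "g \<in> carrier B" using g by (rule G_carrier)
  have "g ` \<Omega> = \<Omega>" using gc by (auto simp: BijGroup_def Bij_def bij_betw_def)
  then have "orbit_partition (conj_subgroup B g ` I) = (\<lambda>x. orb (conj_subgroup B g ` I) (g x)) ` \<Omega>"
    unfolding orbit_partition_def by (metis image_image)
  also have "\<dots> = act g (orbit_partition I)"
    unfolding orbit_partition_def image_image by (rule image_cong[OF refl]) (rule orb_image[OF g I, symmetric])
  finally show ?thesis by simp
qed

lemma conj_M_factor:
  assumes m: "m \<in> M" and T: "T \<in> \<T>"
  shows "conj_subgroup B m T = T"
proof
  have sub: "conj_subgroup B n T \<subseteq> T" if "n \<in> M" for n
    using factor_conj[OF T that] by (auto simp: conj_subgroup_eq)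
  show "conj_subgroup B m T \<subseteq> T" using sub[OF m] .
  have "conj_subgroup B m (conj_subgroup B (inv\<^bsub>B\<^esub> m) T) \<subseteq> conj_subgroup B m T"
    using m by (intro conj_mono sub) simp
  then show "T \<subseteq> conj_subgroup B m T" using conj_inv(2)[of m T] m factor_carrier[OF T] by auto
qed

lemma orbit_partition_invariant:
  assumes I: "I \<subseteq> \<T>"
  shows "M_invariant (orbit_partition I)"
  unfolding M_invariant_def
proof (intro conjI ballI)
  show "partition_on \<Omega> (orbit_partition I)" using I by (rule orbit_partition_partition)
  fix m assume m: "m \<in> M"
  have "conj_subgroup B m ` I = id ` I" using conj_M_factor[OF m] I by (intro image_cong) auto
  then show "act m (orbit_partition I) = orbit_partition I"
    using act_orbit_partition[of m I] m M_sub(2) I by auto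
qed

lemma blk_orbit_partition:
  assumes "I \<subseteq> \<T>" "x \<in> \<Omega>"
  shows "blk (orbit_partition I) x = orb I x"
  using blk(3)[OF orbit_partition_partition[OF assms(1)] assms(2), of "orb I x"] orb_refl[OF assms] assms(2)
  by (auto simp: orbit_partition_def)

text \<open>
  The stabiliser of the orbit of \<open>\<omega>\<close> under a normal subgroup \<open>N\<close> is \<open>N H\<close>, and the subproduct over
  \<open>\<T> - P\<close> is the kernel of the projection to \<open>P\<close>.
\<close>
lemma block_stab_orbit_partition_iff:
  assumes P: "P \<subseteq> \<T>"
  shows "m \<in> block_stab (orbit_partition (\<T> - P)) \<longleftrightarrow> m \<in> M \<and> pr P m \<in> pr P ` H"
proof -
  have P': "\<T> - P \<subseteq> \<T>" by blast
  have "m \<omega> \<in> orb (\<T> - P) \<omega> \<longleftrightarrow> pr P m \<in> pr P ` H" if m: "m \<in> M"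
  proof
    assume "m \<omega> \<in> orb (\<T> - P) \<omega>"
    then obtain n where n: "n \<in> sp (\<T> - P)" "m \<omega> = n \<omega>" by (auto simp: orb_def)
    have nM: "n \<in> M" using n P' by auto
    define h where "h = inv\<^bsub>B\<^esub> n \<cdot> m"
    have "h \<omega> = (inv\<^bsub>B\<^esub> n) (n \<omega>)" unfolding h_def using nM m point n(2) by (simp add: act_mult)
    then have h: "h \<in> H" using nM m point by (simp add: H_iff h_def act_inv)
    have "pr P n = \<one>\<^bsub>B\<^esub>" using proj_eq_one_iff[OF P nM] n by simp
    then have "pr P h = pr P m"
      unfolding h_def using nM m P by (simp add: proj_mult proj_inv)
    then show "pr P m \<in> pr P ` H" using h by (metis image_eqI)
  next
    assume "pr P m \<in> pr P ` H"
    then obtain h where h: "h \<in> H" "pr P m = pr P h" by blast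
    have hM: "h \<in> M" "h \<omega> = \<omega>" using h by (simp_all add: H_iff)
    define n where "n = m \<cdot> inv\<^bsub>B\<^esub> h"
    have nM: "n \<in> M" using m hM by (simp add: n_def)
    have "pr P n = \<one>\<^bsub>B\<^esub>" unfolding n_def using m hM P h(2) by (simp add: proj_mult proj_inv)
    then have n: "n \<in> sp (\<T> - P)" using proj_eq_one_iff[OF P nM] by simp
    have "n \<omega> = m ((inv\<^bsub>B\<^esub> h) \<omega>)" unfolding n_def using m hM point by (simp add: act_mult)
    moreover have "(inv\<^bsub>B\<^esub> h) \<omega> = \<omega>" using act_inv(1)[of h \<omega>] hM point by simp
    ultimately show "m \<omega> \<in> orb (\<T> - P) \<omega>" using n unfolding orb_def by (metis image_eqI)
  qed
  then show ?thesis
    unfolding block_stab_iff[OF orbit_partition_invariant[OF P']] blk_orbit_partition[OF P' point] by blast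
qed

lemma part_subgroup_eq:
  assumes P: "P \<subseteq> \<T>"
  shows "part_subgroup \<Omega> M \<T> \<omega> P = block_stab (orbit_partition (\<T> - P))"
proof
  have P': "\<T> - P \<subseteq> \<T>" by blast
  show "part_subgroup \<Omega> M \<T> \<omega> P \<subseteq> block_stab (orbit_partition (\<T> - P))"
  proof
    fix k assume "k \<in> part_subgroup \<Omega> M \<T> \<omega> P"
    then obtain h n where k: "h \<in> H" "n \<in> sp (\<T> - P)" "k = pr P h \<cdot> n"
      by (auto simp: part_subgroup_def set_mult_def)
    have hn: "h \<in> M" "n \<in> M" using k H_subset P' by auto
    then have "k \<in> M" using k(3) P by simp
    note M = hn this
    have "pr P k = pr P h"
      unfolding k(3) using k(2) M P by (intro proj_eqI proj_decompose(1)) auto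
    then show "k \<in> block_stab (orbit_partition (\<T> - P))"
      unfolding block_stab_orbit_partition_iff[OF P] using M k(1) by (metis image_eqI)
  qed
  show "block_stab (orbit_partition (\<T> - P)) \<subseteq> part_subgroup \<Omega> M \<T> \<omega> P"
  proof
    fix k assume "k \<in> block_stab (orbit_partition (\<T> - P))"
    then have k: "k \<in> M" "pr P k \<in> pr P ` H" by (simp_all add: block_stab_orbit_partition_iff[OF P])
    have "k = pr P k \<cdot> pr (\<T> - P) k" by (rule proj_decompose(2)[OF P k(1)])
    moreover have "pr (\<T> - P) k \<in> sp (\<T> - P)" by (rule proj_decompose(1)[OF P' k(1)])
    ultimately show "k \<in> part_subgroup \<Omega> M \<T> \<omega> P"
      using k(2) unfolding part_subgroup_def set_mult_def by blast
  qed
qed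

text \<open>The construction of the theorem in a form that does not mention the base point.\<close>
lemma cartesian_of_partition_eq:
  assumes "\<And>P. P \<in> \<P> \<Longrightarrow> P \<subseteq> \<T>"
  shows "cartesian_of_partition \<Omega> M \<T> \<omega> \<P> = (\<lambda>P. orbit_partition (\<T> - P)) ` \<P>"
  unfolding cartesian_of_partition_def
proof (rule image_cong[OF refl])
  fix P assume "P \<in> \<P>"
  then have P: "P \<subseteq> \<T>" by (rule assms)
  let ?\<Gamma> = "orbit_partition (\<T> - P)"
  have inv: "M_invariant ?\<Gamma>" by (rule orbit_partition_invariant) blast
  have "orbit (perm_group \<Omega> (part_subgroup \<Omega> M \<T> \<omega> P)) id \<omega> = blk ?\<Gamma> \<omega>"
    unfolding part_subgroup_eq[OF P] blk_eq_orbit[OF inv] by (auto simp: orbit_def)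
  then have "{m ` orbit (perm_group \<Omega> (part_subgroup \<Omega> M \<T> \<omega> P)) id \<omega> | m. m \<in> M} =
      (\<lambda>m. m ` blk ?\<Gamma> \<omega>) ` M" by auto
  then show "{m ` orbit (perm_group \<Omega> (part_subgroup \<Omega> M \<T> \<omega> P)) id \<omega> | m. m \<in> M} = ?\<Gamma>"
    by (simp only: blocks_eq[OF inv, symmetric])
qed

section \<open>Invariant Cartesian decompositions\<close>

context
  fixes \<E> assumes CD: "\<E> \<in> CD_tr \<Omega> G"
begin

lemma CD_cartesian: "cartesian_decomposition \<Omega> \<E>"
  using CD by (simp add: CD_tr_def)

lemma CD_card: "2 \<le> card \<E>"
  using CD_cartesian by (simp add: cartesian_decomposition_def)

lemma CD_finite: "finite \<E>"
  using CD_card by (metis card.infinite not_numeral_le_zero)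

lemma CD_partition: "\<Gamma> \<in> \<E> \<Longrightarrow> partition_on \<Omega> \<Gamma>"
  using CD_cartesian by (simp add: cartesian_decomposition_def)

lemma CD_two_blocks: "\<Gamma> \<in> \<E> \<Longrightarrow> \<exists>\<gamma>\<in>\<Gamma>. \<exists>\<delta>\<in>\<Gamma>. \<gamma> \<noteq> \<delta>"
  using CD_cartesian by (simp add: cartesian_decomposition_def)

lemma CD_act: "g \<in> G \<Longrightarrow> act g ` \<E> = \<E>"
  using CD by (simp add: CD_tr_def)

lemma CD_act_in: "\<lbrakk>g \<in> G; \<Gamma> \<in> \<E>\<rbrakk> \<Longrightarrow> act g \<Gamma> \<in> \<E>"
  using CD_act by blast

lemma CD_transitive: "\<lbrakk>\<Gamma> \<in> \<E>; \<Delta> \<in> \<E>\<rbrakk> \<Longrightarrow> \<exists>g\<in>G. act g \<Gamma> = \<Delta>"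
  using CD by (simp add: CD_tr_def)

lemma CD_act_bij: "g \<in> G \<Longrightarrow> bij_betw (act g) \<E> \<E>"
  using finite_surj_inj[OF CD_finite, of "act g"] CD_act[of g] by (simp add: bij_betw_def)

lemma CD_choice: "(\<And>\<Gamma>. \<Gamma> \<in> \<E> \<Longrightarrow> s \<Gamma> \<in> \<Gamma>) \<Longrightarrow> \<exists>x\<in>\<Omega>. (\<Inter>\<Gamma>\<in>\<E>. s \<Gamma>) = {x}"
proof -
  assume s: "\<And>\<Gamma>. \<Gamma> \<in> \<E> \<Longrightarrow> s \<Gamma> \<in> \<Gamma>"
  then have "card (\<Inter>\<Gamma>\<in>\<E>. s \<Gamma>) = 1" using CD_cartesian by (simp add: cartesian_decomposition_def)
  then obtain x where x: "(\<Inter>\<Gamma>\<in>\<E>. s \<Gamma>) = {x}" by (auto simp: card_1_singleton_iff)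
  obtain \<Gamma> where \<Gamma>: "\<Gamma> \<in> \<E>" using CD_card by fastforce
  have "x \<in> s \<Gamma>" using x \<Gamma> by blast
  then have "x \<in> \<Omega>" using block_subset[OF CD_partition[OF \<Gamma>] s[OF \<Gamma>]] by blast
  then show ?thesis using x by blast
qed

lemma CD_eqI:
  assumes x: "x \<in> \<Omega>" and y: "y \<in> \<Omega>" and eq: "\<And>\<Gamma>. \<Gamma> \<in> \<E> \<Longrightarrow> y \<in> blk \<Gamma> x"
  shows "y = x"
proof -
  obtain z where z: "(\<Inter>\<Gamma>\<in>\<E>. blk \<Gamma> x) = {z}"
    using CD_choice[of "\<lambda>\<Gamma>. blk \<Gamma> x"] blk(1)[OF CD_partition x] by blast
  have "x \<in> (\<Inter>\<Gamma>\<in>\<E>. blk \<Gamma> x)" using blk(2)[OF CD_partition x] by blast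
  moreover have "y \<in> (\<Inter>\<Gamma>\<in>\<E>. blk \<Gamma> x)" using eq by blast
  ultimately show ?thesis using z by auto
qed

text \<open>Sending a point to its blocks identifies \<open>\<Omega>\<close> with the Cartesian product of the partitions.\<close>
lemma CD_card_points: "card \<Omega> = (\<Prod>\<Gamma>\<in>\<E>. card \<Gamma>)"
proof -
  have "bij_betw (\<lambda>x. \<lambda>\<Gamma>\<in>\<E>. blk \<Gamma> x) \<Omega> (PiE \<E> (\<lambda>\<Gamma>. \<Gamma>))"
    unfolding bij_betw_def
  proof
    show "inj_on (\<lambda>x. \<lambda>\<Gamma>\<in>\<E>. blk \<Gamma> x) \<Omega>"
    proof (rule inj_onI)
      fix x y assume xy: "x \<in> \<Omega>" "y \<in> \<Omega>" and eq: "(\<lambda>\<Gamma>\<in>\<E>. blk \<Gamma> x) = (\<lambda>\<Gamma>\<in>\<E>. blk \<Gamma> y)"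
      have "x \<in> blk \<Gamma> y" if "\<Gamma> \<in> \<E>" for \<Gamma>
        using fun_cong[OF eq, of \<Gamma>] that blk(2)[OF CD_partition[OF that] xy(1)] by simp
      then show "x = y" using CD_eqI[OF xy(2,1)] by blast
    qed
    show "(\<lambda>x. \<lambda>\<Gamma>\<in>\<E>. blk \<Gamma> x) ` \<Omega> = PiE \<E> (\<lambda>\<Gamma>. \<Gamma>)"
    proof
      show "(\<lambda>x. \<lambda>\<Gamma>\<in>\<E>. blk \<Gamma> x) ` \<Omega> \<subseteq> PiE \<E> (\<lambda>\<Gamma>. \<Gamma>)" using blk(1)[OF CD_partition] by auto
      show "PiE \<E> (\<lambda>\<Gamma>. \<Gamma>) \<subseteq> (\<lambda>x. \<lambda>\<Gamma>\<in>\<E>. blk \<Gamma> x) ` \<Omega>"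
      proof
        fix s assume s: "s \<in> PiE \<E> (\<lambda>\<Gamma>. \<Gamma>)"
        then obtain x where x: "x \<in> \<Omega>" "(\<Inter>\<Gamma>\<in>\<E>. s \<Gamma>) = {x}" using CD_choice[of s] by (auto simp: PiE_def)
        have "s = (\<lambda>\<Gamma>\<in>\<E>. blk \<Gamma> x)"
        proof
          fix \<Gamma>
          show "s \<Gamma> = (\<lambda>\<Gamma>\<in>\<E>. blk \<Gamma> x) \<Gamma>"
          proof (cases "\<Gamma> \<in> \<E>")
            case True
            have "x \<in> s \<Gamma>" "s \<Gamma> \<in> \<Gamma>" using x(2) True s by auto
            then show ?thesis using blk(3)[OF CD_partition[OF True] x(1)] True by auto
          next
            case False
            then show ?thesis using s by (auto simp: PiE_def extensional_def)
          qed
        qed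
        then show "s \<in> (\<lambda>x. \<lambda>\<Gamma>\<in>\<E>. blk \<Gamma> x) ` \<Omega>" using x(1) by blast
      qed
    qed
  qed
  then have "card \<Omega> = card (PiE \<E> (\<lambda>\<Gamma>. \<Gamma>))" by (rule bij_betw_same_card)
  then show ?thesis using card_PiE[OF CD_finite, of "\<lambda>\<Gamma>. \<Gamma>"] by simp
qed

lemma CD_card_eq:
  assumes "\<Gamma> \<in> \<E>" "\<Delta> \<in> \<E>"
  shows "card \<Gamma> = card \<Delta>"
proof -
  obtain g where g: "g \<in> G" "act g \<Gamma> = \<Delta>" using CD_transitive[OF assms] by blast
  have "inj_on ((`) g) \<Gamma>"
  proof (rule inj_onI)
    fix \<gamma> \<delta> assume in\<Gamma>: "\<gamma> \<in> \<Gamma>" "\<delta> \<in> \<Gamma>" and eq: "g ` \<gamma> = g ` \<delta>"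
    note sub = block_subset[OF CD_partition[OF assms(1)] in\<Gamma>(1)]
      block_subset[OF CD_partition[OF assms(1)] in\<Gamma>(2)]
    have "(inv\<^bsub>B\<^esub> g) ` g ` \<gamma> = \<delta>"
      unfolding eq by (rule image_inv(1)[OF G_carrier[OF g(1)] sub(2)])
    then show "\<gamma> = \<delta>" unfolding image_inv(1)[OF G_carrier[OF g(1)] sub(1)] .
  qed
  then show ?thesis using g(2) card_image[of "(`) g" \<Gamma>] by simp
qed

lemma CD_card_ge_two:
  assumes "\<Gamma> \<in> \<E>"
  shows "2 \<le> card \<Gamma>"
proof -
  obtain \<gamma> \<delta> where "\<gamma> \<in> \<Gamma>" "\<delta> \<in> \<Gamma>" "\<gamma> \<noteq> \<delta>" using CD_two_blocks[OF assms] by blast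
  moreover have "finite \<Gamma>" using finite_elements[OF finite_points CD_partition[OF assms]] .
  ultimately have "card {\<gamma>, \<delta>} \<le> card \<Gamma>" by (intro card_mono) auto
  then show ?thesis using \<open>\<gamma> \<noteq> \<delta>\<close> by simp
qed

lemma CD_kernel_subgroup: "subgroup {m \<in> M. \<forall>\<Gamma>\<in>\<E>. act m \<Gamma> = \<Gamma>} B"
proof (rule subgroupI)
  let ?D = "{m \<in> M. \<forall>\<Gamma>\<in>\<E>. act m \<Gamma> = \<Gamma>}"
  show "?D \<subseteq> carrier B" by auto
  have "\<one>\<^bsub>B\<^esub> \<in> ?D" using act_one_partition[OF CD_partition] by auto
  then show "?D \<noteq> {}" by blast
  fix a assume a: "a \<in> ?D"
  have "act (inv\<^bsub>B\<^esub> a) \<Gamma> = \<Gamma>" if \<Gamma>: "\<Gamma> \<in> \<E>" for \<Gamma>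
  proof -
    have "act (inv\<^bsub>B\<^esub> a) (act a \<Gamma>) = \<Gamma>"
      using act_act[of "inv\<^bsub>B\<^esub> a" a \<Gamma>] act_one_partition[OF CD_partition[OF \<Gamma>]] CD_partition[OF \<Gamma>] a by auto
    then show ?thesis using a \<Gamma> by auto
  qed
  then show "inv\<^bsub>B\<^esub> a \<in> ?D" using a by auto
  fix b assume b: "b \<in> ?D"
  have "act (a \<cdot> b) \<Gamma> = \<Gamma>" if \<Gamma>: "\<Gamma> \<in> \<E>" for \<Gamma>
    using act_act[of a b \<Gamma>] CD_partition[OF \<Gamma>] a b \<Gamma> by auto
  then show "a \<cdot> b \<in> ?D" using a b by auto
qed

text \<open>
  The kernel \<open>D\<close> of the action of \<open>M\<close> on \<open>\<E>\<close> is normal in \<open>G\<close>. If it were trivial, then \<open>|M|\<close> would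
  divide the order of the symmetric group on \<open>\<E>\<close>, while the transitivity of \<open>M\<close> on points makes the
  power \<open>|\<Omega>|\<close> divide \<open>|M|\<close>.
\<close>
lemma CD_M_invariant:
  assumes "\<Gamma> \<in> \<E>"
  shows "M_invariant \<Gamma>"
proof -
  define D where "D = {m \<in> M. \<forall>\<Gamma>\<in>\<E>. act m \<Gamma> = \<Gamma>}"
  have "D = {\<one>\<^bsub>B\<^esub>} \<or> D = M"
  proof (rule minimalD)
    show "subgroup D B" unfolding D_def by (rule CD_kernel_subgroup)
    show "D \<subseteq> M" by (auto simp: D_def)
    fix g d assume g: "g \<in> G" and d: "d \<in> D"
    have c: "g \<in> carrier B" "d \<in> carrier B" using G_carrier[OF g] d by (auto simp: D_def)
    have "act (g \<cdot> d \<cdot> inv\<^bsub>B\<^esub> g) \<Gamma> = \<Gamma>" if \<Gamma>: "\<Gamma> \<in> \<E>" for \<Gamma>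
    proof -
      have i: "act (inv\<^bsub>B\<^esub> g) \<Gamma> \<in> \<E>" using CD_act_in[of "inv\<^bsub>B\<^esub> g"] g \<Gamma> by simp
      have "act (g \<cdot> d \<cdot> inv\<^bsub>B\<^esub> g) \<Gamma> = act (g \<cdot> d) (act (inv\<^bsub>B\<^esub> g) \<Gamma>)"
        using c CD_partition[OF \<Gamma>] by (intro act_act) auto
      also have "\<dots> = act g (act d (act (inv\<^bsub>B\<^esub> g) \<Gamma>))" using c CD_partition[OF i] by (intro act_act) auto
      also have "\<dots> = act g (act (inv\<^bsub>B\<^esub> g) \<Gamma>)" using d i by (simp add: D_def)
      also have "\<dots> = act (g \<cdot> inv\<^bsub>B\<^esub> g) \<Gamma>" using c CD_partition[OF \<Gamma>] by (intro act_act[symmetric]) auto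
      also have "\<dots> = \<Gamma>" using c act_one_partition[OF CD_partition[OF \<Gamma>]] by simp
      finally show ?thesis .
    qed
    moreover have "g \<cdot> d \<cdot> inv\<^bsub>B\<^esub> g \<in> M" using M_conj[OF g] d by (simp add: D_def)
    ultimately show "g \<cdot> d \<cdot> inv\<^bsub>B\<^esub> g \<in> D" by (simp add: D_def)
  qed
  moreover have "D \<noteq> {\<one>\<^bsub>B\<^esub>}"
  proof
    assume triv: "D = {\<one>\<^bsub>B\<^esub>}"
    define \<phi> where "\<phi> m = (\<lambda>\<Gamma>\<in>\<E>. act m \<Gamma>)" for m
    have MG: "m \<in> G" if "m \<in> M" for m using that M_sub(2) by blast
    have \<phi>_Bij: "\<phi> m \<in> Bij \<E>" if "m \<in> M" for m
      using CD_act_bij[OF MG[OF that]] by (auto simp: Bij_def \<phi>_def cong: bij_betw_cong)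
    have \<phi>_mult: "\<phi> (m \<cdot> n) = compose \<E> (\<phi> m) (\<phi> n)" if mn: "m \<in> M" "n \<in> M" for m n
    proof
      fix \<Gamma>
      show "\<phi> (m \<cdot> n) \<Gamma> = compose \<E> (\<phi> m) (\<phi> n) \<Gamma>"
      proof (cases "\<Gamma> \<in> \<E>")
        case True
        have "act (m \<cdot> n) \<Gamma> = act m (act n \<Gamma>)" using mn CD_partition[OF True] by (intro act_act) auto
        then show ?thesis using True CD_act_in[OF MG[OF mn(2)] True] by (simp add: \<phi>_def compose_eq)
      qed (simp add: \<phi>_def compose_def)
    qed
    interpret h: group_hom "B\<lparr>carrier := M\<rparr>" "BijGroup \<E>" \<phi>
    proof (intro group_hom.intro group_hom_axioms.intro homI)
      show "group (B\<lparr>carrier := M\<rparr>)" by (rule subgroup_imp_group[OF M_subgroup])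
      show "group (BijGroup \<E>)" by (rule group_BijGroup)
      show "\<phi> m \<in> carrier (BijGroup \<E>)" if "m \<in> carrier (B\<lparr>carrier := M\<rparr>)" for m
        using that \<phi>_Bij by (simp add: BijGroup_def)
      show "\<phi> (m \<otimes>\<^bsub>B\<lparr>carrier := M\<rparr>\<^esub> n) = \<phi> m \<otimes>\<^bsub>BijGroup \<E>\<^esub> \<phi> n"
        if "m \<in> carrier (B\<lparr>carrier := M\<rparr>)" "n \<in> carrier (B\<lparr>carrier := M\<rparr>)" for m n
        using that \<phi>_Bij \<phi>_mult[of m n] by (simp add: BijGroup_def[of \<E>])
    qed
    have "card (rcosets\<^bsub>BijGroup \<E>\<^esub> (\<phi> ` M)) * card (\<phi> ` M) = order (BijGroup \<E>)"
      using h.H.lagrange[OF h.img_is_subgroup] by simp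
    then have "card (\<phi> ` M) dvd order (BijGroup \<E>)" by (metis dvd_triv_right)
    then have "card (\<phi> ` M) dvd fact (card \<E>)"
      using card_Bij[OF CD_finite] by (simp add: order_def BijGroup_def)
    moreover have "inj_on \<phi> M"
    proof (rule inj_onI)
      fix m n assume mn: "m \<in> M" "n \<in> M" "\<phi> m = \<phi> n"
      have "act (inv\<^bsub>B\<^esub> m \<cdot> n) \<Gamma> = \<Gamma>" if \<Gamma>: "\<Gamma> \<in> \<E>" for \<Gamma>
      proof -
        have "act m \<Gamma> = act n \<Gamma>" using fun_cong[OF mn(3), of \<Gamma>] \<Gamma> by (simp add: \<phi>_def)
        moreover have "act (inv\<^bsub>B\<^esub> m \<cdot> n) \<Gamma> = act (inv\<^bsub>B\<^esub> m) (act n \<Gamma>)"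
          "act (inv\<^bsub>B\<^esub> m \<cdot> m) \<Gamma> = act (inv\<^bsub>B\<^esub> m) (act m \<Gamma>)"
          using mn by (simp_all only: act_act in_carrier M_closed CD_partition[OF \<Gamma>])
        ultimately show ?thesis using mn act_one_partition[OF CD_partition[OF \<Gamma>]] by simp
      qed
      then have "inv\<^bsub>B\<^esub> m \<cdot> n \<in> D" using mn by (simp add: D_def)
      then have "inv\<^bsub>B\<^esub> m \<cdot> n = \<one>\<^bsub>B\<^esub>" using triv by blast
      then show "m = n" using mn inv_equality[of "inv\<^bsub>B\<^esub> m" n] by (metis in_carrier inv_closed inv_inv)
    qed
    ultimately have "card M dvd fact (card \<E>)" by (simp add: card_image)
    moreover have "card \<Omega> dvd card M" using card_points by simp
    moreover have "card \<Omega> = card \<Gamma> ^ card \<E>"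
      using CD_card_points CD_card_eq[OF _ assms] by simp
    ultimately have "card \<Gamma> ^ card \<E> dvd fact (card \<E>)" by (metis dvd_trans)
    then show False using power_not_dvd_fact[OF CD_card_ge_two[OF assms], of "card \<E>"] CD_card by simp
  qed
  ultimately have "D = M" by blast
  then have "\<forall>m\<in>M. act m \<Gamma> = \<Gamma>" using assms unfolding D_def by blast
  then show ?thesis unfolding M_invariant_def using CD_partition[OF assms] by simp
qed

lemma CD_Inter_block_stab:
  assumes "\<And>\<Gamma>. \<Gamma> \<in> \<E> \<Longrightarrow> m \<in> block_stab \<Gamma>"
  shows "m \<in> H"
proof -
  obtain \<Gamma> where "\<Gamma> \<in> \<E>" using CD_card by fastforce
  then have m: "m \<in> M" using assms by (auto simp: block_stab_def)
  have "m \<omega> = \<omega>"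
    using block_stab_iff[OF CD_M_invariant] assms act_in[OF in_carrier[OF m] point] point
    by (intro CD_eqI) auto
  then show ?thesis using m by (simp add: H_iff)
qed

text \<open>The block of \<open>\<Gamma>\<close> at \<open>\<omega>\<close> meets the block of \<open>\<Delta>\<close> at \<open>m \<omega>\<close>; \<open>k\<close> carries \<open>\<omega>\<close> to a common point.\<close>
lemma CD_block_stab_mult:
  assumes "\<Gamma> \<in> \<E>" "\<Delta> \<in> \<E>" "\<Gamma> \<noteq> \<Delta>" and m: "m \<in> M"
  obtains k l where "k \<in> block_stab \<Gamma>" "l \<in> block_stab \<Delta>" "m = k \<cdot> l"
proof -
  have mc: "m \<in> carrier B" using m by auto
  define s where "s \<Lambda> = (if \<Lambda> = \<Gamma> then blk \<Gamma> \<omega> else blk \<Lambda> (m \<omega>))" for \<Lambda>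
  have "s \<Lambda> \<in> \<Lambda>" if "\<Lambda> \<in> \<E>" for \<Lambda>
    using blk(1)[OF CD_partition[OF that] point] blk(1)[OF CD_partition[OF that] act_in[OF mc point]]
    by (cases "\<Lambda> = \<Gamma>") (simp_all add: s_def)
  then obtain x where x: "x \<in> \<Omega>" "(\<Inter>\<Lambda>\<in>\<E>. s \<Lambda>) = {x}" using CD_choice[of s] by blast
  then have xs: "x \<in> s \<Gamma>" "x \<in> s \<Delta>" using assms by auto
  obtain k where k: "k \<in> M" "k \<omega> = x" using M_transitive[OF point x(1)] by blast
  have kK: "k \<in> block_stab \<Gamma>" using xs(1) k block_stab_iff[OF CD_M_invariant[OF assms(1)]] by (simp add: s_def)
  define l where "l = inv\<^bsub>B\<^esub> k \<cdot> m"
  have lM: "l \<in> M" using k m by (simp add: l_def)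
  have "x \<in> blk \<Delta> (m \<omega>)" using xs(2) assms(3) by (simp add: s_def)
  then have "blk \<Delta> (k \<omega>) = blk \<Delta> (m \<omega>)"
    using blk_eq_iff[OF CD_M_invariant[OF assms(2)] x(1) act_in[OF mc point]] k(2) by simp
  moreover have mkl: "m = k \<cdot> l" using k m by (simp add: l_def m_assoc[symmetric])
  ultimately have "blk \<Delta> (k \<omega>) = blk \<Delta> (k (l \<omega>))" using k lM point by (simp add: act_mult)
  then have "k ` blk \<Delta> \<omega> = k ` blk \<Delta> (l \<omega>)"
    using blk_act[OF CD_M_invariant[OF assms(2)] k(1)] point act_in[OF in_carrier[OF lM] point] by simp
  moreover have "blk \<Delta> \<omega> \<subseteq> \<Omega>" "blk \<Delta> (l \<omega>) \<subseteq> \<Omega>"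
    using block_subset[OF CD_partition[OF assms(2)]] blk(1)[OF CD_partition[OF assms(2)]]
      point act_in[OF in_carrier[OF lM] point] by auto
  ultimately have "blk \<Delta> \<omega> = blk \<Delta> (l \<omega>)" using image_inv(1)[OF in_carrier[OF k(1)]] by metis
  then have "l \<omega> \<in> blk \<Delta> \<omega>" using blk(2)[OF CD_partition[OF assms(2)] act_in[OF in_carrier[OF lM] point]] by simp
  then have "l \<in> block_stab \<Delta>" using lM block_stab_iff[OF CD_M_invariant[OF assms(2)]] by simp
  then show thesis using that[OF kK _ mkl] by blast
qed

lemma CD_block_stab_proper:
  assumes "\<Gamma> \<in> \<E>"
  shows "block_stab \<Gamma> \<noteq> M"
proof
  assume "block_stab \<Gamma> = M"
  then have "card M = card \<Gamma> * card M" using card_blocks[OF CD_M_invariant[OF assms]] by simp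
  moreover have "card M > 0" using finite_M M_closed(1) card_gt_0_iff by blast
  ultimately show False using CD_card_ge_two[OF assms] by simp
qed

lemma CD_factor_subset_act_iff:
  assumes g: "g \<in> G" and \<Gamma>: "\<Gamma> \<in> \<E>" and T: "T \<in> \<T>"
  shows "conj_subgroup B g T \<subseteq> block_stab (act g \<Gamma>) \<longleftrightarrow> T \<subseteq> block_stab \<Gamma>"
proof
  have gi: "inv\<^bsub>B\<^esub> g \<in> G" using g by simp
  have g\<Gamma>: "act g \<Gamma> \<in> \<E>" using CD_act_in[OF g \<Gamma>] .
  have undo: "act (inv\<^bsub>B\<^esub> g) (act g \<Gamma>) = \<Gamma>"
    using act_act[OF G_carrier[OF gi] G_carrier[OF g] CD_partition[OF \<Gamma>]]
      act_one_partition[OF CD_partition[OF \<Gamma>]] G_carrier[OF g] by simp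
  show "conj_subgroup B g T \<subseteq> block_stab (act g \<Gamma>)" if "T \<subseteq> block_stab \<Gamma>"
    using factor_subset_block_stab_act[OF CD_M_invariant[OF \<Gamma>] CD_M_invariant[OF g\<Gamma>] g T that] .
  assume "conj_subgroup B g T \<subseteq> block_stab (act g \<Gamma>)"
  then show "T \<subseteq> block_stab \<Gamma>"
    using factor_subset_block_stab_act[of "act g \<Gamma>" "inv\<^bsub>B\<^esub> g" "conj_subgroup B g T"]
      CD_M_invariant[OF g\<Gamma>] CD_M_invariant[OF \<Gamma>] gi conj_factor[OF g T]
    by (simp only: undo conj_inv(1)[OF G_carrier[OF g] factor_carrier[OF T]])
qed

end

end

section \<open>From decompositions to partitions of the factors\<close>

context plinth_factors
begin

definition moved_factors :: "'a set set \<Rightarrow> ('a \<Rightarrow> 'a) set set" where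
  "moved_factors \<Gamma> = {T \<in> \<T>. \<not> T \<subseteq> block_stab \<Gamma>}"

lemma factorising_partitions_iff:
  "\<P> \<in> factorising_partitions \<Omega> G M \<T> \<omega> \<longleftrightarrow>
     partition_on \<T> \<P> \<and> 2 \<le> card \<P> \<and>
     (\<forall>g\<in>G. (\<lambda>P. conj_subgroup B g ` P) ` \<P> = \<P>) \<and> (\<forall>P\<in>\<P>. pr P ` H \<subseteq> H)"
  by (simp add: factorising_partitions_def
      internal_direct_product_projections_iff[OF H_subgroup H_subset] cong: conj_cong)

lemma block_stab_orbit_partitionE:
  assumes P: "P \<subseteq> \<T>" and m: "m \<in> block_stab (orbit_partition (\<T> - P))"
  obtains h where "m \<in> M" "h \<in> H" "pr P m = pr P h"
proof -
  have mM: "m \<in> M" and b: "pr P m \<in> pr P ` H"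
    using m block_stab_orbit_partition_iff[OF P, of m] by simp_all
  from b obtain h where "pr P m = pr P h" "h \<in> H" by (rule imageE)
  then show thesis using that mM by blast
qed

text \<open>
  The subproduct over the factors outside \<open>moved_factors \<Gamma>\<close> lies in \<open>block_stab \<Gamma>\<close>. The projection
  of an element of \<open>block_stab \<Gamma>\<close> to \<open>moved_factors \<Gamma>\<close> thus remains in \<open>block_stab \<Gamma>\<close>; it also lies
  in \<open>block_stab \<Delta>\<close> for every other \<open>\<Delta>\<close>, since \<open>\<Delta>\<close> moves none of these factors. So it fixes \<open>\<omega>\<close>,
  which yields both the factorisation of \<open>H\<close> and the shape of \<open>\<Gamma>\<close>.
\<close>
lemma cartesian_of_moved_factors:
  assumes CD: "\<E> \<in> CD_tr \<Omega> G"
    and unique: "\<And>T. T \<in> \<T> \<Longrightarrow> \<exists>!\<Gamma>. \<Gamma> \<in> \<E> \<and> \<not> T \<subseteq> block_stab \<Gamma>"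
  shows "moved_factors ` \<E> \<in> factorising_partitions \<Omega> G M \<T> \<omega>"
    and "cartesian_of_partition \<Omega> M \<T> \<omega> (moved_factors ` \<E>) = \<E>"
proof -
  have sub: "moved_factors \<Gamma> \<subseteq> \<T>" for \<Gamma> by (auto simp: moved_factors_def)
  have inv: "M_invariant \<Gamma>" if "\<Gamma> \<in> \<E>" for \<Gamma> using CD_M_invariant[OF CD that] .
  have rest: "sp (\<T> - moved_factors \<Gamma>) \<subseteq> block_stab \<Gamma>" if "\<Gamma> \<in> \<E>" for \<Gamma>
    by (rule subproduct_minimal[OF block_stab_subgroup[OF inv[OF that]]]) (auto simp: moved_factors_def)
  have nonempty: "moved_factors \<Gamma> \<noteq> {}" if "\<Gamma> \<in> \<E>" for \<Gamma>
  proof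
    assume "moved_factors \<Gamma> = {}"
    then have "M \<subseteq> block_stab \<Gamma>" using rest[OF that] subproduct_all by simp
    then show False using CD_block_stab_proper[OF CD that] block_stab_subset[OF inv[OF that]] by blast
  qed
  have disj: "moved_factors \<Gamma> \<inter> moved_factors \<Delta> = {}" if "\<Gamma> \<in> \<E>" "\<Delta> \<in> \<E>" "\<Gamma> \<noteq> \<Delta>" for \<Gamma> \<Delta>
  proof -
    have False if T: "T \<in> moved_factors \<Gamma>" "T \<in> moved_factors \<Delta>" for T
    proof -
      have "T \<in> \<T>" "\<not> T \<subseteq> block_stab \<Gamma>" "\<not> T \<subseteq> block_stab \<Delta>" using T by (auto simp: moved_factors_def)
      then show False using unique[of T] \<open>\<Gamma> \<in> \<E>\<close> \<open>\<Delta> \<in> \<E>\<close> \<open>\<Gamma> \<noteq> \<Delta>\<close> by metis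
    qed
    then show ?thesis by blast
  qed
  have part: "partition_on \<T> (moved_factors ` \<E>)"
  proof (rule partition_onI)
    show "\<Union>(moved_factors ` \<E>) = \<T>"
    proof
      show "\<T> \<subseteq> \<Union>(moved_factors ` \<E>)"
      proof
        fix T assume T: "T \<in> \<T>"
        then obtain \<Gamma> where "\<Gamma> \<in> \<E>" "\<not> T \<subseteq> block_stab \<Gamma>" using unique by blast
        then show "T \<in> \<Union>(moved_factors ` \<E>)" using T by (auto simp: moved_factors_def)
      qed
    qed (use sub in blast)
    show "disjnt p q" if "p \<in> moved_factors ` \<E>" "q \<in> moved_factors ` \<E>" "p \<noteq> q" for p q
      using that disj unfolding disjnt_def by blast
    show "{} \<notin> moved_factors ` \<E>" using nonempty by force
  qed
  have inj: "inj_on moved_factors \<E>"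
    by (rule inj_onI) (use disj nonempty in fastforce)
  have conj: "conj_subgroup B g ` moved_factors \<Gamma> = moved_factors (act g \<Gamma>)" if g: "g \<in> G" and \<Gamma>: "\<Gamma> \<in> \<E>" for g \<Gamma>
  proof
    show "conj_subgroup B g ` moved_factors \<Gamma> \<subseteq> moved_factors (act g \<Gamma>)"
      using CD_factor_subset_act_iff[OF CD g \<Gamma>] conj_factor[OF g] by (auto simp: moved_factors_def)
    show "moved_factors (act g \<Gamma>) \<subseteq> conj_subgroup B g ` moved_factors \<Gamma>"
    proof
      fix U assume U: "U \<in> moved_factors (act g \<Gamma>)"
      then obtain T where T: "T \<in> \<T>" "U = conj_subgroup B g T"
        using conj_image_factors[OF g] by (auto simp: moved_factors_def)
      then have "T \<in> moved_factors \<Gamma>"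
        using U CD_factor_subset_act_iff[OF CD g \<Gamma> T(1)] by (simp add: moved_factors_def)
      then show "U \<in> conj_subgroup B g ` moved_factors \<Gamma>" using T by blast
    qed
  qed
  have proj_in: "pr (moved_factors \<Gamma>) k \<in> H" if \<Gamma>: "\<Gamma> \<in> \<E>" and k: "k \<in> block_stab \<Gamma>" for \<Gamma> k
  proof (rule CD_Inter_block_stab[OF CD])
    let ?P = "moved_factors \<Gamma>"
    have kM: "k \<in> M" using k block_stab_subset[OF inv[OF \<Gamma>]] by blast
    fix \<Delta> assume \<Delta>: "\<Delta> \<in> \<E>"
    show "pr ?P k \<in> block_stab \<Delta>"
    proof (cases "\<Delta> = \<Gamma>")
      case True
      have pM: "pr ?P k \<in> M" "pr (\<T> - ?P) k \<in> M" using kM sub by auto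
      have "pr (\<T> - ?P) k \<in> block_stab \<Gamma>"
        using rest[OF \<Gamma>] proj_decompose(1)[of "\<T> - ?P" k] kM by blast
      moreover have "k = pr ?P k \<cdot> pr (\<T> - ?P) k" by (rule proj_decompose(2)[OF sub kM])
      then have "pr ?P k = k \<cdot> inv\<^bsub>B\<^esub> (pr (\<T> - ?P) k)"
        using inv_solve_right[OF in_carrier[OF pM(1)] in_carrier[OF kM] in_carrier[OF pM(2)]] by simp
      ultimately show ?thesis
        using True k block_stab_subgroup[OF inv[OF \<Gamma>]]
        by (simp add: subgroup.m_closed subgroup.m_inv_closed)
    next
      case False
      have "pr ?P k \<in> sp ?P" by (rule proj_decompose(1)[OF sub kM])
      moreover have "?P \<subseteq> \<T> - moved_factors \<Delta>" using disj[OF \<Gamma> \<Delta>] False sub by blast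
      ultimately show ?thesis using rest[OF \<Delta>] subproduct_mono by blast
    qed
  qed
  have proj_H: "pr (moved_factors \<Gamma>) ` H \<subseteq> H" if "\<Gamma> \<in> \<E>" for \<Gamma>
    using proj_in[OF that] stab_subset_block_stab[OF inv[OF that]] by blast
  have card: "2 \<le> card (moved_factors ` \<E>)" using card_image[OF inj] CD_card[OF CD] by simp
  have invar: "(\<lambda>P. conj_subgroup B g ` P) ` moved_factors ` \<E> = moved_factors ` \<E>" if g: "g \<in> G" for g
  proof -
    have "(\<lambda>P. conj_subgroup B g ` P) ` moved_factors ` \<E> = (\<lambda>\<Gamma>. moved_factors (act g \<Gamma>)) ` \<E>"
      unfolding image_image[of "\<lambda>P. conj_subgroup B g ` P"] by (rule image_cong[OF refl conj[OF g]])
    also have "\<dots> = moved_factors ` act g ` \<E>" by (simp only: image_image[of moved_factors])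
    finally show ?thesis using CD_act[OF CD g] by simp
  qed
  show "moved_factors ` \<E> \<in> factorising_partitions \<Omega> G M \<T> \<omega>"
    unfolding factorising_partitions_iff
  proof (intro conjI ballI)
    fix g assume "g \<in> G"
    then show "(\<lambda>P. conj_subgroup B g ` P) ` moved_factors ` \<E> = moved_factors ` \<E>" by (rule invar)
  next
    fix P assume "P \<in> moved_factors ` \<E>"
    then show "pr P ` H \<subseteq> H" using proj_H by blast
  qed (fact part card)+
  have same: "orbit_partition (\<T> - moved_factors \<Gamma>) = \<Gamma>" if \<Gamma>: "\<Gamma> \<in> \<E>" for \<Gamma>
  proof (rule M_invariant_eqI[OF orbit_partition_invariant inv[OF \<Gamma>]])
    let ?P = "moved_factors \<Gamma>"
    show "\<T> - ?P \<subseteq> \<T>" by blast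
    show "block_stab (orbit_partition (\<T> - ?P)) = block_stab \<Gamma>"
    proof
      show "block_stab \<Gamma> \<subseteq> block_stab (orbit_partition (\<T> - ?P))"
      proof
        fix k assume k: "k \<in> block_stab \<Gamma>"
        then have kM: "k \<in> M" using block_stab_subset[OF inv[OF \<Gamma>]] by blast
        have "pr ?P k = pr ?P (pr ?P k)"
          using kM sub by (simp add: proj_proj)
        then have "pr ?P k \<in> pr ?P ` H" by (rule image_eqI[OF _ proj_in[OF \<Gamma> k]])
        then show "k \<in> block_stab (orbit_partition (\<T> - ?P))"
          using kM block_stab_orbit_partition_iff[OF sub] by blast
      qed
      show "block_stab (orbit_partition (\<T> - ?P)) \<subseteq> block_stab \<Gamma>"
      proof
        fix m assume "m \<in> block_stab (orbit_partition (\<T> - ?P))"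
        then obtain h where m: "m \<in> M" "h \<in> H" "pr ?P m = pr ?P h"
          by (rule block_stab_orbit_partitionE[OF sub])
        have hM: "h \<in> M" using m(2) H_subset by blast
        have "pr ?P (inv\<^bsub>B\<^esub> h \<cdot> m) = \<one>\<^bsub>B\<^esub>" using proj_eq_iff[OF sub[of \<Gamma>] hM m(1)] m(3) by simp
        then have "inv\<^bsub>B\<^esub> h \<cdot> m \<in> sp (\<T> - ?P)"
          using proj_eq_one_iff[OF sub[of \<Gamma>], of "inv\<^bsub>B\<^esub> h \<cdot> m"] hM m(1) by simp
        then have "inv\<^bsub>B\<^esub> h \<cdot> m \<in> block_stab \<Gamma>" using rest[OF \<Gamma>] by blast
        moreover have "h \<in> block_stab \<Gamma>" using m(2) stab_subset_block_stab[OF inv[OF \<Gamma>]] by blast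
        moreover have "m = h \<cdot> (inv\<^bsub>B\<^esub> h \<cdot> m)" using hM m(1) by (simp add: m_assoc[symmetric])
        ultimately show "m \<in> block_stab \<Gamma>"
          using subgroup.m_closed[OF block_stab_subgroup[OF inv[OF \<Gamma>]]] by metis
      qed
    qed
  qed
  have "cartesian_of_partition \<Omega> M \<T> \<omega> (moved_factors ` \<E>) =
      (\<lambda>\<Gamma>. orbit_partition (\<T> - moved_factors \<Gamma>)) ` \<E>"
    using cartesian_of_partition_eq[of "moved_factors ` \<E>"] sub by (auto simp: image_image)
  also have "\<dots> = (\<lambda>\<Gamma>. \<Gamma>) ` \<E>" by (rule image_cong[OF refl same])
  finally show "cartesian_of_partition \<Omega> M \<T> \<omega> (moved_factors ` \<E>) = \<E>" by simp
qed

subsection \<open>Each factor is moved by one partition of the decomposition\<close>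

text \<open>Otherwise the factor would lie in the intersection of all block stabilisers, which is \<open>H\<close>.\<close>
lemma CD_factor_moved:
  assumes CD: "\<E> \<in> CD_tr \<Omega> G" and T: "T \<in> \<T>"
  shows "\<exists>\<Gamma>\<in>\<E>. \<not> T \<subseteq> block_stab \<Gamma>"
proof (rule ccontr)
  assume "\<not> ?thesis"
  then have "T \<subseteq> H" using CD_Inter_block_stab[OF CD] by blast
  then show False using factor_not_in_stabilizer[OF T] by simp
qed

lemma card_moving_partitions_conj:
  assumes CD: "\<E> \<in> CD_tr \<Omega> G" and g: "g \<in> G" and T: "T \<in> \<T>"
  shows "card {\<Gamma> \<in> \<E>. \<not> conj_subgroup B g T \<subseteq> block_stab \<Gamma>} = card {\<Gamma> \<in> \<E>. \<not> T \<subseteq> block_stab \<Gamma>}"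
proof -
  have "{\<Gamma> \<in> \<E>. \<not> conj_subgroup B g T \<subseteq> block_stab \<Gamma>} = act g ` {\<Gamma> \<in> \<E>. \<not> T \<subseteq> block_stab \<Gamma>}"
  proof
    show "act g ` {\<Gamma> \<in> \<E>. \<not> T \<subseteq> block_stab \<Gamma>} \<subseteq> {\<Gamma> \<in> \<E>. \<not> conj_subgroup B g T \<subseteq> block_stab \<Gamma>}"
    proof
      fix \<Delta> assume "\<Delta> \<in> act g ` {\<Gamma> \<in> \<E>. \<not> T \<subseteq> block_stab \<Gamma>}"
      then obtain \<Gamma> where "\<Gamma> \<in> {\<Gamma> \<in> \<E>. \<not> T \<subseteq> block_stab \<Gamma>}" and \<Delta>: "\<Delta> = act g \<Gamma>" by (rule imageE)
      then have \<Gamma>: "\<Gamma> \<in> \<E>" "\<not> T \<subseteq> block_stab \<Gamma>" by simp_all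
      then show "\<Delta> \<in> {\<Gamma> \<in> \<E>. \<not> conj_subgroup B g T \<subseteq> block_stab \<Gamma>}"
        using CD_factor_subset_act_iff[OF CD g \<Gamma>(1) T] CD_act_in[OF CD g \<Gamma>(1)] \<Delta> by simp
    qed
    show "{\<Gamma> \<in> \<E>. \<not> conj_subgroup B g T \<subseteq> block_stab \<Gamma>} \<subseteq> act g ` {\<Gamma> \<in> \<E>. \<not> T \<subseteq> block_stab \<Gamma>}"
    proof
      fix \<Delta> assume "\<Delta> \<in> {\<Gamma> \<in> \<E>. \<not> conj_subgroup B g T \<subseteq> block_stab \<Gamma>}"
      then have \<Delta>: "\<Delta> \<in> act g ` \<E>" "\<not> conj_subgroup B g T \<subseteq> block_stab \<Delta>"
        using CD_act[OF CD g] by simp_all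
      from \<Delta>(1) obtain \<Gamma> where eq: "\<Delta> = act g \<Gamma>" and \<Gamma>: "\<Gamma> \<in> \<E>" by (rule imageE)
      have "\<not> T \<subseteq> block_stab \<Gamma>"
        using \<Delta>(2) CD_factor_subset_act_iff[OF CD g \<Gamma> T] eq by simp
      then show "\<Delta> \<in> act g ` {\<Gamma> \<in> \<E>. \<not> T \<subseteq> block_stab \<Gamma>}"
        unfolding eq using \<Gamma> by (intro imageI) simp
    qed
  qed
  moreover have "inj_on (act g) {\<Gamma> \<in> \<E>. \<not> T \<subseteq> block_stab \<Gamma>}"
    by (rule inj_on_subset[OF bij_betw_imp_inj_on[OF CD_act_bij[OF CD g]]]) auto
  ultimately show ?thesis by (simp only: card_image)
qed

text \<open>
  The number \<open>e\<close> of partitions that move a factor does not depend on the factor, as \<open>G\<close> is transitive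
  on factors. Multiply the bound of \<open>card_subdirect_le\<close> over all partitions and exchange the products:
  \<open>e \<ge> 2\<close> would give \<open>|M| \<le> |\<Omega>|\<close>, so \<open>H\<close> would be trivial.
\<close>
lemma unique_moving_partition_subdirect:
  assumes CD: "\<E> \<in> CD_S \<Omega> G M \<T> \<omega>" and H: "subdirect_subgroup B M \<T> H" and T: "T \<in> \<T>"
  shows "\<exists>!\<Gamma>. \<Gamma> \<in> \<E> \<and> \<not> T \<subseteq> block_stab \<Gamma>"
proof -
  have tr: "\<E> \<in> CD_tr \<Omega> G" using CD by (simp add: CD_S_def)
  have finE: "finite \<E>" using CD_finite[OF tr] .
  have inv: "M_invariant \<Gamma>" if "\<Gamma> \<in> \<E>" for \<Gamma> using CD_M_invariant[OF tr that] .
  have sd: "pr {U} ` block_stab \<Gamma> = U" if "\<Gamma> \<in> \<E>" "U \<in> \<T>" for \<Gamma> U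
    using CD that unfolding CD_S_def block_stabilizers_eq subdirect_subgroup_def by blast
  define e where "e U = card {\<Gamma> \<in> \<E>. \<not> U \<subseteq> block_stab \<Gamma>}" for U
  have e_const: "e U = e T" if "U \<in> \<T>" for U
    using conj_transitive[OF T that] card_moving_partitions_conj[OF tr _ T] by (auto simp: e_def)
  have "e T \<ge> 1"
    unfolding e_def using CD_factor_moved[OF tr T] finE by (auto simp: Suc_le_eq card_gt_0_iff)
  moreover have "\<not> 2 \<le> e T"
  proof
    assume two: "2 \<le> e T"
    have pos: "card U > 0" if "U \<in> \<T>" for U
      using finite_factor[OF that] subgroup.one_closed[OF factor_subgroup[OF that]] by (auto simp: card_gt_0_iff)
    have bound: "(\<Prod>U | U \<in> \<T> \<and> \<not> U \<subseteq> block_stab \<Gamma>. card U) \<le> (card \<Gamma>)\<^sup>2" if \<Gamma>: "\<Gamma> \<in> \<E>" for \<Gamma>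
    proof -
      let ?K = "block_stab \<Gamma>" and ?p = "\<Prod>U | U \<in> \<T> \<and> \<not> U \<subseteq> block_stab \<Gamma>. card U"
      have "(card ?K)\<^sup>2 * ?p \<le> (card M)\<^sup>2"
        by (rule card_subdirect_le[OF block_stab_subgroup[OF inv[OF \<Gamma>]] block_stab_subset[OF inv[OF \<Gamma>]] sd[OF \<Gamma>]])
      also have "\<dots> = (card ?K)\<^sup>2 * (card \<Gamma>)\<^sup>2"
        using card_blocks[OF inv[OF \<Gamma>]] by (simp add: power_mult_distrib)
      finally have "(card ?K)\<^sup>2 * ?p \<le> (card ?K)\<^sup>2 * (card \<Gamma>)\<^sup>2" .
      moreover have "card ?K > 0"
        using subgroup.one_closed[OF block_stab_subgroup[OF inv[OF \<Gamma>]]] finite_subset[OF block_stab_subset[OF inv[OF \<Gamma>]] finite_M]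
        by (auto simp: card_gt_0_iff)
      ultimately show ?thesis by simp
    qed
    have "card M \<le> (\<Prod>U\<in>\<T>. card U)"
    proof (rule card_le_prod_coordinates[OF subset_refl _ subset_refl])
      show "finite U" if "U \<in> \<T>" for U using that by (rule finite_factor)
      show "k = l" if "k \<in> M" "l \<in> M" "\<And>U. U \<in> \<T> \<Longrightarrow> pr {U} k = pr {U} l" for k l
        using that by (rule eq_if_coordinates)
    qed
    then have "(card M)\<^sup>2 \<le> (\<Prod>U\<in>\<T>. card U)\<^sup>2" by (rule power_mono) simp
    also have "\<dots> = (\<Prod>U\<in>\<T>. (card U)\<^sup>2)" by (simp add: prod_power_distrib)
    also have "\<dots> \<le> (\<Prod>U\<in>\<T>. card U ^ e U)"
      using pos two e_const by (intro prod_mono) (auto intro!: power_increasing simp: Suc_le_eq)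
    also have "\<dots> = (\<Prod>U\<in>\<T>. \<Prod>\<Gamma> | \<Gamma> \<in> \<E> \<and> \<not> U \<subseteq> block_stab \<Gamma>. card U)" by (simp add: e_def)
    also have "\<dots> = (\<Prod>\<Gamma>\<in>\<E>. \<Prod>U | U \<in> \<T> \<and> \<not> U \<subseteq> block_stab \<Gamma>. card U)"
      by (rule prod.swap_restrict[OF finite_factors finE])
    also have "\<dots> \<le> (\<Prod>\<Gamma>\<in>\<E>. (card \<Gamma>)\<^sup>2)" using bound by (intro prod_mono) auto
    also have "\<dots> = (card \<Omega>)\<^sup>2" by (simp add: CD_card_points[OF tr] prod_power_distrib)
    finally have "card M \<le> card \<Omega>" by (simp add: power2_nat_le_eq_le)
    moreover have "card \<Omega> > 0" using finite_points point by (auto simp: card_gt_0_iff)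
    ultimately have "card H \<le> 1" using card_points by simp
    moreover have oneH: "\<one>\<^bsub>B\<^esub> \<in> H" using H_subgroup by (rule subgroup.one_closed)
    moreover have "finite H" using H_subset finite_M finite_subset by blast
    ultimately have "\<forall>x\<in>H. \<forall>y\<in>H. x = y" using card_le_Suc0_iff_eq[of H] by simp
    then have "H = {\<one>\<^bsub>B\<^esub>}" using oneH by blast
    then have "pr {T} ` H = {\<one>\<^bsub>B\<^esub>}" using T by simp
    then show False using H nontrivial_factor[OF T] T by (auto simp: subdirect_subgroup_def)
  qed
  ultimately have "e T = 1" by simp
  then obtain \<Gamma> where eq: "{\<Gamma> \<in> \<E>. \<not> T \<subseteq> block_stab \<Gamma>} = {\<Gamma>}"
    unfolding e_def by (auto simp: card_1_singleton_iff)
  have "\<Delta> \<in> \<E> \<and> \<not> T \<subseteq> block_stab \<Delta> \<longleftrightarrow> \<Delta> = \<Gamma>" for \<Delta>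
    using arg_cong[OF eq, of "\<lambda>S. \<Delta> \<in> S"] by simp
  then show ?thesis by simp
qed

text \<open>
  In the absence of strips, \<open>\<Gamma>\<close> moves \<open>T\<close> precisely if its block stabiliser has a proper projection to
  \<open>T\<close>. Two such stabilisers would have the same projection \<open>Q\<close>, although their product is \<open>M\<close>.
\<close>
lemma unique_moving_partition_one_projection:
  assumes CD: "\<E> \<in> CD_1 \<Omega> G M \<T> \<omega>" and T: "T \<in> \<T>"
  shows "\<exists>!\<Gamma>. \<Gamma> \<in> \<E> \<and> \<not> T \<subseteq> block_stab \<Gamma>"
proof -
  have tr: "\<E> \<in> CD_tr \<Omega> G" using CD by (simp add: CD_1_def)
  have inv: "M_invariant \<Gamma>" if "\<Gamma> \<in> \<E>" for \<Gamma> using CD_M_invariant[OF tr that] .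
  have "card (proper_projections B \<T> (block_stab ` \<E>) T) = 1"
    using CD T unfolding CD_1_def block_stabilizers_eq by blast
  then obtain Q where Q: "proper_projections B \<T> (block_stab ` \<E>) T = {Q}" by (auto simp: card_1_singleton_iff)
  have none: "\<not> (\<exists>X. full_strip B M \<T> X \<and> nontrivial_strip B M \<T> X \<and> involved B M \<T> X (block_stab \<Gamma>))"
    if "\<Gamma> \<in> \<E>" for \<Gamma>
    using CD that unfolding CD_1_def block_stabilizers_eq by blast
  have proper: "pr {T} ` block_stab \<Gamma> = Q" if "\<Gamma> \<in> \<E>" "pr {T} ` block_stab \<Gamma> \<noteq> T" for \<Gamma>
  proof -
    have "pr {T} ` block_stab \<Gamma> \<in> proper_projections B \<T> (block_stab ` \<E>) T"
      unfolding proper_projections_def using that by blast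
    then show ?thesis using Q by simp
  qed
  have moved_iff: "\<not> T \<subseteq> block_stab \<Gamma> \<longleftrightarrow> pr {T} ` block_stab \<Gamma> \<noteq> T" if \<Gamma>: "\<Gamma> \<in> \<E>" for \<Gamma>
  proof -
    have "T \<subseteq> block_stab \<Gamma>" if "pr {T} ` block_stab \<Gamma> = T"
      by (rule factor_subset_if_no_strip[OF block_stab_subgroup[OF inv[OF \<Gamma>]] block_stab_subset[OF inv[OF \<Gamma>]] T that none[OF \<Gamma>]])
    moreover have "pr {T} ` block_stab \<Gamma> = T" if "T \<subseteq> block_stab \<Gamma>"
      by (rule proj_image_containing_factor[OF T that block_stab_subset[OF inv[OF \<Gamma>]]])
    ultimately show ?thesis by blast
  qed
  have "\<Gamma> = \<Delta>" if \<Gamma>: "\<Gamma> \<in> \<E>" "\<not> T \<subseteq> block_stab \<Gamma>" and \<Delta>: "\<Delta> \<in> \<E>" "\<not> T \<subseteq> block_stab \<Delta>" for \<Gamma> \<Delta>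
  proof (rule ccontr)
    assume ne: "\<Gamma> \<noteq> \<Delta>"
    have Q1: "pr {T} ` block_stab \<Gamma> = Q" "Q \<noteq> T" using proper \<Gamma> moved_iff by auto
    have Q2: "pr {T} ` block_stab \<Delta> = Q" using proper \<Delta> moved_iff by auto
    have KM: "block_stab \<Gamma> \<subseteq> M" "block_stab \<Delta> \<subseteq> M" using block_stab_subset inv \<Gamma> \<Delta> by auto
    have Qs: "subgroup Q B"
      unfolding Q1(1)[symmetric] using T by (intro proj_subgroup block_stab_subgroup inv \<Gamma>(1) KM) auto
    have "Q \<subseteq> T" using proj_image_subset[OF T KM(1)] Q1 by simp
    moreover have "T \<subseteq> Q"
    proof
      fix t assume t: "t \<in> T"
      then have tM: "t \<in> M" using factor_subset[OF T] by blast
      obtain k l where kl: "k \<in> block_stab \<Gamma>" "l \<in> block_stab \<Delta>" "t = k \<cdot> l"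
        using CD_block_stab_mult[OF tr \<Gamma>(1) \<Delta>(1) ne tM] by blast
      have M: "k \<in> M" "l \<in> M" using kl KM by auto
      have "t = pr {T} t" using proj_id[of "{T}" t] t T subproduct_single[OF T] by simp
      also have "\<dots> = pr {T} k \<cdot> pr {T} l" unfolding kl(3) using T M by (intro proj_mult) auto
      also have "\<dots> \<in> Q" using Q1 Q2 kl by (intro subgroup.m_closed[OF Qs]) auto
      finally show "t \<in> Q" .
    qed
    ultimately show False using Q1(2) by blast
  qed
  then show ?thesis using CD_factor_moved[OF tr T] by blast
qed

section \<open>From partitions of the factors to decompositions\<close>

lemma block_stab_all_iff:
  assumes inv: "M_invariant \<Gamma>"
  shows "block_stab \<Gamma> = M \<longleftrightarrow> \<Gamma> = {\<Omega>}"
proof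
  assume "block_stab \<Gamma> = M"
  then have "blk \<Gamma> \<omega> = (\<lambda>k. k \<omega>) ` M" using blk_eq_orbit[OF inv] by simp
  also have "\<dots> = \<Omega>" using M_transitive[OF point] act_in[OF in_carrier point] by blast
  finally have b: "blk \<Gamma> \<omega> = \<Omega>" .
  have "m ` \<Omega> = \<Omega>" if "m \<in> M" for m
    using in_carrier[OF that] by (auto simp: BijGroup_def Bij_def bij_betw_def)
  then have "(\<lambda>m. m ` blk \<Gamma> \<omega>) ` M = (\<lambda>m. \<Omega>) ` M" unfolding b by (rule image_cong[OF refl])
  also have "\<dots> = {\<Omega>}" using M_closed(1) by blast
  finally have "(\<lambda>m. m ` blk \<Gamma> \<omega>) ` M = {\<Omega>}" .
  then show "\<Gamma> = {\<Omega>}" using blocks_eq[OF inv] by simp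
next
  assume "\<Gamma> = {\<Omega>}"
  then have "blk \<Gamma> \<omega> = \<Omega>" using blk(1)[OF inv_partition[OF inv] point] by simp
  then show "block_stab \<Gamma> = M" using block_stab_iff[OF inv] act_in[OF in_carrier point] by auto
qed

text \<open>
  That \<open>H\<close> projects onto \<open>T\<close> means that the subproduct over the other factors is transitive on points, a
  condition that \<open>G\<close> preserves.
\<close>
lemma projection_onto_factor_conj:
  assumes T: "T \<in> \<T>" and U: "U \<in> \<T>" and onto: "pr {T} ` H = T"
  shows "pr {U} ` H = U"
proof -
  obtain g where g: "g \<in> G" "conj_subgroup B g T = U" using conj_transitive[OF T U] by blast
  have ex: "block_stab (orbit_partition (\<T> - {V})) = M \<longleftrightarrow> pr {V} ` H = V" if V: "V \<in> \<T>" for V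
  proof -
    have VT: "{V} \<subseteq> \<T>" using V by simp
    have MV: "pr {V} ` M = V"
      by (rule proj_image_containing_factor[OF V factor_subset[OF V] subset_refl])
    have "block_stab (orbit_partition (\<T> - {V})) = M \<longleftrightarrow> pr {V} ` M \<subseteq> pr {V} ` H"
      using block_stab_orbit_partition_iff[OF VT] by blast
    also have "\<dots> \<longleftrightarrow> pr {V} ` H = V"
      unfolding MV using proj_image_subset[OF V H_subset] by blast
    finally show ?thesis .
  qed
  have sub: "\<T> - {T} \<subseteq> \<T>" "\<T> - {U} \<subseteq> \<T>" by auto
  have "conj_subgroup B g ` (\<T> - {T}) = \<T> - {U}"
    using inj_on_image_set_diff[OF conj_inj_factors[OF g(1)], of \<T> "{T}"] conj_image_factors[OF g(1)] T g(2) by simp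
  then have "orbit_partition (\<T> - {U}) = act g (orbit_partition (\<T> - {T}))"
    using act_orbit_partition[OF g(1) sub(1)] by simp
  also have "orbit_partition (\<T> - {T}) = {\<Omega>}"
    using block_stab_all_iff[OF orbit_partition_invariant[OF sub(1)]] ex[OF T] onto by simp
  also have "act g {\<Omega>} = {\<Omega>}"
    using G_carrier[OF g(1)] by (auto simp: BijGroup_def Bij_def bij_betw_def)
  finally show ?thesis
    using block_stab_all_iff[OF orbit_partition_invariant[OF sub(2)]] ex[OF U] by simp
qed

context
  fixes \<P> assumes P: "\<P> \<in> factorising_partitions \<Omega> G M \<T> \<omega>"
begin

lemma P_partition: "partition_on \<T> \<P>"
  and P_card: "2 \<le> card \<P>"
  and P_conj: "g \<in> G \<Longrightarrow> (\<lambda>P. conj_subgroup B g ` P) ` \<P> = \<P>"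
  and P_proj: "p \<in> \<P> \<Longrightarrow> pr p ` H \<subseteq> H"
  using P by (simp_all add: factorising_partitions_iff)

lemma P_subset: "p \<in> \<P> \<Longrightarrow> p \<subseteq> \<T>"
  using P_partition by (auto simp: partition_on_def)

abbreviation part_of :: "('a \<Rightarrow> 'a) set set \<Rightarrow> 'a set set" where
  "part_of p \<equiv> orbit_partition (\<T> - p)"

abbreviation cart :: "'a set set set" where
  "cart \<equiv> cartesian_of_partition \<Omega> M \<T> \<omega> \<P>"

lemma cart_eq: "cart = part_of ` \<P>"
  using cartesian_of_partition_eq P_subset by blast

lemma part_of_invariant: "M_invariant (part_of p)"
  by (rule orbit_partition_invariant) blast

lemma factor_subset_block_stab_part_of_iff:
  assumes p: "p \<in> \<P>" and T: "T \<in> \<T>"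
  shows "T \<subseteq> block_stab (part_of p) \<longleftrightarrow> T \<notin> p"
proof
  note sub = P_subset[OF p]
  assume TK: "T \<subseteq> block_stab (part_of p)"
  show "T \<notin> p"
  proof
    assume Tp: "T \<in> p"
    have "t \<in> H" if t: "t \<in> T" for t
    proof -
      have "t \<in> sp p" using factor_in_subproduct[OF Tp] t by blast
      then have "pr p t = t" by (rule proj_id[OF sub])
      moreover have "pr p t \<in> pr p ` H" using block_stab_orbit_partition_iff[OF sub] TK t by blast
      ultimately show ?thesis using P_proj[OF p] by auto
    qed
    then show False using factor_not_in_stabilizer[OF T] by blast
  qed
next
  note sub = P_subset[OF p]
  assume "T \<notin> p"
  show "T \<subseteq> block_stab (part_of p)"
  proof
    fix t assume t: "t \<in> T"
    have tM: "t \<in> M" using t factor_subset[OF T] by blast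
    have "pr p t = \<one>\<^bsub>B\<^esub>"
      using \<open>T \<notin> p\<close> T t sub by (intro proj_trivial[of p "{T}"]) (auto simp: subproduct_single)
    also have "\<dots> = pr p \<one>\<^bsub>B\<^esub>" using sub by simp
    finally have "pr p t \<in> pr p ` H" using subgroup.one_closed[OF H_subgroup] by blast
    then show "t \<in> block_stab (part_of p)" using block_stab_orbit_partition_iff[OF sub] tM by blast
  qed
qed

lemma moved_factors_part_of: "p \<in> \<P> \<Longrightarrow> moved_factors (part_of p) = p"
  using factor_subset_block_stab_part_of_iff P_subset unfolding moved_factors_def by blast

lemma moved_factors_cart: "moved_factors ` cart = \<P>"
  unfolding cart_eq image_image using moved_factors_part_of by simp

lemma part_of_inj: "inj_on part_of \<P>"
  using moved_factors_part_of by (rule inj_on_inverseI)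

lemma proj_block_stab_part_of:
  assumes p: "p \<in> \<P>" and T: "T \<in> \<T>"
  shows "pr {T} ` block_stab (part_of p) = (if T \<in> p then pr {T} ` H else T)"
proof (cases "T \<in> p")
  case True
  note sub = P_subset[OF p]
  have "pr {T} m \<in> pr {T} ` H" if "m \<in> block_stab (part_of p)" for m
  proof -
    obtain h where h: "m \<in> M" "h \<in> H" "pr p m = pr p h"
      using \<open>m \<in> block_stab (part_of p)\<close> by (rule block_stab_orbit_partitionE[OF sub])
    have "pr {T} m = pr {T} (pr p m)"
      using proj_proj[of "{T}" p m] True sub h(1) by simp
    also have "\<dots> = pr {T} h" unfolding h(3) using True sub h H_subset by (intro proj_proj) auto
    finally show ?thesis using h(2) by blast
  qed
  then show ?thesis using True stab_subset_block_stab[OF part_of_invariant, of p] by auto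
next
  case False
  then have TK: "T \<subseteq> block_stab (part_of p)" using factor_subset_block_stab_part_of_iff[OF p T] by simp
  show ?thesis
    using proj_image_containing_factor[OF T TK block_stab_subset[OF part_of_invariant, of p]] False by simp
qed

text \<open>
  Translate \<open>\<omega>\<close> by the element of \<open>M\<close> whose coordinates in the part \<open>p\<close> are those of an element
  carrying \<open>\<omega>\<close> to \<open>x p\<close>.
\<close>
lemma cart_choice_exists:
  assumes x: "\<And>p. p \<in> \<P> \<Longrightarrow> x p \<in> \<Omega>"
  obtains y where "y \<in> \<Omega>" "\<And>p. p \<in> \<P> \<Longrightarrow> y \<in> orb (\<T> - p) (x p)"
proof -
  have "\<forall>p\<in>\<P>. \<exists>m. m \<in> M \<and> m \<omega> = x p" using M_transitive[OF point x] by blast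
  then obtain \<mu> where "\<forall>p\<in>\<P>. \<mu> p \<in> M \<and> \<mu> p \<omega> = x p" by (rule bchoice[THEN exE])
  then have \<mu>: "\<mu> p \<in> M \<and> \<mu> p \<omega> = x p" if "p \<in> \<P>" for p using that by blast
  define part where "part T = (THE p. p \<in> \<P> \<and> T \<in> p)" for T
  have part: "part T = p" if "p \<in> \<P>" "T \<in> p" for T p
  proof -
    have uniq: "q = p" if "q \<in> \<P> \<and> T \<in> q" for q
      using disjointD[OF partition_onD2[OF P_partition] _ \<open>p \<in> \<P>\<close>, of q] that \<open>T \<in> p\<close> by blast
    show ?thesis unfolding part_def by (rule the_equality[OF _ uniq]) (use that in simp_all)
  qed
  have ex_part: "\<exists>p\<in>\<P>. T \<in> p" if "T \<in> \<T>" for T using that P_partition by (auto simp: partition_on_def)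
  have "pr {T} (\<mu> (part T)) \<in> T" if T: "T \<in> \<T>" for T
  proof -
    obtain p where "p \<in> \<P>" "T \<in> p" using ex_part[OF T] by blast
    then show ?thesis using part[of p T] \<mu>[of p] proj_factor[OF T] by simp
  qed
  then obtain m where m: "m \<in> M" "\<And>T. T \<in> \<T> \<Longrightarrow> pr {T} m = pr {T} (\<mu> (part T))"
    using exists_with_coordinates[of "\<lambda>T. pr {T} (\<mu> (part T))"] by blast
  have "m \<omega> \<in> orb (\<T> - p) (x p)" if p: "p \<in> \<P>" for p
  proof -
    have M: "\<mu> p \<in> M" "\<mu> p \<omega> = x p" using \<mu>[OF p] by auto
    define n where "n = m \<cdot> inv\<^bsub>B\<^esub> (\<mu> p)"
    have nM: "n \<in> M" using M m(1) by (simp add: n_def)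
    have "pr {T} n = \<one>\<^bsub>B\<^esub>" if T: "T \<in> \<T> - (\<T> - p)" for T
    proof -
      have "T \<in> \<T>" "part T = p" using T part[OF p] by auto
      then have "pr {T} m = pr {T} (\<mu> p)" using m(2)[of T] by simp
      then show ?thesis using \<open>T \<in> \<T>\<close> M m(1) by (simp add: n_def proj_mult proj_inv)
    qed
    then have "n \<in> sp (\<T> - p)" using subproduct_iff[of "\<T> - p" n] nM by blast
    moreover have "n \<cdot> \<mu> p = m" using M m(1) by (simp add: n_def m_assoc)
    then have "m \<omega> = n (x p)" using act_mult[of n "\<mu> p" \<omega>] M nM point by auto
    ultimately show ?thesis by (simp add: orb_def)
  qed
  then show thesis using that[of "m \<omega>"] act_in[OF in_carrier[OF m(1)] point] by blast
qed

text \<open>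
  If \<open>a\<close> and \<open>b\<close> carry \<open>\<omega>\<close> to the two points, then for each part the projection of \<open>a\<^sup>-\<^sup>1 b\<close> agrees with
  the projection of an element of \<open>H\<close>, hence lies in \<open>H\<close>; so \<open>a\<^sup>-\<^sup>1 b\<close> lies in \<open>H\<close>.
\<close>
lemma cart_choice_unique:
  assumes x: "x \<in> \<Omega>" and y: "y \<in> \<Omega>" and eq: "\<And>p. p \<in> \<P> \<Longrightarrow> y \<in> orb (\<T> - p) x"
  shows "y = x"
proof -
  obtain a where a: "a \<in> M" "a \<omega> = x" using M_transitive[OF point x] by blast
  obtain b where b: "b \<in> M" "b \<omega> = y" using M_transitive[OF point y] by blast
  have "pr p (inv\<^bsub>B\<^esub> a \<cdot> b) \<in> H" if p: "p \<in> \<P>" for p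
  proof -
    note sub = P_subset[OF p]
    obtain n where n: "n \<in> sp (\<T> - p)" "y = n x" using eq[OF p] by (auto simp: orb_def)
    have nM: "n \<in> M" using n(1) by auto
    define h where "h = inv\<^bsub>B\<^esub> (n \<cdot> a) \<cdot> b"
    have na: "(n \<cdot> a) \<omega> = y" using act_mult[of n a \<omega>] nM a n(2) point by auto
    have hM: "h \<in> M" using nM a b by (simp add: h_def)
    have "h \<omega> = (inv\<^bsub>B\<^esub> (n \<cdot> a)) (b \<omega>)" unfolding h_def using nM a b point by (intro act_mult) auto
    also have "\<dots> = \<omega>" using act_inv(1)[of "n \<cdot> a" \<omega>] na b nM a point by auto
    finally have h: "h \<in> H" using hM by (simp add: H_iff)
    have "pr p n = \<one>\<^bsub>B\<^esub>" using proj_eq_one_iff[OF sub nM] n(1) by simp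
    then have "pr p h = pr p (inv\<^bsub>B\<^esub> a \<cdot> b)"
      unfolding h_def using nM a b sub by (simp add: proj_mult proj_inv)
    then show ?thesis using P_proj[OF p] h by (metis image_subset_iff)
  qed
  then have ab: "inv\<^bsub>B\<^esub> a \<cdot> b \<in> H"
    using partition_coordinates_in[OF H_subgroup H_subset P_partition, of "inv\<^bsub>B\<^esub> a \<cdot> b"] a b by simp
  have "a ((inv\<^bsub>B\<^esub> a \<cdot> b) \<omega>) = b \<omega>"
    using act_mult[of a "inv\<^bsub>B\<^esub> a \<cdot> b" \<omega>] a b point by (simp add: m_assoc[symmetric])
  then show ?thesis using ab a b by (simp add: H_iff)
qed

lemma cart_cartesian: "cartesian_decomposition \<Omega> cart"
  unfolding cartesian_decomposition_def
proof (intro conjI ballI allI impI)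
  show "2 \<le> card cart" unfolding cart_eq using card_image[OF part_of_inj] P_card by simp
next
  fix \<Gamma> assume "\<Gamma> \<in> cart"
  then obtain p where p: "p \<in> \<P>" "\<Gamma> = part_of p" unfolding cart_eq by blast
  have inv: "M_invariant \<Gamma>" unfolding p(2) by (rule part_of_invariant)
  show "partition_on \<Omega> \<Gamma>" by (rule inv_partition[OF inv])
  obtain T where T: "T \<in> p" using p(1) partition_onD3[OF P_partition] by fastforce
  then have TT: "T \<in> \<T>" using P_subset[OF p(1)] by blast
  then have "\<not> T \<subseteq> block_stab \<Gamma>" using factor_subset_block_stab_part_of_iff[OF p(1) TT] T p(2) by simp
  then obtain m where "m \<in> M" "m \<notin> block_stab \<Gamma>" using factor_subset[OF TT] by blast
  then have "m ` blk \<Gamma> \<omega> \<noteq> blk \<Gamma> \<omega>" by (simp add: block_stab_def)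
  moreover have "m ` blk \<Gamma> \<omega> \<in> \<Gamma>" using blocks_eq[OF inv] \<open>m \<in> M\<close> by blast
  moreover have "blk \<Gamma> \<omega> \<in> \<Gamma>" by (rule blk(1)[OF inv_partition[OF inv] point])
  ultimately show "\<exists>\<gamma>\<in>\<Gamma>. \<exists>\<delta>\<in>\<Gamma>. \<gamma> \<noteq> \<delta>" by blast
next
  fix s assume s: "\<forall>\<Gamma>\<in>cart. s \<Gamma> \<in> \<Gamma>"
  have "\<forall>p\<in>\<P>. \<exists>x. x \<in> \<Omega> \<and> s (part_of p) = orb (\<T> - p) x"
    using s unfolding cart_eq by (auto simp: orbit_partition_def)
  then obtain x where "\<forall>p\<in>\<P>. x p \<in> \<Omega> \<and> s (part_of p) = orb (\<T> - p) (x p)" by (rule bchoice[THEN exE])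
  then have x: "x p \<in> \<Omega> \<and> s (part_of p) = orb (\<T> - p) (x p)" if "p \<in> \<P>" for p using that by blast
  obtain y where y: "y \<in> \<Omega>" "\<And>p. p \<in> \<P> \<Longrightarrow> y \<in> orb (\<T> - p) (x p)"
    using cart_choice_exists[of x] x by blast
  have sy: "s (part_of p) = orb (\<T> - p) y" if "p \<in> \<P>" for p
    using orb_eqI[of "\<T> - p" "x p" y] x[OF that] y(2)[OF that] by auto
  have "(\<Inter>\<Gamma>\<in>cart. s \<Gamma>) = {y}"
  proof
    show "{y} \<subseteq> (\<Inter>\<Gamma>\<in>cart. s \<Gamma>)" unfolding cart_eq using x y(2) by auto
    show "(\<Inter>\<Gamma>\<in>cart. s \<Gamma>) \<subseteq> {y}"
    proof
      fix z assume z: "z \<in> (\<Inter>\<Gamma>\<in>cart. s \<Gamma>)"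
      have zo: "z \<in> orb (\<T> - p) y" if "p \<in> \<P>" for p using z sy[OF that] that unfolding cart_eq by blast
      obtain p where "p \<in> \<P>" using P_card by fastforce
      then have "z \<in> \<Omega>" using zo orb_subset[of "\<T> - p" y] y(1) by blast
      then show "z \<in> {y}" using cart_choice_unique[OF y(1) _ zo] by simp
    qed
  qed
  then show "card (\<Inter>\<Gamma>\<in>cart. s \<Gamma>) = 1" by simp
qed

lemma act_part_of:
  assumes g: "g \<in> G" and p: "p \<in> \<P>"
  shows "act g (part_of p) = part_of (conj_subgroup B g ` p)"
proof -
  have "conj_subgroup B g ` (\<T> - p) = \<T> - conj_subgroup B g ` p"
    using inj_on_image_set_diff[OF conj_inj_factors[OF g], of \<T> p] conj_image_factors[OF g] P_subset[OF p] by simp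
  then show ?thesis using act_orbit_partition[OF g, of "\<T> - p"] by simp
qed

lemma cart_CD_tr: "cart \<in> CD_tr \<Omega> G"
proof -
  have "act g ` cart = cart" if g: "g \<in> G" for g
  proof -
    have "act g ` cart = (\<lambda>p. part_of (conj_subgroup B g ` p)) ` \<P>"
      unfolding cart_eq image_image[of "act g"] by (rule image_cong[OF refl act_part_of[OF g]])
    also have "\<dots> = part_of ` (\<lambda>p. conj_subgroup B g ` p) ` \<P>" by (simp only: image_image[of part_of])
    finally show ?thesis using P_conj[OF g] cart_eq by simp
  qed
  moreover have "\<exists>g\<in>G. act g \<Gamma> = \<Delta>" if "\<Gamma> \<in> cart" "\<Delta> \<in> cart" for \<Gamma> \<Delta>
  proof -
    obtain p q where pq: "p \<in> \<P>" "\<Gamma> = part_of p" "q \<in> \<P>" "\<Delta> = part_of q" using \<open>\<Gamma> \<in> cart\<close> \<open>\<Delta> \<in> cart\<close> unfolding cart_eq by blast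
    obtain T U where TU: "T \<in> p" "U \<in> q" using partition_onD3[OF P_partition] pq by fastforce
    then have "T \<in> \<T>" "U \<in> \<T>" using P_subset pq by blast+
    then obtain g where g: "g \<in> G" "conj_subgroup B g T = U" using conj_transitive by blast
    have "conj_subgroup B g ` p \<in> \<P>" using P_conj[OF g(1)] pq(1) by blast
    moreover have "U \<in> conj_subgroup B g ` p" using g(2) TU(1) by blast
    ultimately have "conj_subgroup B g ` p = q"
      using disjointD[OF partition_onD2[OF P_partition] _ pq(3)] TU(2) by blast
    then have "act g \<Gamma> = \<Delta>" using act_part_of[OF g(1) pq(1)] pq by simp
    then show ?thesis using g(1) by blast
  qed
  ultimately show ?thesis unfolding CD_tr_def using cart_cartesian by blast
qed

lemma cart_CD_S:
  assumes H: "subdirect_subgroup B M \<T> H"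
  shows "cart \<in> CD_S \<Omega> G M \<T> \<omega>"
proof -
  have "subdirect_subgroup B M \<T> (block_stab \<Gamma>)" if "\<Gamma> \<in> cart" for \<Gamma>
  proof -
    obtain p where p: "p \<in> \<P>" "\<Gamma> = part_of p" using \<open>\<Gamma> \<in> cart\<close> unfolding cart_eq by blast
    have "pr {T} ` block_stab \<Gamma> = T" if "T \<in> \<T>" for T
      using proj_block_stab_part_of[OF p(1) that] H that p(2) by (simp add: subdirect_subgroup_def)
    then show ?thesis
      unfolding subdirect_subgroup_def p(2)
      using subgroup_incl[OF block_stab_subgroup M_subgroup block_stab_subset, OF part_of_invariant part_of_invariant] by blast
  qed
  then show ?thesis unfolding CD_S_def block_stabilizers_eq using cart_CD_tr by blast
qed

text \<open>
  A strip involved in a block stabiliser is supported on factors onto which the stabiliser projects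
  without containing them. The stabiliser attached to \<open>p\<close> contains the factors outside \<open>p\<close> and does not
  project onto those in \<open>p\<close>.
\<close>
lemma cart_CD_1:
  assumes H: "\<not> subdirect_subgroup B M \<T> H"
  shows "cart \<in> CD_1 \<Omega> G M \<T> \<omega>"
proof -
  obtain T0 where T0: "T0 \<in> \<T>" "pr {T0} ` H \<noteq> T0"
    using H subgroup_incl[OF H_subgroup M_subgroup H_subset] by (auto simp: subdirect_subgroup_def)
  have proper: "pr {T} ` H \<noteq> T" if "T \<in> \<T>" for T
    using projection_onto_factor_conj[OF that T0(1)] T0(2) by blast
  have "proper_projections B \<T> (block_stab ` cart) T = {pr {T} ` H}" if T: "T \<in> \<T>" for T
  proof -
    obtain p where p: "p \<in> \<P>" "T \<in> p" using T P_partition by (auto simp: partition_on_def)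
    show ?thesis
    proof
      show "proper_projections B \<T> (block_stab ` cart) T \<subseteq> {pr {T} ` H}"
      proof
        fix Q assume "Q \<in> proper_projections B \<T> (block_stab ` cart) T"
        then obtain q where q: "q \<in> \<P>" "Q = pr {T} ` block_stab (part_of q)" "Q \<noteq> T"
          unfolding proper_projections_def cart_eq by blast
        then show "Q \<in> {pr {T} ` H}"
          using proj_block_stab_part_of[OF q(1) T] by (simp split: if_splits)
      qed
      have eq: "pr {T} ` block_stab (part_of p) = pr {T} ` H"
        using proj_block_stab_part_of[OF p(1) T] p(2) by simp
      have "pr {T} ` block_stab (part_of p) \<in> proper_projections B \<T> (block_stab ` cart) T"
        unfolding proper_projections_def cart_eq using p(1) eq proper[OF T]
        by (intro CollectI exI[of _ "block_stab (part_of p)"]) simp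
      then show "{pr {T} ` H} \<subseteq> proper_projections B \<T> (block_stab ` cart) T"
        unfolding eq by simp
    qed
  qed
  moreover have False if "\<Gamma> \<in> cart"
    and X: "full_strip B M \<T> X" "nontrivial_strip B M \<T> X" "involved B M \<T> X (block_stab \<Gamma>)" for \<Gamma> X
  proof -
    obtain p where p: "p \<in> \<P>" "\<Gamma> = part_of p" using \<open>\<Gamma> \<in> cart\<close> unfolding cart_eq by blast
    have "strip_support B \<T> X \<noteq> {}" using X(2) by (auto simp: nontrivial_strip_def)
    then obtain T where T: "T \<in> strip_support B \<T> X" by blast
    then have TT: "T \<in> \<T>" by (simp add: strip_support_def)
    have "T \<in> p"
      using involved_full_stripD(2)[OF X T] factor_subset_block_stab_part_of_iff[OF p(1) TT] p(2) by simp
    then have "pr {T} ` H = T"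
      using involved_full_stripD(1)[OF X T] proj_block_stab_part_of[OF p(1) TT] p(2) by simp
    then show False using proper[OF TT] by simp
  qed
  ultimately show ?thesis
    unfolding CD_1_def block_stabilizers_eq using cart_CD_tr by auto
qed

end

theorem bij_betw_cartesian_of_partition:
  "bij_betw (cartesian_of_partition \<Omega> M \<T> \<omega>) (factorising_partitions \<Omega> G M \<T> \<omega>)
     (if subdirect_subgroup B M \<T> H then CD_S \<Omega> G M \<T> \<omega> else CD_1 \<Omega> G M \<T> \<omega>)"
    (is "bij_betw ?c ?F ?C")
proof (rule bij_betw_byWitness[where f' = "(`) moved_factors"])
  show "\<forall>\<P>\<in>?F. moved_factors ` ?c \<P> = \<P>" using moved_factors_cart by blast
  show "?c ` ?F \<subseteq> ?C" using cart_CD_S cart_CD_1 by auto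
  have key: "\<E> \<in> CD_tr \<Omega> G \<and> (\<forall>T\<in>\<T>. \<exists>!\<Gamma>. \<Gamma> \<in> \<E> \<and> \<not> T \<subseteq> block_stab \<Gamma>)" if "\<E> \<in> ?C" for \<E>
  proof (cases "subdirect_subgroup B M \<T> H")
    case True
    then have "\<E> \<in> CD_S \<Omega> G M \<T> \<omega>" using that by simp
    then show ?thesis using unique_moving_partition_subdirect[OF _ True] by (auto simp: CD_S_def)
  next
    case False
    then have "\<E> \<in> CD_1 \<Omega> G M \<T> \<omega>" using that by simp
    then show ?thesis using unique_moving_partition_one_projection by (auto simp: CD_1_def)
  qed
  show "\<forall>\<E>\<in>?C. ?c (moved_factors ` \<E>) = \<E>"
  proof
    fix \<E> assume "\<E> \<in> ?C"
    note k = key[OF this]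
    show "?c (moved_factors ` \<E>) = \<E>"
      by (rule cartesian_of_moved_factors(2)[OF conjunct1[OF k] bspec[OF conjunct2[OF k]]])
  qed
  show "(`) moved_factors ` ?C \<subseteq> ?F"
  proof (rule image_subsetI)
    fix \<E> assume "\<E> \<in> ?C"
    note k = key[OF this]
    show "moved_factors ` \<E> \<in> ?F"
      by (rule cartesian_of_moved_factors(1)[OF conjunct1[OF k] bspec[OF conjunct2[OF k]]])
  qed
qed

end

theorem theorem7p2:
  fixes \<Omega> :: "'a set" and G M :: "('a \<Rightarrow> 'a) set" and \<T> :: "('a \<Rightarrow> 'a) set set" and \<omega> :: 'a
  assumes "innately_transitive \<Omega> G" and "finite G"
    and "plinth \<Omega> G M" and "\<not> comm_group (perm_group \<Omega> M)"
    and "\<T> = simple_normal_subgroups (BijGroup \<Omega>) M"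
    and "internal_direct_product (BijGroup \<Omega>) M \<T> (\<lambda>T. T)"
    and "\<omega> \<in> \<Omega>"
  shows "bij_betw (cartesian_of_partition \<Omega> M \<T> \<omega>)
           (factorising_partitions \<Omega> G M \<T> \<omega>)
           (if subdirect_subgroup (BijGroup \<Omega>) M \<T> (point_stabilizer \<Omega> M \<omega>)
            then CD_S \<Omega> G M \<T> \<omega> else CD_1 \<Omega> G M \<T> \<omega>)"
proof -
  have "subgroup G (BijGroup \<Omega>)" using assms(1) by (simp add: innately_transitive_def)
  then interpret plinth_factors \<Omega> G M \<T> \<omega>
    using assms(2-7) by (rule plinth_factors.intro)
  show ?thesis by (rule bij_betw_cartesian_of_partition)
qed

end
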